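(* The relative entropy of steering $\mathscr{S}_{\mathrm R}$, defined for a normalised assemblage $\rho_{A|X}$ by $$\mathscr{S}_{\mathrm R}(\rho_{A|X}):=\min_{\sigma_{A|X}\in\mathsf{LHS}}S_{\mathrm A}(\rho_{A|X}\,\|\,\sigma_{A|X}),$$ where $S_{\mathrm A}$ is the assemblage relative entropy and the minimum is over unsteerable assemblages with the same parameters $(d,r,s)$ as $\rho_{A|X}$, is a convex steering monotone.
   Context: Notation: $[n]=\{0,\dots,n-1\}$. All index sets are finite and all Hilbert spaces finite-dimensional. Assemblages. Fix natural numbers $d,r,s\ge1$ and $\mathcal{H}_B=\mathbb{C}^d$. A (no-signaling) assemblage with parameters $(d,r,s)$ is a family $\rho_{A|X}=\{\varrho_{A|X}(a,x)\}_{a\in[r],x\in[s]}$ of positive semidefinite operators on $\mathcal{H}_B$ such that $\varrho_B:=\sum_a\varrho_{A|X}(a,x)$ does not depend on $x$. Its trace is $\mathrm{Tr}[\rho_{A|X}]:=\mathrm{Tr}[\varrho_B]$; it is normalised if this equals $1$. Scalar multiples and sums are taken componentwise. The quantum representation of $\rho_{A|X}$ is the family of operators $\hat\rho_{A|X}(x)=\sum_a|a\rangle\langle a|\otimes\varrho_{A|X}(a,x)$ on $\mathbb{C}^r\otimes\mathcal{H}_B$, $x\in[s]$, with $\{|a\rangle\}$ an orthonormal basis of $\mathbb{C}^r$. Unsteerable assemblages. A normalised assemblage $\{\varsigma_{A|X}(a,x)\}$ is unsteerable (belongs to $\mathsf{LHS}$) if there exist a probability distribution $P_\Lambda$ on a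 finite set, conditional probability distributions $P_{A|X\Lambda}$, and density operators $\xi(\lambda)$ on $\mathcal{H}_B$ with $\varsigma_{A|X}(a,x)=\sum_\lambda P_\Lambda(\lambda)P_{A|X\Lambda}(a,x,\lambda)\,\xi(\lambda)$ for all $a,x$. 1W-LOCCs. A deterministic 1W-LOCC $\mathcal{M}$ from assemblages with parameters $(d,r,s)$ to assemblages with parameters $(d_f,r_f,s_f)$ is specified by a finite set of $\omega$'s, operators $K_\omega:\mathbb{C}^d\to\mathbb{C}^{d_f}$ with $\sum_\omega K_\omega^\dagger K_\omega=\mathbb{1}$, and normalised conditional probability distributions $P(x|x_f,\omega)$ and $P(a_f|a,x,\omega,x_f)$ ($x\in[s]$, $x_f\in[s_f]$, $a\in[r]$, $a_f\in[r_f]$). It is $\mathcal{M}=\sum_\omega\mathcal{M}_\omega$, with $$[\mathcal{M}_\omega(\rho_{A|X})](a_f,x_f)=\sum_{a,x}P(x|x_f,\omega)P(a_f|a,x,\omega,x_f)\,K_\omega\,\varrho_{A|X}(a,x)\,K_\omega^\dagger .$$ Convex steering monotones. A function $\mathscr{S}$ from normalised assemblages (of all parameters) to $\mathbb{R}_{\ge0}$ is a steering monotone if (i) $\mathscr{S}(\rho_{A|X})=0$ for all $\rho_{A|X}\in\mathsf{LHS}$; and (ii) for every deterministic 1W-LOCC $\mathcal{M}=\sum_\omega\mathcal{M}_\omega$ and every normalised assemblage $\rho_{A|X}$ in its domain, with $P_\Omega(\omega)=\mathrm{Tr}[\mathcal{M}_\omega(\rho_{A|X})]$, $$\sum_\omega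 P_\Omega(\omega)\,\mathscr{S}\!\left(\frac{\mathcal{M}_\omega(\rho_{A|X})}{\mathrm{Tr}[\mathcal{M}_\omega(\rho_{A|X})]}\right)\le\mathscr{S}(\rho_{A|X})$$ (terms with $P_\Omega(\omega)=0$ are omitted). It is a convex steering monotone if in addition (iii) $\mathscr{S}(\mu\rho_{A|X}+(1-\mu)\rho'_{A|X})\le\mu\mathscr{S}(\rho_{A|X})+(1-\mu)\mathscr{S}(\rho'_{A|X})$ for all $0\le\mu\le1$ and all normalised assemblages $\rho_{A|X},\rho'_{A|X}$ with the same parameters. Relative entropies. $S_{\mathrm Q}(\varrho\|\varrho')=\mathrm{Tr}[\varrho(\log\varrho-\log\varrho')]$ is the von Neumann relative entropy of density operators ($+\infty$ if the support of $\varrho$ is not contained in that of $\varrho'$), and $S_{\mathrm C}(P\|P')=\sum_xP(x)[\log P(x)-\log P'(x)]$ is the Kullback–Leibler divergence (with the usual conventions, $+\infty$ if $P'(x)=0<P(x)$ for some $x$). For normalised assemblages $\rho_{A|X},\rho'_{A|X}$ with the same parameters, the assemblage relative entropy is $$S_{\mathrm A}(\rho_{A|X}\|\rho'_{A|X}):=\max_{P_{X|\Gamma},\{E_\gamma\}}\Big[S_{\mathrm C}(P_\Gamma\|P'_\Gamma)+\sum_{\gamma,x}P(x|\gamma)P_\Gamma(\gamma)\,S_{\mathrm Q}\Big(\tfrac{(\mathbb{1}\otimes E_\gamma)\hat\rho_{A|X}(x)(\mathbb{1}\otimes E_\gamma^\dagger)}{P_\Gamma(\gamma)}\Big\|\tfrac{(\mathbb{1}\otimes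 E_\gamma)\hat\rho'_{A|X}(x)(\mathbb{1}\otimes E_\gamma^\dagger)}{P'_\Gamma(\gamma)}\Big)\Big]\in[0,+\infty],$$ where the maximum (understood as a supremum) is over all finite families of operators $E_\gamma:\mathcal{H}_B\to\mathcal{H}_B$ with $\sum_\gamma E_\gamma^\dagger E_\gamma=\mathbb{1}$ and all conditional probability distributions $P_{X|\Gamma}$, written $P(x|\gamma)$, of $x\in[s]$ given $\gamma$; and $P_\Gamma(\gamma)=\mathrm{Tr}[E_\gamma\varrho_BE_\gamma^\dagger]$, $P'_\Gamma(\gamma)=\mathrm{Tr}[E_\gamma\varrho'_BE_\gamma^\dagger]$. Terms with $P_\Gamma(\gamma)=0$ are omitted; if $P'_\Gamma(\gamma)=0<P_\Gamma(\gamma)$ for some $\gamma$ the bracket is $+\infty$. *)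

theory Defs
  imports
    "Jordan_Normal_Form.Schur_Decomposition"
    "Jordan_Normal_Form.Matrix_Kernel"
    "HOL-Library.Extended_Real"
begin

section \<open>Operators on finite-dimensional Hilbert spaces\<close>

text \<open>The type of matrices does not fix the dimensions, so there is no zero to start a generic
  sum from; the dimensions are given explicitly and the sum is taken entrywise.\<close>

definition mat_sum :: "nat \<Rightarrow> nat \<Rightarrow> 'i set \<Rightarrow> ('i \<Rightarrow> complex mat) \<Rightarrow> complex mat" where
  "mat_sum m n I A = mat m n (\<lambda>(i, j). \<Sum>k\<in>I. A k $$ (i, j))"

definition mat_trace :: "complex mat \<Rightarrow> complex" where
  "mat_trace A = (\<Sum>i<dim_row A. A $$ (i, i))"

definition kron :: "complex mat \<Rightarrow> complex mat \<Rightarrow> complex mat" where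
  "kron A B = mat (dim_row A * dim_row B) (dim_col A * dim_col B)
     (\<lambda>(i, j). A $$ (i div dim_row B, j div dim_col B) * B $$ (i mod dim_row B, j mod dim_col B))"

definition basis_proj :: "nat \<Rightarrow> nat \<Rightarrow> complex mat" where
  "basis_proj r a = mat r r (\<lambda>(i, j). if i = a \<and> j = a then 1 else 0)"

definition psd :: "nat \<Rightarrow> complex mat \<Rightarrow> bool" where
  "psd n A \<longleftrightarrow> A \<in> carrier_mat n n \<and> mat_adjoint A = A \<and>
     (\<forall>v \<in> carrier_vec n. 0 \<le> Re ((A *\<^sub>v v) \<bullet>c v))"

definition density_op :: "nat \<Rightarrow> complex mat \<Rightarrow> bool" where
  "density_op n A \<longleftrightarrow> psd n A \<and> mat_trace A = 1"

text \<open>Functional calculus for Hermitian matrices. The result does not depend on the chosen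
  diagonalisation, so the description is definite.\<close>

definition herm_fun :: "(real \<Rightarrow> real) \<Rightarrow> complex mat \<Rightarrow> complex mat" where
  "herm_fun f A = (THE B. \<exists>U l. U \<in> carrier_mat (dim_row A) (dim_row A) \<and>
     mat_adjoint U * U = 1\<^sub>m (dim_row A) \<and>
     A = U * mat_diag (dim_row A) (\<lambda>i. complex_of_real (l i)) * mat_adjoint U \<and>
     B = U * mat_diag (dim_row A) (\<lambda>i. complex_of_real (f (l i))) * mat_adjoint U)"

text \<open>The logarithm of a positive semidefinite operator is taken on its support and is zero on its
  kernel; this encodes \<open>0 log 0 = 0\<close>.\<close>

definition mat_log :: "complex mat \<Rightarrow> complex mat" where
  "mat_log = herm_fun (\<lambda>t. if t > 0 then ln t else 0)"

definition supp :: "complex mat \<Rightarrow> complex vec set" where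
  "supp A = {v \<in> carrier_vec (dim_col A). \<forall>w \<in> mat_kernel A. v \<bullet>c w = 0}"

section \<open>Relative entropies of states and of distributions\<close>

definition prob_dist :: "nat \<Rightarrow> (nat \<Rightarrow> real) \<Rightarrow> bool" where
  "prob_dist n p \<longleftrightarrow> (\<forall>i<n. 0 \<le> p i) \<and> (\<Sum>i<n. p i) = 1"

definition S_Q :: "complex mat \<Rightarrow> complex mat \<Rightarrow> ereal" where
  "S_Q \<rho> \<rho>' = (if supp \<rho> \<subseteq> supp \<rho>'
     then ereal (Re (mat_trace (\<rho> * (mat_log \<rho> - mat_log \<rho>')))) else \<infinity>)"

definition S_C :: "nat \<Rightarrow> (nat \<Rightarrow> real) \<Rightarrow> (nat \<Rightarrow> real) \<Rightarrow> ereal" where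
  "S_C n p p' = (if \<exists>i<n. p' i = 0 \<and> 0 < p i then \<infinity>
     else ereal (\<Sum>i<n. if p i = 0 then 0 else p i * (ln (p i) - ln (p' i))))"

section \<open>Assemblages\<close>

text \<open>An assemblage with parameters \<open>(d, r, s)\<close> is a family \<open>\<rho> a x\<close> with output \<open>a < r\<close> and input
  \<open>x < s\<close>. Outside this index range it is required to be the zero operator, so that two assemblages
  with the same parameters are equal as functions iff they agree on the index range.\<close>

type_synonym assemblage = "nat \<Rightarrow> nat \<Rightarrow> complex mat"

definition is_assemblage :: "nat \<Rightarrow> nat \<Rightarrow> nat \<Rightarrow> assemblage \<Rightarrow> bool" where
  "is_assemblage d r s \<rho> \<longleftrightarrow> 1 \<le> d \<and> 1 \<le> r \<and> 1 \<le> s \<and>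
     (\<forall>a<r. \<forall>x<s. psd d (\<rho> a x)) \<and>
     (\<forall>a x. \<not> (a < r \<and> x < s) \<longrightarrow> \<rho> a x = 0\<^sub>m d d) \<and>
     (\<forall>x<s. \<forall>y<s. mat_sum d d {..<r} (\<lambda>a. \<rho> a x) = mat_sum d d {..<r} (\<lambda>a. \<rho> a y))"

text \<open>By no-signaling the marginal is the same for every input; input 0 always exists.\<close>

definition rho_B :: "nat \<Rightarrow> nat \<Rightarrow> assemblage \<Rightarrow> complex mat" where
  "rho_B d r \<rho> = mat_sum d d {..<r} (\<lambda>a. \<rho> a 0)"

definition asm_trace :: "nat \<Rightarrow> nat \<Rightarrow> assemblage \<Rightarrow> real" where
  "asm_trace d r \<rho> = Re (mat_trace (rho_B d r \<rho>))"

definition normalised_assemblages :: "nat \<Rightarrow> nat \<Rightarrow> nat \<Rightarrow> assemblage set" where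
  "normalised_assemblages d r s = {\<rho>. is_assemblage d r s \<rho> \<and> asm_trace d r \<rho> = 1}"

definition asm_scale :: "real \<Rightarrow> assemblage \<Rightarrow> assemblage" where
  "asm_scale c \<rho> = (\<lambda>a x. complex_of_real c \<cdot>\<^sub>m \<rho> a x)"

definition asm_add :: "assemblage \<Rightarrow> assemblage \<Rightarrow> assemblage" where
  "asm_add \<rho> \<rho>' = (\<lambda>a x. \<rho> a x + \<rho>' a x)"

definition quantum_rep :: "nat \<Rightarrow> nat \<Rightarrow> assemblage \<Rightarrow> nat \<Rightarrow> complex mat" where
  "quantum_rep d r \<rho> x = mat_sum (r * d) (r * d) {..<r} (\<lambda>a. kron (basis_proj r a) (\<rho> a x))"

definition LHS :: "nat \<Rightarrow> nat \<Rightarrow> nat \<Rightarrow> assemblage set" where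
  "LHS d r s = {\<sigma> \<in> normalised_assemblages d r s.
     \<exists>m (P\<^sub>\<Lambda> :: nat \<Rightarrow> real) (P\<^sub>A :: nat \<Rightarrow> nat \<Rightarrow> nat \<Rightarrow> real) (\<xi> :: nat \<Rightarrow> complex mat).
       prob_dist m P\<^sub>\<Lambda> \<and>
       (\<forall>x<s. \<forall>l<m. prob_dist r (\<lambda>a. P\<^sub>A a x l)) \<and>
       (\<forall>l<m. density_op d (\<xi> l)) \<and>
       (\<forall>a<r. \<forall>x<s. \<sigma> a x =
          mat_sum d d {..<m} (\<lambda>l. complex_of_real (P\<^sub>\<Lambda> l * P\<^sub>A a x l) \<cdot>\<^sub>m \<xi> l))}"

section \<open>One-way LOCCs and steering monotones\<close>

text \<open>A deterministic 1W-LOCC with outcomes \<open>\<omega> < n\<close>, Kraus operators \<open>K \<omega>\<close>, and conditional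
  distributions \<open>P x x\<^sub>f \<omega> = P(x | x\<^sub>f, \<omega>)\<close> and
  \<open>Q a\<^sub>f a x \<omega> x\<^sub>f = P(a\<^sub>f | a, x, \<omega>, x\<^sub>f)\<close>.\<close>

definition is_locc :: "nat \<Rightarrow> nat \<Rightarrow> nat \<Rightarrow> nat \<Rightarrow> nat \<Rightarrow> nat \<Rightarrow> nat \<Rightarrow> (nat \<Rightarrow> complex mat) \<Rightarrow>
    (nat \<Rightarrow> nat \<Rightarrow> nat \<Rightarrow> real) \<Rightarrow> (nat \<Rightarrow> nat \<Rightarrow> nat \<Rightarrow> nat \<Rightarrow> nat \<Rightarrow> real) \<Rightarrow> bool" where
  "is_locc d r s d\<^sub>f r\<^sub>f s\<^sub>f n K P Q \<longleftrightarrow>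
     1 \<le> d \<and> 1 \<le> r \<and> 1 \<le> s \<and> 1 \<le> d\<^sub>f \<and> 1 \<le> r\<^sub>f \<and> 1 \<le> s\<^sub>f \<and>
     (\<forall>\<omega><n. K \<omega> \<in> carrier_mat d\<^sub>f d) \<and>
     mat_sum d d {..<n} (\<lambda>\<omega>. mat_adjoint (K \<omega>) * K \<omega>) = 1\<^sub>m d \<and>
     (\<forall>\<omega><n. \<forall>x\<^sub>f<s\<^sub>f. prob_dist s (\<lambda>x. P x x\<^sub>f \<omega>)) \<and>
     (\<forall>\<omega><n. \<forall>x\<^sub>f<s\<^sub>f. \<forall>a<r. \<forall>x<s. prob_dist r\<^sub>f (\<lambda>a\<^sub>f. Q a\<^sub>f a x \<omega> x\<^sub>f))"

definition locc_branch :: "nat \<Rightarrow> nat \<Rightarrow> nat \<Rightarrow> nat \<Rightarrow> nat \<Rightarrow> (nat \<Rightarrow> complex mat) \<Rightarrow>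
    (nat \<Rightarrow> nat \<Rightarrow> nat \<Rightarrow> real) \<Rightarrow> (nat \<Rightarrow> nat \<Rightarrow> nat \<Rightarrow> nat \<Rightarrow> nat \<Rightarrow> real) \<Rightarrow> nat \<Rightarrow>
    assemblage \<Rightarrow> assemblage" where
  "locc_branch r s d\<^sub>f r\<^sub>f s\<^sub>f K P Q \<omega> \<rho> = (\<lambda>a\<^sub>f x\<^sub>f.
     if a\<^sub>f < r\<^sub>f \<and> x\<^sub>f < s\<^sub>f
     then mat_sum d\<^sub>f d\<^sub>f ({..<r} \<times> {..<s}) (\<lambda>(a, x).
       complex_of_real (P x x\<^sub>f \<omega> * Q a\<^sub>f a x \<omega> x\<^sub>f) \<cdot>\<^sub>m (K \<omega> * \<rho> a x * mat_adjoint (K \<omega>)))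
     else 0\<^sub>m d\<^sub>f d\<^sub>f)"

text \<open>A function of normalised assemblages of all parameters: the first three arguments of \<open>S\<close> are
  \<open>d\<close>, \<open>r\<close>, \<open>s\<close>, and only its values on \<open>normalised_assemblages d r s\<close> matter.\<close>

definition steering_monotone :: "(nat \<Rightarrow> nat \<Rightarrow> nat \<Rightarrow> assemblage \<Rightarrow> real) \<Rightarrow> bool" where
  "steering_monotone S \<longleftrightarrow>
     (\<forall>d r s. \<forall>\<rho> \<in> normalised_assemblages d r s. 0 \<le> S d r s \<rho>) \<and>
     (\<forall>d r s. \<forall>\<rho> \<in> LHS d r s. S d r s \<rho> = 0) \<and>
     (\<forall>d r s d\<^sub>f r\<^sub>f s\<^sub>f n K P Q. is_locc d r s d\<^sub>f r\<^sub>f s\<^sub>f n K P Q \<longrightarrow>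
        (\<forall>\<rho> \<in> normalised_assemblages d r s.
          (\<Sum>\<omega><n. let M = locc_branch r s d\<^sub>f r\<^sub>f s\<^sub>f K P Q \<omega> \<rho>; p = asm_trace d\<^sub>f r\<^sub>f M
             in if p = 0 then 0 else p * S d\<^sub>f r\<^sub>f s\<^sub>f (asm_scale (1 / p) M))
          \<le> S d r s \<rho>))"

definition convex_steering_monotone :: "(nat \<Rightarrow> nat \<Rightarrow> nat \<Rightarrow> assemblage \<Rightarrow> real) \<Rightarrow> bool" where
  "convex_steering_monotone S \<longleftrightarrow> steering_monotone S \<and>
     (\<forall>d r s. \<forall>\<rho> \<in> normalised_assemblages d r s. \<forall>\<rho>' \<in> normalised_assemblages d r s.
        \<forall>\<mu>. 0 \<le> \<mu> \<and> \<mu> \<le> 1 \<longrightarrow>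
          S d r s (asm_add (asm_scale \<mu> \<rho>) (asm_scale (1 - \<mu>) \<rho>'))
          \<le> \<mu> * S d r s \<rho> + (1 - \<mu>) * S d r s \<rho>')"

section \<open>Assemblage relative entropy and relative entropy of steering\<close>

definition P_Gamma :: "nat \<Rightarrow> nat \<Rightarrow> (nat \<Rightarrow> complex mat) \<Rightarrow> assemblage \<Rightarrow> nat \<Rightarrow> real" where
  "P_Gamma d r E \<rho> \<gamma> = Re (mat_trace (E \<gamma> * rho_B d r \<rho> * mat_adjoint (E \<gamma>)))"

definition post_meas :: "nat \<Rightarrow> nat \<Rightarrow> (nat \<Rightarrow> complex mat) \<Rightarrow> assemblage \<Rightarrow> nat \<Rightarrow> nat \<Rightarrow>
    complex mat" where
  "post_meas d r E \<rho> \<gamma> x = complex_of_real (1 / P_Gamma d r E \<rho> \<gamma>) \<cdot>\<^sub>m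
     (kron (1\<^sub>m r) (E \<gamma>) * quantum_rep d r \<rho> x * kron (1\<^sub>m r) (mat_adjoint (E \<gamma>)))"

text \<open>\<open>P x \<gamma>\<close> is the probability \<open>P(x | \<gamma>)\<close>. If \<open>P_Gamma\<close> vanishes for \<open>\<rho>'\<close> but not for
  \<open>\<rho>\<close> at some \<open>\<gamma>\<close>, then \<open>S_C\<close> is \<open>\<infinity>\<close> and hence so is the whole expression, because
  \<open>\<infinity> + z = \<infinity>\<close> for every \<open>z\<close>. Also \<open>0 * \<infinity> = 0\<close>.\<close>

definition S_A_value :: "nat \<Rightarrow> nat \<Rightarrow> nat \<Rightarrow> nat \<Rightarrow> (nat \<Rightarrow> complex mat) \<Rightarrow>
    (nat \<Rightarrow> nat \<Rightarrow> real) \<Rightarrow> assemblage \<Rightarrow> assemblage \<Rightarrow> ereal" where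
  "S_A_value d r s g E P \<rho> \<rho>' =
     S_C g (P_Gamma d r E \<rho>) (P_Gamma d r E \<rho>') +
     (\<Sum>\<gamma><g. \<Sum>x<s. if P_Gamma d r E \<rho> \<gamma> = 0 then 0
        else ereal (P x \<gamma> * P_Gamma d r E \<rho> \<gamma>) *
          S_Q (post_meas d r E \<rho> \<gamma> x) (post_meas d r E \<rho>' \<gamma> x))"

definition S_A :: "nat \<Rightarrow> nat \<Rightarrow> nat \<Rightarrow> assemblage \<Rightarrow> assemblage \<Rightarrow> ereal" where
  "S_A d r s \<rho> \<rho>' = Sup {S_A_value d r s g E P \<rho> \<rho>' | g E P.
     (\<forall>\<gamma><g. E \<gamma> \<in> carrier_mat d d) \<and>
     mat_sum d d {..<g} (\<lambda>\<gamma>. mat_adjoint (E \<gamma>) * E \<gamma>) = 1\<^sub>m d \<and>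
     (\<forall>\<gamma><g. prob_dist s (\<lambda>x. P x \<gamma>))}"

definition S_R :: "nat \<Rightarrow> nat \<Rightarrow> nat \<Rightarrow> assemblage \<Rightarrow> ereal" where
  "S_R d r s \<rho> = (INF \<sigma> \<in> LHS d r s. S_A d r s \<rho> \<sigma>)"

end

theory Submission
  imports "HOL-Analysis.Equivalence_Lebesgue_Henstock_Integration" Defs
begin

text \<open>The function \<open>a (ln a - ln b) - a + b\<close> is the integral of \<open>t (b - a)\<^sup>2 / (t b + (1 - t) a)\<close> over
  \<open>0 < t < 1\<close>. Hence the relative entropy of positive matrices \<open>A\<close>, \<open>B\<close> is, up to the term \<open>Tr A - Tr B\<close>,
  the integral of \<open>t\<close> times the quadratic form of the inverse of \<open>T = t R + (1 - t) L\<close> at \<open>B - A\<close>, where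
  \<open>L\<close> is left multiplication by \<open>A\<close> and \<open>R\<close> is right multiplication by \<open>B\<close>. This form is the supremum over
  \<open>X\<close> of \<open>2 Re \<langle>X, B - A\<rangle> - \<langle>X, T X\<rangle>\<close>, which is linear in the pair \<open>(A, B)\<close>. Joint convexity, lower
  semicontinuity and monotonicity under partial isometries can all be read off from this supremum.

  For normalised assemblages the bracket in the definition of the assemblage relative entropy collapses
  to the sum over \<open>\<gamma>\<close>, \<open>x\<close>, \<open>a\<close> of \<open>P(x|\<gamma>)\<close> times the divergence of \<open>E\<^sub>\<gamma> \<rho>(a,x) E\<^sub>\<gamma>\<^sup>\<dagger>\<close> from
  \<open>E\<^sub>\<gamma> \<sigma>(a,x) E\<^sub>\<gamma>\<^sup>\<dagger>\<close>. Joint convexity then gives convexity of the relative entropy of steering, and it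
  gives monotonicity because a measurement made after a one-way LOCC is a measurement on the original
  assemblage. The minimum is finite since \<open>\<rho>(a,x) \<le> \<rho>\<^sub>B\<close>, and it is attained since the unsteerable
  assemblages form a compact set.\<close>

text \<open>Most inequalities for the divergence are proved for a fixed trial matrix
  \<open>X\<close> and a fixed \<open>t\<close>, then pass to the supremum and to the integral. The
  closed form in eigenbases supplies the rest: measurability in \<open>t\<close>, the logarithmic
  formula, rescaling and block sums.

  The correction by traces keeps the divergence nonnegative for unnormalised matrices as well. Its
  values, finite or not, can therefore be added freely in \<open>ennreal\<close>, and each block of
  an assemblage is treated separately. Weighted by the distribution of inputs, the traces of each
  normalised assemblage total 1, so all corrections cancel.

  Three obstacles shape monotonicity. Kraus operators may be rectangular while \<open>S_A\<close>
  measures with square ones. The supremum in \<open>S_A\<close> is only approached, so nearly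
  optimal measurements are chosen for every outcome. Finally, an optimal unsteerable assemblage must
  give positive probability to each outcome that \<open>\<rho>\<close> gives; this comes from
  finiteness of the minimum, which is why existence and finiteness are settled first.\<close>

unbundle no vec_syntax
unbundle no inner_syntax

notation mat_adjoint (\<open>_\<^sup>\<dagger>\<close> [1000] 999)

section \<open>Adjoints, traces and the spectral theorem\<close>

lemma dim_adjoint [simp]:
  "dim_row (A\<^sup>\<dagger>) = dim_col A" "dim_col (A\<^sup>\<dagger>) = dim_row A"
  by (simp_all add: mat_adjoint_def)

lemma adjoint_carrier [simp]: "A \<in> carrier_mat m n \<Longrightarrow> A\<^sup>\<dagger> \<in> carrier_mat n m"
  by (intro carrier_matI) (auto dest: carrier_matD)

lemma adjoint_index [simp]:
  fixes A :: "complex mat"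
  shows "i < dim_col A \<Longrightarrow> j < dim_row A \<Longrightarrow> A\<^sup>\<dagger> $$ (i, j) = cnj (A $$ (j, i))"
  by (simp add: mat_adjoint_def mat_of_rows_index)

lemma mult_index:
  fixes A :: "'a::comm_semiring_0 mat"
  assumes "A \<in> carrier_mat m n" "B \<in> carrier_mat n k" "i < m" "j < k"
  shows "(A * B) $$ (i, j) = (\<Sum>l<n. A $$ (i, l) * B $$ (l, j))"
  using assms by (simp add: scalar_prod_def atLeast0LessThan)

lemma adjoint_mult:
  fixes A :: "complex mat"
  assumes "A \<in> carrier_mat m n" "B \<in> carrier_mat n k"
  shows "(A * B)\<^sup>\<dagger> = B\<^sup>\<dagger> * A\<^sup>\<dagger>"
proof (rule eq_matI)
  fix i j assume "i < dim_row (B\<^sup>\<dagger> * A\<^sup>\<dagger>)" "j < dim_col (B\<^sup>\<dagger> * A\<^sup>\<dagger>)"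
  then have ij: "i < k" "j < m" using assms by auto
  have "(B\<^sup>\<dagger> * A\<^sup>\<dagger>) $$ (i, j) = (\<Sum>l<n. B\<^sup>\<dagger> $$ (i, l) * A\<^sup>\<dagger> $$ (l, j))"
    by (rule mult_index[OF adjoint_carrier[OF assms(2)] adjoint_carrier[OF assms(1)] ij])
  also have "\<dots> = (\<Sum>l<n. cnj (A $$ (j, l) * B $$ (l, i)))"
    using assms ij by (intro sum.cong refl) auto
  also have "\<dots> = cnj ((A * B) $$ (j, i))"
    unfolding mult_index[OF assms ij(2,1)] by simp
  also have "\<dots> = (A * B)\<^sup>\<dagger> $$ (i, j)"
    using assms ij by simp
  finally show "(A * B)\<^sup>\<dagger> $$ (i, j) = (B\<^sup>\<dagger> * A\<^sup>\<dagger>) $$ (i, j)" ..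
qed (use assms in auto)

lemma adjoint_adjoint [simp]: "(A\<^sup>\<dagger>)\<^sup>\<dagger> = (A :: complex mat)"
  by (rule eq_matI) auto

lemma adjoint_minus:
  fixes A :: "complex mat"
  assumes "A \<in> carrier_mat m n" "B \<in> carrier_mat m n"
  shows "(A - B)\<^sup>\<dagger> = A\<^sup>\<dagger> - B\<^sup>\<dagger>"
  using assms by (intro eq_matI) auto

lemma adjoint_add:
  fixes A :: "complex mat"
  assumes "A \<in> carrier_mat m n" "B \<in> carrier_mat m n"
  shows "(A + B)\<^sup>\<dagger> = A\<^sup>\<dagger> + B\<^sup>\<dagger>"
  using assms by (intro eq_matI) auto

lemma adjoint_smult: "(c \<cdot>\<^sub>m A)\<^sup>\<dagger> = cnj c \<cdot>\<^sub>m (A :: complex mat)\<^sup>\<dagger>"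
  by (rule eq_matI) auto

lemma adjoint_one [simp]: "(1\<^sub>m n :: complex mat)\<^sup>\<dagger> = 1\<^sub>m n"
  by (rule eq_matI) auto

lemma mat_diag_index [simp]:
  "i < n \<Longrightarrow> j < n \<Longrightarrow> mat_diag n f $$ (i, j) = (if i = j then f j else 0)"
  by (simp add: mat_diag_def)

lemma dim_mat_diag [simp]: "dim_row (mat_diag n f) = n" "dim_col (mat_diag n f) = n"
  by (simp_all add: mat_diag_def)

lemma adjoint_mat_diag_real [simp]:
  "(mat_diag n (\<lambda>i. complex_of_real (l i)))\<^sup>\<dagger> = mat_diag n (\<lambda>i. complex_of_real (l i))"
  by (rule eq_matI) auto

lemma trace_mult:
  assumes "A \<in> carrier_mat m n" "B \<in> carrier_mat n m"
  shows "mat_trace (A * B) = (\<Sum>i<m. \<Sum>j<n. A $$ (i, j) * B $$ (j, i))"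
  using assms by (simp add: mat_trace_def mult_index[OF assms] del: index_mult_mat(1))

lemma trace_comm:
  assumes "A \<in> carrier_mat m n" "B \<in> carrier_mat n m"
  shows "mat_trace (A * B) = mat_trace (B * A)"
  unfolding trace_mult[OF assms] trace_mult[OF assms(2,1)]
  by (subst sum.swap) (simp add: mult.commute)

lemma trace_add:
  assumes "A \<in> carrier_mat n n" "B \<in> carrier_mat n n"
  shows "mat_trace (A + B) = mat_trace A + mat_trace B"
  using assms by (simp add: mat_trace_def sum.distrib)

lemma trace_minus:
  assumes "A \<in> carrier_mat n n" "B \<in> carrier_mat n n"
  shows "mat_trace (A - B) = mat_trace A - mat_trace B"
  using assms by (simp add: mat_trace_def sum_subtractf)

lemma trace_smult: "mat_trace (c \<cdot>\<^sub>m A) = c * mat_trace A" if "A \<in> carrier_mat n n"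
  using that by (simp add: mat_trace_def sum_distrib_left)

lemma trace_zero [simp]: "mat_trace (0\<^sub>m n n) = 0"
  by (simp add: mat_trace_def)

text \<open>This is the squared Hilbert-Schmidt norm, so a Gram matrix of trace zero can only come
  from the zero matrix.\<close>

lemma trace_gram:
  assumes "C \<in> carrier_mat m n"
  shows "mat_trace (C * C\<^sup>\<dagger>) = of_real (\<Sum>i<m. \<Sum>j<n. (cmod (C $$ (i, j)))\<^sup>2)"
  using assms by (simp add: trace_mult[OF assms adjoint_carrier[OF assms]] complex_norm_square del: of_real_power)

lemma mult_adjoint_eq_0:
  fixes C :: "complex mat"
  assumes C: "C \<in> carrier_mat m n" and 0: "C * C\<^sup>\<dagger> = 0\<^sub>m m m"
  shows "C = 0\<^sub>m m n"
proof -
  have "(\<Sum>i<m. \<Sum>j<n. (cmod (C $$ (i, j)))\<^sup>2) = 0"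
    using trace_gram[OF C] unfolding 0 by (metis of_real_eq_0_iff trace_zero)
  then have "\<forall>i<m. (\<Sum>j<n. (cmod (C $$ (i, j)))\<^sup>2) = 0"
    by (subst (asm) sum_nonneg_eq_0_iff) (auto intro: sum_nonneg)
  then have "\<forall>i<m. \<forall>j<n. C $$ (i, j) = 0"
    by (subst (asm) sum_nonneg_eq_0_iff) auto
  then show ?thesis using C by (intro eq_matI) auto
qed

lemma unitary_commute:
  fixes U :: "complex mat"
  assumes "U \<in> carrier_mat n n" "U\<^sup>\<dagger> * U = 1\<^sub>m n"
  shows "U * U\<^sup>\<dagger> = 1\<^sub>m n"
  using mat_mult_left_right_inverse[OF adjoint_carrier[OF assms(1)] assms] .

text \<open>The data are those quantified over in \<open>herm_fun\<close>, so any decomposition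
  found by the spectral theorem also computes the matrix logarithm. Eigenvalues are listed with
  multiplicity and in no particular order.\<close>

definition diagonalises :: "nat \<Rightarrow> complex mat \<Rightarrow> (nat \<Rightarrow> real) \<Rightarrow> complex mat \<Rightarrow> bool" where
  "diagonalises n U l A \<longleftrightarrow> U \<in> carrier_mat n n \<and> U\<^sup>\<dagger> * U = 1\<^sub>m n \<and>
     A = U * mat_diag n (\<lambda>i. complex_of_real (l i)) * U\<^sup>\<dagger>"

lemma diagonalisesD:
  assumes "diagonalises n U l A"
  shows "U \<in> carrier_mat n n" "U\<^sup>\<dagger> * U = 1\<^sub>m n" "U * U\<^sup>\<dagger> = 1\<^sub>m n"
    "A = U * mat_diag n (\<lambda>i. complex_of_real (l i)) * U\<^sup>\<dagger>" "A \<in> carrier_mat n n"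
proof -
  show *: "U \<in> carrier_mat n n" "U\<^sup>\<dagger> * U = 1\<^sub>m n"
    "A = U * mat_diag n (\<lambda>i. complex_of_real (l i)) * U\<^sup>\<dagger>"
    using assms by (auto simp: diagonalises_def)
  show "U * U\<^sup>\<dagger> = 1\<^sub>m n" by (rule unitary_commute) (use * in auto)
  show "A \<in> carrier_mat n n"
    unfolding *(3) using *(1) by (auto intro!: mult_carrier_mat[of _ _ n])
qed

section \<open>The spectral theorem for Hermitian matrices\<close>

lemma exists_eigenvector:
  fixes A :: "complex mat"
  assumes "A \<in> carrier_mat n n" "0 < n"
  obtains v e where "v \<in> carrier_vec n" "v \<noteq> 0\<^sub>v n" "A *\<^sub>v v = e \<cdot>\<^sub>v v"
proof -
  have "degree (char_poly A) = n" using degree_monic_char_poly[OF assms(1)] by auto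
  then have "\<not> constant (poly (char_poly A))" using assms(2) by (simp add: constant_degree)
  then obtain e where "poly (char_poly A) e = 0" using fundamental_theorem_of_algebra by blast
  then have "eigenvalue A e" using eigenvalue_root_char_poly[OF assms(1)] by simp
  then obtain v where "eigenvector A v e" by (auto simp: eigenvalue_def)
  then show ?thesis using that assms(1) by (auto simp: eigenvector_def)
qed

lemma cscalar_prod_self:
  fixes v :: "complex vec"
  assumes "v \<in> carrier_vec n" "v \<noteq> 0\<^sub>v n"
  shows "v \<bullet>c v = of_real (Re (v \<bullet>c v))" "0 < Re (v \<bullet>c v)"
proof -
  have eq: "v \<bullet>c v = of_real (\<Sum>i<n. (cmod (v $ i))\<^sup>2)"
    using assms(1) by (simp add: scalar_prod_def atLeast0LessThan complex_norm_square del: of_real_power)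
  then show "v \<bullet>c v = of_real (Re (v \<bullet>c v))" by (metis Re_complex_of_real)
  have "v \<bullet>c v \<noteq> 0" using assms conjugate_square_eq_0_vec[OF assms(1)] by auto
  then show "0 < Re (v \<bullet>c v)"
    unfolding eq by (metis Re_complex_of_real less_eq_real_def of_real_0 sum_nonneg zero_le_power2)
qed

text \<open>Gram-Schmidt yields orthogonal vectors that need not have norm 1, so each column is
  rescaled. The process keeps the first vector, hence the first column stays a multiple of
  \<open>v\<close>, which is what deflation by an eigenvector requires.\<close>

lemma unitary_with_first_column:
  fixes v :: "complex vec"
  assumes v: "v \<in> carrier_vec n" "v \<noteq> 0\<^sub>v n" and n: "0 < n"
  obtains W c where "W \<in> carrier_mat n n" "W\<^sup>\<dagger> * W = 1\<^sub>m n" "col W 0 = c \<cdot>\<^sub>v v"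
proof -
  interpret cof_vec_space n "TYPE(complex)" .
  define ws where "ws = gram_schmidt n (basis_completion v)"
  note b = basis_completion[OF v]
  note g = gram_schmidt_result[OF b(2,4,5) ws_def]
  have len: "length ws = n" using g b by simp
  have bn: "basis_completion v \<noteq> []" using b(6) n by auto
  have hd: "ws ! 0 = v"
  proof -
    have "hd ws = v"
      using gram_schmidt_hd[of v "tl (basis_completion v)"] v b(7) bn unfolding ws_def
      by (metis list.collapse)
    then show ?thesis using len n by (metis hd_conv_nth length_0_conv not_less_iff_gr_or_eq)
  qed
  define c where "c = (\<lambda>j. 1 / complex_of_real (sqrt (Re (ws ! j \<bullet>c ws ! j))))"
  define W where "W = mat n n (\<lambda>(i, j). c j * ws ! j $ i)"
  have W: "W \<in> carrier_mat n n" by (simp add: W_def)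
  have ws: "ws ! j \<in> carrier_vec n" if "j < n" for j using g(3) len that by auto
  have ws0: "ws ! j \<noteq> 0\<^sub>v n" if "j < n" for j
    using corthogonalD[OF g(2), of j j] len that ws[OF that] by auto
  have "W\<^sup>\<dagger> * W = 1\<^sub>m n"
  proof (rule eq_matI)
    fix i j assume "i < dim_row (1\<^sub>m n :: complex mat)" "j < dim_col (1\<^sub>m n :: complex mat)"
    then have ij: "i < n" "j < n" by auto
    have "(W\<^sup>\<dagger> * W) $$ (i, j) = (\<Sum>k<n. cnj (c i) * c j * (ws ! j $ k * cnj (ws ! i $ k)))"
      using ij W unfolding mult_index[OF adjoint_carrier[OF W] W ij]
      by (intro sum.cong refl) (auto simp: W_def)
    also have "\<dots> = cnj (c i) * c j * (ws ! j \<bullet>c ws ! i)"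
      using ws[OF ij(1)] ws[OF ij(2)]
      by (simp add: scalar_prod_def atLeast0LessThan sum_distrib_left)
    also have "\<dots> = (if i = j then 1 else 0)"
    proof (cases "i = j")
      case True
      define q where "q = Re (ws ! i \<bullet>c ws ! i)"
      have q: "ws ! i \<bullet>c ws ! i = of_real q" "q > 0"
        using cscalar_prod_self[OF ws[OF ij(1)] ws0[OF ij(1)]] by (auto simp: q_def)
      have "cnj (c i) * c i = 1 / of_real (sqrt q * sqrt q)"
        unfolding c_def q_def[symmetric] by (simp only: complex_cnj_divide complex_cnj_one complex_cnj_complex_of_real times_divide_times_eq mult_1 of_real_mult)
      also have "sqrt q * sqrt q = q" using q by simp
      finally have "cnj (c i) * c i = 1 / of_real q" .
      then show ?thesis using True q by simp
    next
      case False
      then show ?thesis using corthogonalD[OF g(2), of j i] ij len by auto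
    qed
    finally show "(W\<^sup>\<dagger> * W) $$ (i, j) = 1\<^sub>m n $$ (i, j)" using ij by simp
  qed (use W in auto)
  moreover have "col W 0 = c 0 \<cdot>\<^sub>v v"
    using n v(1) hd by (intro eq_vecI) (auto simp: W_def)
  ultimately show ?thesis using that W by blast
qed

lemma adjoint_four_block:
  fixes A :: "complex mat"
  assumes "A \<in> carrier_mat p p" "D \<in> carrier_mat q q"
  shows "(four_block_mat A (0\<^sub>m p q) (0\<^sub>m q p) D)\<^sup>\<dagger> = four_block_mat (A\<^sup>\<dagger>) (0\<^sub>m p q) (0\<^sub>m q p) (D\<^sup>\<dagger>)"
  using assms by (intro eq_matI) auto

lemma mult_four_block_diag:
  fixes A :: "complex mat"
  assumes "A \<in> carrier_mat p p" "A' \<in> carrier_mat p p" "D \<in> carrier_mat q q" "D' \<in> carrier_mat q q"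
  shows "four_block_mat A (0\<^sub>m p q) (0\<^sub>m q p) D * four_block_mat A' (0\<^sub>m p q) (0\<^sub>m q p) D'
    = four_block_mat (A * A') (0\<^sub>m p q) (0\<^sub>m q p) (D * D')"
  using assms by (subst mult_four_block_mat[of _ p p _ q _ q]) auto

text \<open>Induction by deflation. Conjugation with a unitary whose first column is an eigenvector
  clears the rest of the first column, and Hermiticity then clears the first row. The induction
  hypothesis diagonalises the remaining block.\<close>

theorem hermitian_diagonalisable:
  assumes "A \<in> carrier_mat n n" "A\<^sup>\<dagger> = A"
  shows "\<exists>U l. diagonalises n U l A"
  using assms
proof (induction n arbitrary: A)
  case 0
  then show ?case
    by (intro exI[of _ "1\<^sub>m 0"] exI[of _ "\<lambda>_. 0"]) (auto simp: diagonalises_def intro!: eq_matI)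
next
  case (Suc m)
  let ?n = "Suc m"
  note A = Suc.prems(1)
  obtain v e where v: "v \<in> carrier_vec ?n" "v \<noteq> 0\<^sub>v ?n" "A *\<^sub>v v = e \<cdot>\<^sub>v v"
    using exists_eigenvector[OF A] by auto
  obtain W c where W: "W \<in> carrier_mat ?n ?n" "W\<^sup>\<dagger> * W = 1\<^sub>m ?n" "col W 0 = c \<cdot>\<^sub>v v"
    using unitary_with_first_column[OF v(1,2)] by auto
  have W': "W\<^sup>\<dagger> \<in> carrier_mat ?n ?n" using W(1) by simp
  note WW = unitary_commute[OF W(1,2)]
  define B where "B = W\<^sup>\<dagger> * (A * W)"
  have AW: "A * W \<in> carrier_mat ?n ?n" using A W by simp
  have B: "B \<in> carrier_mat ?n ?n" using A W' AW by (simp add: B_def)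
  have Bh: "B\<^sup>\<dagger> = B"
    unfolding B_def using A W(1) W' AW Suc.prems(2)
    by (simp add: adjoint_mult[OF W' AW] adjoint_mult[OF A W(1)] assoc_mult_mat[OF W' A W(1)])
  have AW0: "(A * W) $$ (k, 0) = e * W $$ (k, 0)" if "k < ?n" for k
  proof -
    have "(A * W) $$ (k, 0) = (A *\<^sub>v col W 0) $ k" using A W(1) that by auto
    also have "A *\<^sub>v col W 0 = e \<cdot>\<^sub>v col W 0"
      using A v unfolding W(3)
      by (simp add: mult_mat_vec[OF A v(1)] smult_smult_assoc mult.commute)
    finally show ?thesis using W(1) that by simp
  qed
  have B0: "B $$ (i, 0) = (if i = 0 then e else 0)" if "i < ?n" for i
  proof -
    have "B $$ (i, 0) = (\<Sum>k<?n. W\<^sup>\<dagger> $$ (i, k) * (A * W) $$ (k, 0))"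
      unfolding B_def using that by (subst mult_index[OF W' AW]) auto
    also have "\<dots> = e * (\<Sum>k<?n. W\<^sup>\<dagger> $$ (i, k) * W $$ (k, 0))"
      unfolding sum_distrib_left by (intro sum.cong refl) (auto simp: AW0)
    also have "(\<Sum>k<?n. W\<^sup>\<dagger> $$ (i, k) * W $$ (k, 0)) = (W\<^sup>\<dagger> * W) $$ (i, 0)"
      using that by (subst mult_index[OF W' W(1)]) auto
    also have "e * \<dots> = (if i = 0 then e else 0)" unfolding W(2) using that by simp
    finally show ?thesis .
  qed
  have Bsym: "B $$ (i, j) = cnj (B $$ (j, i))" if "i < ?n" "j < ?n" for i j
    using arg_cong[OF Bh, of "\<lambda>X. X $$ (i, j)"] that B by simp
  \<comment> \<open>The eigenvalue is a diagonal entry of a Hermitian matrix, hence real, and fits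
    into the real list \<open>l\<close>.\<close>
  have e: "e = complex_of_real (Re e)"
    using Bsym[of 0 0] B0[of 0] by (simp add: complex_eq_iff)
  define A3 where "A3 = mat m m (\<lambda>(i, j). B $$ (Suc i, Suc j))"
  have A3: "A3 \<in> carrier_mat m m" by (simp add: A3_def)
  have "A3\<^sup>\<dagger> = A3" by (rule eq_matI) (auto simp: A3_def Bsym[symmetric])
  from Suc.IH[OF A3 this] obtain U3 l3 where "diagonalises m U3 l3 A3" by blast
  note U3 = diagonalisesD[OF this]
  have Bblock: "B = four_block_mat (e \<cdot>\<^sub>m 1\<^sub>m 1) (0\<^sub>m 1 m) (0\<^sub>m m 1) A3"
  proof (rule eq_matI)
    fix i j assume "i < dim_row (four_block_mat (e \<cdot>\<^sub>m 1\<^sub>m 1) (0\<^sub>m 1 m) (0\<^sub>m m 1) A3)"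
      "j < dim_col (four_block_mat (e \<cdot>\<^sub>m 1\<^sub>m 1) (0\<^sub>m 1 m) (0\<^sub>m m 1) A3)"
    then have ij: "i < ?n" "j < ?n" using A3 by auto
    show "B $$ (i, j) = four_block_mat (e \<cdot>\<^sub>m 1\<^sub>m 1) (0\<^sub>m 1 m) (0\<^sub>m m 1) A3 $$ (i, j)"
      using ij A3 B0[OF ij(1)] B0[OF ij(2)] Bsym[OF ij]
      by (cases i; cases j) (auto simp: A3_def)
  qed (use B A3 in auto)
  define P where "P = four_block_mat (1\<^sub>m 1) (0\<^sub>m 1 m) (0\<^sub>m m 1) U3"
  define l where "l = (\<lambda>i. case i of 0 \<Rightarrow> Re e | Suc k \<Rightarrow> l3 k)"
  let ?D = "mat_diag ?n (\<lambda>i. complex_of_real (l i))"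
  let ?D3 = "mat_diag m (\<lambda>i. complex_of_real (l3 i))"
  have P: "P \<in> carrier_mat ?n ?n" using U3(1) by (auto simp: P_def)
  have P': "P\<^sup>\<dagger> = four_block_mat (1\<^sub>m 1) (0\<^sub>m 1 m) (0\<^sub>m m 1) (U3\<^sup>\<dagger>)"
    unfolding P_def using adjoint_four_block[OF _ U3(1), of "1\<^sub>m 1" 1] by simp
  have D: "?D = four_block_mat (e \<cdot>\<^sub>m 1\<^sub>m 1) (0\<^sub>m 1 m) (0\<^sub>m m 1) ?D3"
    by (rule eq_matI) (use e in \<open>auto simp: l_def split: nat.splits\<close>)
  have PP: "P\<^sup>\<dagger> * P = 1\<^sub>m ?n"
    unfolding P' unfolding P_def
    by (subst mult_four_block_diag) (use U3 in auto)
  have BP: "B = P * ?D * P\<^sup>\<dagger>"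
    unfolding P' unfolding P_def D Bblock
    by (subst mult_four_block_diag; use U3 in simp)
       (subst mult_four_block_diag, use U3 in auto)
  let ?U = "W * P"
  have "A = W * B * W\<^sup>\<dagger>"
  proof -
    have "W * B = A * W" unfolding B_def
      using assoc_mult_mat[OF W(1) W' AW] unfolding WW left_mult_one_mat[OF AW] ..
    then show ?thesis using assoc_mult_mat[OF A W(1) W'] WW A by simp
  qed
  also have "\<dots> = ?U * ?D * ?U\<^sup>\<dagger>"
    unfolding BP adjoint_mult[OF W(1) P] using W P
    by (simp add: mult_carrier_mat[of _ ?n ?n _ ?n] assoc_mult_mat[of _ ?n ?n _ ?n _ ?n])
  finally have "A = ?U * ?D * ?U\<^sup>\<dagger>" .
  moreover have "?U\<^sup>\<dagger> * ?U = 1\<^sub>m ?n"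
  proof -
    have "?U\<^sup>\<dagger> * ?U = P\<^sup>\<dagger> * ((W\<^sup>\<dagger> * W) * P)"
      unfolding adjoint_mult[OF W(1) P] using W(1) P
      by (simp add: mult_carrier_mat[of _ ?n ?n _ ?n] assoc_mult_mat[of _ ?n ?n _ ?n _ ?n])
    then show ?thesis using W(2) PP P by simp
  qed
  moreover have "?U \<in> carrier_mat ?n ?n" using W(1) P by (rule mult_carrier_mat)
  ultimately have "diagonalises ?n ?U l A" by (simp only: diagonalises_def simp_thms)
  then show ?case by blast
qed

section \<open>Positive semidefinite matrices\<close>

lemma quad_form:
  fixes A :: "complex mat"
  assumes "A \<in> carrier_mat m n" "v \<in> carrier_vec n" "w \<in> carrier_vec m"
  shows "(A *\<^sub>v v) \<bullet>c w = (\<Sum>i<m. \<Sum>j<n. A $$ (i, j) * v $ j * cnj (w $ i))"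
  using assms
  by (simp add: scalar_prod_def atLeast0LessThan sum_distrib_right)

lemma cscalar_prod_adjoint:
  fixes A :: "complex mat"
  assumes "A \<in> carrier_mat m n" "v \<in> carrier_vec n" "w \<in> carrier_vec m"
  shows "(A *\<^sub>v v) \<bullet>c w = v \<bullet>c (A\<^sup>\<dagger> *\<^sub>v w)"
proof -
  have "v \<bullet>c (A\<^sup>\<dagger> *\<^sub>v w) = (\<Sum>j<n. \<Sum>i<m. A $$ (i, j) * v $ j * cnj (w $ i))"
    using assms
    by (simp add: scalar_prod_def atLeast0LessThan sum_distrib_left mult_ac)
  then show ?thesis unfolding quad_form[OF assms] by (subst sum.swap) simp
qed

lemma psdD:
  assumes "psd n A"
  shows "A \<in> carrier_mat n n" "A\<^sup>\<dagger> = A"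
    "\<And>v. v \<in> carrier_vec n \<Longrightarrow> 0 \<le> Re ((A *\<^sub>v v) \<bullet>c v)"
  using assms by (auto simp: psd_def)

lemma psd_gram:
  assumes C: "C \<in> carrier_mat n m"
  shows "psd n (C * C\<^sup>\<dagger>)"
  unfolding psd_def
proof (intro conjI ballI)
  have C': "C\<^sup>\<dagger> \<in> carrier_mat m n" using C by simp
  show "C * C\<^sup>\<dagger> \<in> carrier_mat n n" using C C' by simp
  show "(C * C\<^sup>\<dagger>)\<^sup>\<dagger> = C * C\<^sup>\<dagger>" by (simp add: adjoint_mult[OF C C'])
  fix v :: "complex vec" assume v: "v \<in> carrier_vec n"
  define w where "w = C\<^sup>\<dagger> *\<^sub>v v"
  have w: "w \<in> carrier_vec m" unfolding w_def by (rule mult_mat_vec_carrier[OF C' v])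
  have "((C * C\<^sup>\<dagger>) *\<^sub>v v) \<bullet>c v = w \<bullet>c w"
    unfolding assoc_mult_mat_vec[OF C C' v] w_def[symmetric] cscalar_prod_adjoint[OF C w v] ..
  also have "\<dots> = of_real (\<Sum>i<m. (cmod (w $ i))\<^sup>2)"
    using w by (simp add: scalar_prod_def atLeast0LessThan complex_norm_square del: of_real_power)
  finally show "0 \<le> Re (((C * C\<^sup>\<dagger>) *\<^sub>v v) \<bullet>c v)" by (simp add: sum_nonneg)
qed

lemma diagonalises_conj:
  assumes "diagonalises n U l A"
  shows "U\<^sup>\<dagger> * (A * U) = mat_diag n (\<lambda>i. complex_of_real (l i))"
proof -
  let ?D = "mat_diag n (\<lambda>i. complex_of_real (l i))"
  note d = diagonalisesD[OF assms]
  have U': "U\<^sup>\<dagger> \<in> carrier_mat n n" using d(1) by simp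
  have UD: "U * ?D \<in> carrier_mat n n" using d(1) by (intro mult_carrier_mat[of _ n n]) auto
  have "A * U = U * ?D"
    unfolding d(4) using assoc_mult_mat[OF UD U' d(1)] d(2) UD by simp
  then show ?thesis using assoc_mult_mat[OF U' d(1) mat_diag_dim, symmetric] d(2)
    by (simp add: left_mult_one_mat[OF mat_diag_dim])
qed

text \<open>The eigenvalue \<open>l i\<close> is the value of the quadratic form of \<open>A\<close>
  at column \<open>i\<close> of \<open>U\<close>.\<close>

lemma psd_eigenvalue_nonneg:
  assumes A: "psd n A" and dg: "diagonalises n U l A" and i: "i < n"
  shows "0 \<le> l i"
proof -
  note d = diagonalisesD[OF dg]
  let ?e = "unit_vec n i :: complex vec" and ?D = "mat_diag n (\<lambda>i. complex_of_real (l i))"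
  have U': "U\<^sup>\<dagger> \<in> carrier_mat n n" using d(1) by simp
  have AU: "A * U \<in> carrier_mat n n" by (rule mult_carrier_mat[OF d(5,1)])
  have e: "?e \<in> carrier_vec n" by simp
  have Ue: "U *\<^sub>v ?e \<in> carrier_vec n" using d(1) e by simp
  have AUe: "(A * U) *\<^sub>v ?e \<in> carrier_vec n" using AU e by simp
  have "(A *\<^sub>v (U *\<^sub>v ?e)) \<bullet>c (U *\<^sub>v ?e) = ((A * U) *\<^sub>v ?e) \<bullet>c (U *\<^sub>v ?e)"
    using assoc_mult_mat_vec[OF d(5,1) e] by simp
  also have "\<dots> = (U\<^sup>\<dagger> *\<^sub>v ((A * U) *\<^sub>v ?e)) \<bullet>c ?e"
    by (subst cscalar_prod_adjoint[OF U' AUe e]) simp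
  also have "U\<^sup>\<dagger> *\<^sub>v ((A * U) *\<^sub>v ?e) = ?D *\<^sub>v ?e"
    using assoc_mult_mat_vec[OF U' AU e] diagonalises_conj[OF dg] by simp
  also have "(?D *\<^sub>v ?e) \<bullet>c ?e = (\<Sum>k<n. \<Sum>j<n. if j = i then if k = i then of_real (l i) else 0 else 0)"
    unfolding quad_form[OF mat_diag_dim e e] by (intro sum.cong refl) (use i in auto)
  also have "\<dots> = of_real (l i)" using i by simp
  finally show ?thesis using psdD(3)[OF A Ue] by simp
qed

lemma psd_diagonalisable:
  assumes "psd n A"
  obtains U l where "diagonalises n U l A" "\<forall>i<n. 0 \<le> l i"
proof -
  obtain U l where "diagonalises n U l A"
    using hermitian_diagonalisable[OF psdD(1,2)[OF assms]] by blast
  then show ?thesis using that psd_eigenvalue_nonneg[OF assms] by blast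
qed

text \<open>Take \<open>U\<close> times the diagonal matrix of square roots of the eigenvalues. With
  such a factor, congruences of \<open>A\<close> become Gram matrices of another factor, and trace
  and entry bounds become sums of squares.\<close>

lemma psd_factor:
  assumes "psd n A"
  obtains C where "C \<in> carrier_mat n n" "A = C * C\<^sup>\<dagger>"
proof -
  obtain U l where d: "diagonalises n U l A" and l: "\<forall>i<n. 0 \<le> l i"
    by (rule psd_diagonalisable[OF assms])
  note dd = diagonalisesD[OF d]
  define D where "D = mat_diag n (\<lambda>i. complex_of_real (sqrt (l i)))"
  have D: "D \<in> carrier_mat n n" by (simp add: D_def)
  have U': "U\<^sup>\<dagger> \<in> carrier_mat n n" using dd(1) by simp
  have UD: "U * D \<in> carrier_mat n n" by (rule mult_carrier_mat[OF dd(1) D])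
  have DD: "D * D = mat_diag n (\<lambda>i. complex_of_real (l i))"
    unfolding D_def mat_diag_diag
    by (rule eq_matI) (auto simp: l simp flip: of_real_mult)
  have "D\<^sup>\<dagger> = D" by (simp add: D_def)
  then have "(U * D) * (U * D)\<^sup>\<dagger> = U * (D * D) * U\<^sup>\<dagger>"
    unfolding adjoint_mult[OF dd(1) D] using assoc_mult_mat[OF UD D U'] assoc_mult_mat[OF dd(1) D D]
    by simp
  then show ?thesis using that[OF UD] DD dd(4) by simp
qed

lemma psd_congruence:
  assumes A: "psd n A" and K: "K \<in> carrier_mat m n"
  shows "psd m (K * A * K\<^sup>\<dagger>)"
proof -
  obtain C where C: "C \<in> carrier_mat n n" "A = C * C\<^sup>\<dagger>" by (rule psd_factor[OF A])
  have C': "C\<^sup>\<dagger> \<in> carrier_mat n n" and K': "K\<^sup>\<dagger> \<in> carrier_mat n m" using C K by auto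
  have KC: "K * C \<in> carrier_mat m n" by (rule mult_carrier_mat[OF K C(1)])
  have "K * A * K\<^sup>\<dagger> = (K * C) * (K * C)\<^sup>\<dagger>"
    unfolding C(2) adjoint_mult[OF K C(1)]
    using assoc_mult_mat[OF KC C' K'] assoc_mult_mat[OF K C(1) C'] by simp
  then show ?thesis using psd_gram[OF KC] by simp
qed

text \<open>In terms of a factor \<open>C\<close> the trace is the sum of the squared row norms of
  \<open>C\<close>, and an entry of \<open>A\<close> is the inner product of two rows. The entry
  bound later makes families of positive matrices with fixed total trace bounded.\<close>

lemma psd_trace:
  assumes "psd n A"
  shows "mat_trace A = of_real (Re (mat_trace A))" "0 \<le> Re (mat_trace A)"
    "Re (mat_trace A) = 0 \<Longrightarrow> A = 0\<^sub>m n n"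
    "i < n \<Longrightarrow> j < n \<Longrightarrow> cmod (A $$ (i, j)) \<le> Re (mat_trace A)"
proof -
  obtain C where C: "C \<in> carrier_mat n n" "A = C * C\<^sup>\<dagger>" by (rule psd_factor[OF assms])
  have C': "C\<^sup>\<dagger> \<in> carrier_mat n n" using C by simp
  define R where "R = (\<lambda>i. \<Sum>k<n. (cmod (C $$ (i, k)))\<^sup>2)"
  have tr: "mat_trace A = of_real (\<Sum>i<n. R i)"
    unfolding C(2) trace_gram[OF C(1)] R_def ..
  have R0: "0 \<le> R i" for i by (simp add: R_def sum_nonneg)
  show "mat_trace A = of_real (Re (mat_trace A))" "0 \<le> Re (mat_trace A)"
    unfolding tr by (auto simp: R0 sum_nonneg)
  show "A = 0\<^sub>m n n" if "Re (mat_trace A) = 0"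
  proof -
    have "\<forall>i<n. R i = 0"
      using that unfolding tr by (subst (asm) Re_complex_of_real, subst (asm) sum_nonneg_eq_0_iff) (auto simp: R0)
    then have "\<forall>i<n. \<forall>j<n. C $$ (i, j) = 0"
      unfolding R_def by (subst (asm) sum_nonneg_eq_0_iff) auto
    then have "C = 0\<^sub>m n n" using C(1) by (intro eq_matI) auto
    then show ?thesis unfolding C(2) using C' by simp
  qed
  show "cmod (A $$ (i, j)) \<le> Re (mat_trace A)" if ij: "i < n" "j < n"
  proof -
    have RT: "R i \<le> (\<Sum>i<n. R i)" if "i < n" for i
      by (rule member_le_sum) (use that R0 in auto)
    have "A $$ (i, j) = (\<Sum>k<n. C $$ (i, k) * cnj (C $$ (j, k)))"
      unfolding C(2) mult_index[OF C(1) C' ij] using ij C(1) by (intro sum.cong refl) auto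
    then have "cmod (A $$ (i, j)) \<le> (\<Sum>k<n. cmod (C $$ (i, k)) * cmod (C $$ (j, k)))"
      by (auto intro!: sum_norm_le simp: norm_mult)
    \<comment> \<open>The arithmetic mean of two squared row norms suffices in place of the
      Cauchy-Schwarz inequality, since each of them is at most the trace.\<close>
    also have "\<dots> \<le> (\<Sum>k<n. ((cmod (C $$ (i, k)))\<^sup>2 + (cmod (C $$ (j, k)))\<^sup>2) / 2)"
    proof (rule sum_mono)
      fix k
      show "cmod (C $$ (i, k)) * cmod (C $$ (j, k)) \<le> ((cmod (C $$ (i, k)))\<^sup>2 + (cmod (C $$ (j, k)))\<^sup>2) / 2"
        using sum_squares_bound[of "cmod (C $$ (i, k))" "cmod (C $$ (j, k))"] by simp
    qed
    also have "\<dots> = (R i + R j) / 2"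
      by (simp add: R_def sum.distrib flip: sum_divide_distrib)
    also have "\<dots> \<le> (\<Sum>i<n. R i)" using RT[OF ij(1)] RT[OF ij(2)] by simp
    finally show ?thesis unfolding tr by simp
  qed
qed

lemma psd_smult:
  assumes "psd n A" "0 \<le> c"
  shows "psd n (complex_of_real c \<cdot>\<^sub>m A)"
proof -
  note A = psdD[OF assms(1)]
  have "0 \<le> Re (((complex_of_real c \<cdot>\<^sub>m A) *\<^sub>v v) \<bullet>c v)" if v: "v \<in> carrier_vec n" for v
  proof -
    have "((complex_of_real c \<cdot>\<^sub>m A) *\<^sub>v v) \<bullet>c v = of_real c * ((A *\<^sub>v v) \<bullet>c v)"
      using A(1) v by (subst (1 2) quad_form[of _ n n]) (auto simp: sum_distrib_left mult_ac)
    then show ?thesis using A(3)[OF v] assms(2) by simp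
  qed
  then show ?thesis using A(1,2) unfolding psd_def by (auto simp: adjoint_smult)
qed

section \<open>Finite sums and entrywise limits of matrices\<close>

lemma mat_sum_carrier [simp]: "mat_sum m n I A \<in> carrier_mat m n"
  by (simp add: mat_sum_def)

lemma mat_sum_index [simp]:
  "i < m \<Longrightarrow> j < n \<Longrightarrow> mat_sum m n I A $$ (i, j) = (\<Sum>k\<in>I. A k $$ (i, j))"
  by (simp add: mat_sum_def)

lemma dim_mat_sum [simp]: "dim_row (mat_sum m n I A) = m" "dim_col (mat_sum m n I A) = n"
  by (simp_all add: mat_sum_def)

lemma mat_sum_cong:
  "I = J \<Longrightarrow> (\<And>k. k \<in> J \<Longrightarrow> A k = B k) \<Longrightarrow> mat_sum m n I A = mat_sum m n J B"
  by (auto intro!: eq_matI sum.cong)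

lemma mult_mat_sum:
  fixes A :: "'i \<Rightarrow> complex mat"
  assumes "K \<in> carrier_mat l m" "\<And>k. k \<in> I \<Longrightarrow> A k \<in> carrier_mat m n"
  shows "K * mat_sum m n I A = mat_sum l n I (\<lambda>k. K * A k)"
proof (rule eq_matI)
  fix i j assume "i < dim_row (mat_sum l n I (\<lambda>k. K * A k))" "j < dim_col (mat_sum l n I (\<lambda>k. K * A k))"
  then have ij: "i < l" "j < n" by auto
  have "(K * mat_sum m n I A) $$ (i, j) = (\<Sum>q<m. \<Sum>k\<in>I. K $$ (i, q) * A k $$ (q, j))"
    unfolding mult_index[OF assms(1) mat_sum_carrier ij] using ij
    by (intro sum.cong refl) (simp add: sum_distrib_left)
  also have "\<dots> = (\<Sum>k\<in>I. (K * A k) $$ (i, j))"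
    by (subst sum.swap) (intro sum.cong refl, simp only: mult_index[OF assms(1) assms(2) ij])
  finally show "(K * mat_sum m n I A) $$ (i, j) = mat_sum l n I (\<lambda>k. K * A k) $$ (i, j)"
    using ij by simp
qed (use assms in auto)

lemma mat_sum_mult:
  fixes A :: "'i \<Rightarrow> complex mat"
  assumes "K \<in> carrier_mat m n" "\<And>k. k \<in> I \<Longrightarrow> A k \<in> carrier_mat l m"
  shows "mat_sum l m I A * K = mat_sum l n I (\<lambda>k. A k * K)"
proof (rule eq_matI)
  fix i j assume "i < dim_row (mat_sum l n I (\<lambda>k. A k * K))" "j < dim_col (mat_sum l n I (\<lambda>k. A k * K))"
  then have ij: "i < l" "j < n" by auto
  have "(mat_sum l m I A * K) $$ (i, j) = (\<Sum>q<m. \<Sum>k\<in>I. A k $$ (i, q) * K $$ (q, j))"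
    unfolding mult_index[OF mat_sum_carrier assms(1) ij] using ij
    by (intro sum.cong refl) (simp add: sum_distrib_right)
  also have "\<dots> = (\<Sum>k\<in>I. (A k * K) $$ (i, j))"
    by (subst sum.swap) (intro sum.cong refl, simp only: mult_index[OF assms(2) assms(1) ij])
  finally show "(mat_sum l m I A * K) $$ (i, j) = mat_sum l n I (\<lambda>k. A k * K) $$ (i, j)"
    using ij by simp
qed (use assms in auto)

lemma congruence_mat_sum:
  fixes A :: "'i \<Rightarrow> complex mat"
  assumes K: "K \<in> carrier_mat m n" and A: "\<And>k. k \<in> I \<Longrightarrow> A k \<in> carrier_mat n n"
  shows "K * mat_sum n n I A * K\<^sup>\<dagger> = mat_sum m m I (\<lambda>k. K * A k * K\<^sup>\<dagger>)"
proof -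
  have KA: "K * A k \<in> carrier_mat m n" if "k \<in> I" for k
    by (rule mult_carrier_mat[OF K A[OF that]])
  have "K * mat_sum n n I A = mat_sum m n I (\<lambda>k. K * A k)"
    by (rule mult_mat_sum[OF K A])
  then show ?thesis using mat_sum_mult[OF adjoint_carrier[OF K] KA] by simp
qed

lemma congruence_smult:
  fixes A :: "complex mat"
  assumes "K \<in> carrier_mat m n" "A \<in> carrier_mat n n"
  shows "K * (c \<cdot>\<^sub>m A) * K\<^sup>\<dagger> = c \<cdot>\<^sub>m (K * A * K\<^sup>\<dagger>)"
proof -
  have "K * (c \<cdot>\<^sub>m A) = c \<cdot>\<^sub>m (K * A)" by (rule mult_smult_distrib[OF assms])
  then show ?thesis
    using mult_smult_assoc_mat[OF mult_carrier_mat[OF assms] adjoint_carrier[OF assms(1)]] by simp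
qed

lemma congruence_mult:
  fixes A :: "complex mat"
  assumes E: "E \<in> carrier_mat l m" and K: "K \<in> carrier_mat m n" and A: "A \<in> carrier_mat n n"
  shows "(E * K) * A * (E * K)\<^sup>\<dagger> = E * (K * A * K\<^sup>\<dagger>) * E\<^sup>\<dagger>"
proof -
  have E': "E\<^sup>\<dagger> \<in> carrier_mat m l" and K': "K\<^sup>\<dagger> \<in> carrier_mat n m" using E K by auto
  have KA: "K * A \<in> carrier_mat m n" by (rule mult_carrier_mat[OF K A])
  have EKA: "E * (K * A) \<in> carrier_mat l n" by (rule mult_carrier_mat[OF E KA])
  show ?thesis
    unfolding adjoint_mult[OF E K] assoc_mult_mat[OF E K A]
    using assoc_mult_mat[OF EKA K' E'] assoc_mult_mat[OF E KA K'] by simp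
qed

lemma trace_mat_sum: "mat_trace (mat_sum n n I A) = (\<Sum>k\<in>I. mat_trace (A k))"
  if "\<And>k. k \<in> I \<Longrightarrow> A k \<in> carrier_mat n n"
proof -
  have "mat_trace (mat_sum n n I A) = (\<Sum>i<n. \<Sum>k\<in>I. A k $$ (i, i))"
    by (simp add: mat_trace_def)
  also have "\<dots> = (\<Sum>k\<in>I. mat_trace (A k))"
    unfolding mat_trace_def using that by (subst sum.swap) (intro sum.cong refl, auto)
  finally show ?thesis .
qed

lemma psd_mat_sum:
  assumes "\<And>k. k \<in> I \<Longrightarrow> psd n (A k)"
  shows "psd n (mat_sum n n I A)"
  unfolding psd_def
proof (intro conjI ballI)
  note A = psdD[OF assms]
  have "cnj (A k $$ (j, i)) = A k $$ (i, j)" if "k \<in> I" "i < n" "j < n" for k i j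
    using arg_cong[OF A(2)[OF that(1)], of "\<lambda>X. X $$ (i, j)"] A(1)[OF that(1)] that by simp
  then show "(mat_sum n n I A)\<^sup>\<dagger> = mat_sum n n I A"
    by (intro eq_matI) auto
  fix v :: "complex vec" assume v: "v \<in> carrier_vec n"
  have "(mat_sum n n I A *\<^sub>v v) \<bullet>c v = (\<Sum>i<n. \<Sum>j<n. \<Sum>k\<in>I. A k $$ (i, j) * v $ j * cnj (v $ i))"
    unfolding quad_form[OF mat_sum_carrier v v]
    by (intro sum.cong refl) (simp add: sum_distrib_right)
  also have "\<dots> = (\<Sum>k\<in>I. \<Sum>i<n. \<Sum>j<n. A k $$ (i, j) * v $ j * cnj (v $ i))"
    by (simp add: sum.swap[of _ I])
  also have "\<dots> = (\<Sum>k\<in>I. (A k *\<^sub>v v) \<bullet>c v)"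
    by (intro sum.cong refl) (simp only: quad_form[OF A(1) v v])
  finally show "0 \<le> Re ((mat_sum n n I A *\<^sub>v v) \<bullet>c v)"
    using A(3)[OF _ v] by (simp add: sum_nonneg)
qed simp

text \<open>Hermiticity and each inequality for the quadratic form are closed conditions on finitely
  many entries, so entrywise convergence preserves them.\<close>

lemma psd_limit:
  assumes A: "\<And>N. psd n (A N)" and B: "B \<in> carrier_mat n n"
    and lim: "\<And>i j. i < n \<Longrightarrow> j < n \<Longrightarrow> (\<lambda>N. A N $$ (i, j)) \<longlonglongrightarrow> B $$ (i, j)"
  shows "psd n B"
  unfolding psd_def
proof (intro conjI ballI)
  show "B\<^sup>\<dagger> = B"
  proof (rule eq_matI)
    fix i j assume "i < dim_row B" "j < dim_col B"
    then have ij: "i < n" "j < n" using B by auto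
    have "A N $$ (i, j) = cnj (A N $$ (j, i))" for N
      using arg_cong[OF psdD(2)[OF A], of "\<lambda>X. X $$ (i, j)" N] psdD(1)[OF A, of N] ij by simp
    then have "(\<lambda>N. A N $$ (i, j)) \<longlonglongrightarrow> cnj (B $$ (j, i))"
      using lim[OF ij(2,1)] by (simp add: lim_cnj)
    then show "B\<^sup>\<dagger> $$ (i, j) = B $$ (i, j)"
      using LIMSEQ_unique[OF lim[OF ij]] B ij by simp
  qed (use B in auto)
  fix v :: "complex vec" assume v: "v \<in> carrier_vec n"
  have "(\<lambda>N. Re ((A N *\<^sub>v v) \<bullet>c v)) \<longlonglongrightarrow> Re ((B *\<^sub>v v) \<bullet>c v)"
    unfolding quad_form[OF psdD(1)[OF A] v v] quad_form[OF B v v]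
    by (intro tendsto_Re tendsto_sum tendsto_mult tendsto_const lim) auto
  then show "0 \<le> Re ((B *\<^sub>v v) \<bullet>c v)"
    by (rule LIMSEQ_le_const) (use psdD(3)[OF A v] in auto)
qed (rule B)

section \<open>Block diagonal matrices\<close>

text \<open>The index \<open>a * d + k\<close> is that of \<open>kron\<close> with the classical
  register as first factor. In this form the quantum representation of an assemblage and the
  operators acting on the second factor alone are both direct sums over outputs.\<close>

definition block_diag :: "nat \<Rightarrow> nat \<Rightarrow> (nat \<Rightarrow> complex mat) \<Rightarrow> complex mat" where
  "block_diag d r A = mat (r * d) (r * d) (\<lambda>(i, j).
     if i div d = j div d then A (i div d) $$ (i mod d, j mod d) else 0)"

lemma block_diag_carrier [simp]: "block_diag d r A \<in> carrier_mat (r * d) (r * d)"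
  by (simp add: block_diag_def)

lemma dim_block_diag [simp]:
  "dim_row (block_diag d r A) = r * d" "dim_col (block_diag d r A) = r * d"
  by (simp_all add: block_diag_def)

lemma block_diag_index:
  "i < r * d \<Longrightarrow> j < r * d \<Longrightarrow> block_diag d r A $$ (i, j) =
     (if i div d = j div d then A (i div d) $$ (i mod d, j mod d) else 0)"
  by (simp add: block_diag_def)

lemma block_index_bounds:
  fixes i d r :: nat
  assumes "i < r * d"
  shows "i div d < r" "i mod d < d"
proof -
  have "0 < d" using assms by (cases d) auto
  then show "i mod d < d" by simp
  show "i div d < r" using assms by (simp add: less_mult_imp_div_less)
qed

lemma sum_blocks: "(\<Sum>k<r * d. f k) = (\<Sum>a<r. \<Sum>i<d. f (a * d + i :: nat))"
proof -
  have "(\<Sum>k<r * d. f k) = (\<Sum>a<r. sum f {a * d..<a * d + d})"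
    by (rule sum.nat_group[symmetric])
  also have "\<dots> = (\<Sum>a<r. \<Sum>i<d. f (a * d + i))"
  proof (rule sum.cong[OF refl])
    fix a
    show "sum f {a * d..<a * d + d} = (\<Sum>i<d. f (a * d + i))"
      by (rule sum.reindex_bij_witness[of _ "\<lambda>i. a * d + i" "\<lambda>i. i - a * d"]) auto
  qed
  finally show ?thesis .
qed

lemma block_diag_mult:
  assumes A: "\<And>a. a < r \<Longrightarrow> A a \<in> carrier_mat d d" and B: "\<And>a. a < r \<Longrightarrow> B a \<in> carrier_mat d d"
  shows "block_diag d r A * block_diag d r B = block_diag d r (\<lambda>a. A a * B a)"
proof (rule eq_matI)
  fix i j assume "i < dim_row (block_diag d r (\<lambda>a. A a * B a))"
    "j < dim_col (block_diag d r (\<lambda>a. A a * B a))"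
  then have ij: "i < r * d" "j < r * d" by auto
  note b = block_index_bounds[OF ij(1)] block_index_bounds[OF ij(2)]
  have "(block_diag d r A * block_diag d r B) $$ (i, j) =
      (\<Sum>c<r. \<Sum>l<d. block_diag d r A $$ (i, c * d + l) * block_diag d r B $$ (c * d + l, j))"
    unfolding mult_index[OF block_diag_carrier block_diag_carrier ij] sum_blocks ..
  also have "\<dots> = (\<Sum>c<r. if c = i div d then if i div d = j div d then
      (\<Sum>l<d. A c $$ (i mod d, l) * B c $$ (l, j mod d)) else 0 else 0)"
  proof (rule sum.cong[OF refl])
    fix c assume c: "c \<in> {..<r}"
    have cl: "c * d + l < r * d" if "l < d" for l
    proof -
      have "c * d + l < Suc c * d" using that by simp
      also have "\<dots> \<le> r * d" using c by (intro mult_right_mono) auto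
      finally show ?thesis .
    qed
    show "(\<Sum>l<d. block_diag d r A $$ (i, c * d + l) * block_diag d r B $$ (c * d + l, j)) =
        (if c = i div d then if i div d = j div d then
      (\<Sum>l<d. A c $$ (i mod d, l) * B c $$ (l, j mod d)) else 0 else 0)"
      using ij cl by (auto simp: block_diag_index intro!: sum.cong sum.neutral)
  qed
  also have "\<dots> = (if i div d = j div d then (A (i div d) * B (i div d)) $$ (i mod d, j mod d) else 0)"
    using b by (simp add: mult_index[OF A B])
  finally show "(block_diag d r A * block_diag d r B) $$ (i, j) = block_diag d r (\<lambda>a. A a * B a) $$ (i, j)"
    using ij by (simp add: block_diag_index)
qed auto

lemma block_diag_cong:
  assumes "\<And>a. a < r \<Longrightarrow> A a = B a"
  shows "block_diag d r A = block_diag d r B"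
  by (rule eq_matI) (auto simp: block_diag_index assms block_index_bounds)

lemma adjoint_block_diag:
  assumes "\<And>a. a < r \<Longrightarrow> A a \<in> carrier_mat d d"
  shows "(block_diag d r A)\<^sup>\<dagger> = block_diag d r (\<lambda>a. (A a)\<^sup>\<dagger>)"
proof (rule eq_matI)
  fix i j assume "i < dim_row (block_diag d r (\<lambda>a. (A a)\<^sup>\<dagger>))"
    "j < dim_col (block_diag d r (\<lambda>a. (A a)\<^sup>\<dagger>))"
  then have ij: "i < r * d" "j < r * d" by auto
  note b = block_index_bounds[OF ij(1)] block_index_bounds[OF ij(2)]
  show "(block_diag d r A)\<^sup>\<dagger> $$ (i, j) = block_diag d r (\<lambda>a. (A a)\<^sup>\<dagger>) $$ (i, j)"
    using ij b carrier_matD[OF assms[OF b(1)]] by (auto simp: block_diag_index)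
qed auto

lemma block_diag_mat_diag:
  "block_diag d r (\<lambda>a. mat_diag d (l a)) = mat_diag (r * d) (\<lambda>i. l (i div d) (i mod d))"
proof (rule eq_matI)
  fix i j assume "i < dim_row (mat_diag (r * d) (\<lambda>i. l (i div d) (i mod d)))"
    "j < dim_col (mat_diag (r * d) (\<lambda>i. l (i div d) (i mod d)))"
  then have ij: "i < r * d" "j < r * d" by auto
  have "i = j \<longleftrightarrow> i div d = j div d \<and> i mod d = j mod d"
    by (metis div_mult_mod_eq)
  then show "block_diag d r (\<lambda>a. mat_diag d (l a)) $$ (i, j) =
      mat_diag (r * d) (\<lambda>i. l (i div d) (i mod d)) $$ (i, j)"
    using ij block_index_bounds[OF ij(1)] block_index_bounds[OF ij(2)]
    by (auto simp: block_diag_index)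
qed auto

lemma trace_block_diag:
  assumes "\<And>a. a < r \<Longrightarrow> A a \<in> carrier_mat d d"
  shows "mat_trace (block_diag d r A) = (\<Sum>a<r. mat_trace (A a))"
proof -
  have cl: "c * d + l < r * d" if "l < d" "c < r" for l c
  proof -
    have "c * d + l < Suc c * d" using that by simp
    also have "\<dots> \<le> r * d" using that by (intro mult_right_mono) auto
    finally show ?thesis .
  qed
  have "mat_trace (block_diag d r A) = (\<Sum>a<r. \<Sum>i<d. block_diag d r A $$ (a * d + i, a * d + i))"
    by (simp add: mat_trace_def sum_blocks)
  also have "\<dots> = (\<Sum>a<r. mat_trace (A a))"
  proof (rule sum.cong[OF refl])
    fix a assume a: "a \<in> {..<r}"
    then have "dim_row (A a) = d" using assms by auto
    then show "(\<Sum>i<d. block_diag d r A $$ (a * d + i, a * d + i)) = mat_trace (A a)"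
      unfolding mat_trace_def using a cl by (simp add: block_diag_index)
  qed
  finally show ?thesis .
qed

text \<open>Since eigenvectors are chosen block by block, those belonging to different blocks are
  orthogonal by construction, also when two block diagonal matrices are compared.\<close>

lemma diagonalises_block_diag:
  assumes "\<And>a. a < r \<Longrightarrow> diagonalises d (U a) (l a) (A a)"
  shows "diagonalises (r * d) (block_diag d r U) (\<lambda>i. l (i div d) (i mod d)) (block_diag d r A)"
proof -
  note d = diagonalisesD[OF assms]
  let ?D = "\<lambda>a. mat_diag d (\<lambda>i. complex_of_real (l a i))"
  have U': "(U a)\<^sup>\<dagger> \<in> carrier_mat d d" if "a < r" for a using d(1)[OF that] by simp
  have UD: "U a * ?D a \<in> carrier_mat d d" if "a < r" for a
    by (rule mult_carrier_mat[OF d(1)[OF that] mat_diag_dim])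
  have "(block_diag d r U)\<^sup>\<dagger> * block_diag d r U = block_diag d r (\<lambda>a. (U a)\<^sup>\<dagger> * U a)"
    using d(1) U' by (simp add: adjoint_block_diag block_diag_mult)
  also have "\<dots> = block_diag d r (\<lambda>a. mat_diag d (\<lambda>i. 1))"
    by (rule block_diag_cong) (simp add: d(2) mat_diag_one)
  also have "\<dots> = 1\<^sub>m (r * d)" unfolding block_diag_mat_diag by (rule mat_diag_one)
  finally have 1: "(block_diag d r U)\<^sup>\<dagger> * block_diag d r U = 1\<^sub>m (r * d)" .
  have "block_diag d r A = block_diag d r (\<lambda>a. U a * ?D a * (U a)\<^sup>\<dagger>)"
    by (rule block_diag_cong) (use d(4) in auto)
  also have "\<dots> = block_diag d r (\<lambda>a. U a * ?D a) * block_diag d r (\<lambda>a. (U a)\<^sup>\<dagger>)"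
    by (rule block_diag_mult[symmetric]) (use UD U' in auto)
  also have "block_diag d r (\<lambda>a. U a * ?D a) = block_diag d r U * block_diag d r ?D"
    by (rule block_diag_mult[symmetric]) (use d(1) in auto)
  also have "block_diag d r ?D = mat_diag (r * d) (\<lambda>i. complex_of_real (l (i div d) (i mod d)))"
    by (rule block_diag_mat_diag)
  also have "block_diag d r (\<lambda>a. (U a)\<^sup>\<dagger>) = (block_diag d r U)\<^sup>\<dagger>"
    by (rule adjoint_block_diag[symmetric]) (use d(1) in auto)
  finally show ?thesis unfolding diagonalises_def using 1 by simp
qed

lemma kron_one: "E \<in> carrier_mat d d \<Longrightarrow> kron (1\<^sub>m r) E = block_diag d r (\<lambda>_. E)"
  by (rule eq_matI) (auto simp: kron_def block_diag_index block_index_bounds)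

lemma quantum_rep_block_diag:
  assumes "\<And>a. a < r \<Longrightarrow> \<rho> a x \<in> carrier_mat d d"
  shows "quantum_rep d r \<rho> x = block_diag d r (\<lambda>a. \<rho> a x)"
proof (rule eq_matI)
  fix i j assume "i < dim_row (block_diag d r (\<lambda>a. \<rho> a x))" "j < dim_col (block_diag d r (\<lambda>a. \<rho> a x))"
  then have ij: "i < r * d" "j < r * d" by auto
  note b = block_index_bounds[OF ij(1)] block_index_bounds[OF ij(2)]
  have "quantum_rep d r \<rho> x $$ (i, j) =
      (\<Sum>a<r. if a = i div d then if i div d = j div d then \<rho> a x $$ (i mod d, j mod d) else 0 else 0)"
  proof -
    have "kron (basis_proj r a) (\<rho> a x) $$ (i, j) =
        (if a = i div d then if i div d = j div d then \<rho> a x $$ (i mod d, j mod d) else 0 else 0)"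
      if "a < r" for a
      using ij b carrier_matD[OF assms[OF that]] by (auto simp: kron_def basis_proj_def)
    then show ?thesis unfolding quantum_rep_def using ij by simp
  qed
  then show "quantum_rep d r \<rho> x $$ (i, j) = block_diag d r (\<lambda>a. \<rho> a x) $$ (i, j)"
    using ij b by (simp add: block_diag_index)
qed (auto simp: quantum_rep_def)

section \<open>The scalar relative entropy as an integral\<close>

text \<open>This is the scalar function underlying \<open>mat_log\<close>, so the matrix logarithm
  acts on eigenvalues as \<open>lg\<close>.\<close>

definition lg :: "real \<Rightarrow> real" where
  "lg t = (if t > 0 then ln t else 0)"

text \<open>The Bregman divergence of \<open>t ln t\<close>. The linear terms make it nonnegative
  for arbitrary nonnegative arguments, which justifies \<open>ennreal\<close> as the type of
  values.\<close>

definition phi :: "real \<Rightarrow> real \<Rightarrow> ennreal" where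
  "phi a b = (if 0 < a \<and> b = 0 then \<infinity> else ennreal (a * (lg a - lg b) - a + b))"

lemma phi_real_nonneg:
  assumes "0 \<le> a" "0 \<le> b" "\<not> (0 < a \<and> b = 0)"
  shows "0 \<le> a * (lg a - lg b) - a + b"
proof (cases "a = 0")
  case False
  then have ab: "0 < a" "0 < b" using assms by auto
  have "ln (b / a) \<le> b / a - 1" using ab by (intro ln_le_minus_one) simp
  then have "a * ln (b / a) \<le> b - a" using ab by (simp add: field_simps)
  then show ?thesis using ab by (simp add: lg_def ln_div algebra_simps)
qed (use assms in auto)

text \<open>For \<open>a = 0\<close> the integrand is the constant \<open>b\<close>. For positive
  arguments it has an explicit antiderivative. For \<open>b = 0 < a\<close> it is
  \<open>a t / (1 - t)\<close>, which is not integrable at 1.\<close>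

lemma phi_integral:
  fixes a b :: real
  assumes "0 \<le> a" "0 \<le> b"
  shows "(\<integral>\<^sup>+t. ennreal (t * (b - a)\<^sup>2 / (t * b + (1 - t) * a)) * indicator {0<..<1} t \<partial>lborel) = phi a b"
proof -
  consider (zero) "a = 0" | (pos) "0 < a" "0 < b" | (inf) "0 < a" "b = 0" using assms by fastforce
  then show ?thesis
  proof cases
    case zero
    have "(\<integral>\<^sup>+t. ennreal (t * (b - a)\<^sup>2 / (t * b + (1 - t) * a)) * indicator {0<..<1} t \<partial>lborel)
        = (\<integral>\<^sup>+t. ennreal b * indicator {0<..<1::real} t \<partial>lborel)"
      using zero by (intro nn_integral_cong) (auto simp: power2_eq_square split: split_indicator)
    also have "\<dots> = ennreal b" by (subst nn_integral_cmult_indicator) auto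
    finally show ?thesis using zero by (simp add: phi_def)
  next
    case pos
    have m: "0 < t * b + (1 - t) * a" if "0 \<le> t" "t \<le> 1" for t
    proof (cases "t = 0")
      case False
      then have "0 < t * b" using that pos by simp
      moreover have "0 \<le> (1 - t) * a" using that pos by simp
      ultimately show ?thesis by linarith
    qed (use pos in simp)
    \<comment> \<open>With denominator \<open>m = t b + (1 - t) a\<close> one has
      \<open>m - a = t (b - a)\<close>, so the integrand equals
      \<open>(b - a) - a (b - a) / m\<close>, and the second part is \<open>a\<close> times a
      logarithmic derivative.\<close>
    define F where "F = (\<lambda>t. t * (b - a) - a * ln (t * b + (1 - t) * a))"
    have "(\<integral>\<^sup>+t. ennreal (t * (b - a)\<^sup>2 / (t * b + (1 - t) * a)) * indicator {0<..<1} t \<partial>lborel)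
        = (\<integral>\<^sup>+t. ennreal (t * (b - a)\<^sup>2 / (t * b + (1 - t) * a)) * indicator {0..1} t \<partial>lborel)"
      by (rule nn_integral_cong_AE)
         (use AE_lborel_singleton[of 0] AE_lborel_singleton[of 1] in
           \<open>eventually_elim, auto split: split_indicator\<close>)
    also have "\<dots> = ennreal (F 1 - F 0)"
    proof (rule nn_integral_FTC_Icc)
      fix t :: real assume t: "t \<in> {0..1}"
      then have mt: "0 < t * b + (1 - t) * a" using m by auto
      show "0 \<le> t * (b - a)\<^sup>2 / (t * b + (1 - t) * a)" using t mt by simp
      have "(F has_real_derivative (b - a) - a * ((b - a) / (t * b + (1 - t) * a))) (at t)"
        unfolding F_def using mt by (auto intro!: derivative_eq_intros simp: field_simps)
      also have "(b - a) - a * ((b - a) / (t * b + (1 - t) * a)) = t * (b - a)\<^sup>2 / (t * b + (1 - t) * a)"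
        using mt by (simp add: field_simps power2_eq_square)
      finally show "(F has_real_derivative t * (b - a)\<^sup>2 / (t * b + (1 - t) * a)) (at t)" .
    qed auto
    also have "F 1 - F 0 = a * (lg a - lg b) - a + b" using pos by (simp add: F_def lg_def algebra_simps)
    finally show ?thesis using pos by (simp add: phi_def)
  next
    case inf
    let ?I = "\<integral>\<^sup>+t. ennreal (t * (b - a)\<^sup>2 / (t * b + (1 - t) * a)) * indicator {0<..<1} t \<partial>lborel"
    have ge: "ennreal M \<le> ?I" if M: "0 \<le> M" for M
    proof -
      \<comment> \<open>The cut-off makes \<open>- a ln (1 - c)\<close> equal to
        \<open>M + a\<close>. The linear part of the antiderivative costs at most \<open>a\<close>,
        so the integral up to \<open>c\<close> is at least \<open>M\<close>.\<close>
      define c where "c = 1 - exp (- (M + a) / a)"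
      have c: "0 \<le> c" "c < 1" using inf M by (auto simp: c_def divide_le_0_iff)
      define F where "F = (\<lambda>t. - a * t - a * ln (1 - t))"
      have "ennreal (F c - F 0) = (\<integral>\<^sup>+t. ennreal (a * t / (1 - t)) * indicator {0..c} t \<partial>lborel)"
      proof (rule nn_integral_FTC_Icc[symmetric])
        fix t :: real assume t: "t \<in> {0..c}"
        then show "0 \<le> a * t / (1 - t)" using inf c by auto
        have "(F has_real_derivative (- a + a * (1 / (1 - t)))) (at t)"
          unfolding F_def using t c by (auto intro!: derivative_eq_intros simp: field_simps)
        also have "- a + a * (1 / (1 - t)) = a * t / (1 - t)"
          using t c by (simp add: field_simps)
        finally show "(F has_real_derivative a * t / (1 - t)) (at t)" .
      qed (use c in auto)
      also have "\<dots> \<le> ?I"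
      proof (rule nn_integral_mono)
        fix t
        show "ennreal (a * t / (1 - t)) * indicator {0..c} t
            \<le> ennreal (t * (b - a)\<^sup>2 / (t * b + (1 - t) * a)) * indicator {0<..<1} t"
          using inf c by (cases "t = 0") (auto simp: power2_eq_square field_simps split: split_indicator)
      qed
      finally have "ennreal (F c - F 0) \<le> ?I" .
      moreover have "M \<le> F c - F 0"
      proof -
        have "ln (1 - c) = - (M + a) / a" by (simp add: c_def)
        then have "F c - F 0 = - a * c + (M + a)" using inf by (simp add: F_def)
        moreover have "a * c \<le> a" using inf c by (simp add: mult_left_le)
        ultimately show ?thesis by simp
      qed
      ultimately show ?thesis by (meson ennreal_leI order_trans)
    qed
    have "?I = \<infinity>"
    proof (rule ccontr)
      assume "?I \<noteq> \<infinity>"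
      then obtain x where x: "?I = ennreal x" "0 \<le> x" by (cases ?I) auto
      have "ennreal (x + 1) \<le> ennreal x" using ge[of "x + 1"] x by simp
      then show False using x by simp
    qed
    then show ?thesis using inf by (simp add: phi_def)
  qed
qed

section \<open>A divergence of positive semidefinite matrices\<close>

text \<open>The coefficients of \<open>B\<close> and \<open>A\<close> are collected so that linearity in the pair \<open>(A, B)\<close> is visible;
  \<open>ell_expand\<close> shows the form \<open>2 Re \<langle>X, B - A\<rangle> - \<langle>X, T X\<rangle>\<close>. The maximal value over \<open>X\<close> is computed in
  eigenbases of \<open>A\<close> and \<open>B\<close>, where the problem splits into scalar ones.\<close>

definition ell :: "real \<Rightarrow> complex mat \<Rightarrow> complex mat \<Rightarrow> complex mat \<Rightarrow> real" where
  "ell t A B X = Re (mat_trace ((2 \<cdot>\<^sub>m X\<^sup>\<dagger> - of_real t \<cdot>\<^sub>m (X\<^sup>\<dagger> * X)) * B)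
     - mat_trace ((2 \<cdot>\<^sub>m X\<^sup>\<dagger> + of_real (1 - t) \<cdot>\<^sub>m (X * X\<^sup>\<dagger>)) * A))"

text \<open>The trial matrix 0 gives the value 0, so the truncation of negative numbers by
  \<open>ennreal\<close> does not change the supremum.\<close>

definition quad_div :: "nat \<Rightarrow> real \<Rightarrow> complex mat \<Rightarrow> complex mat \<Rightarrow> ennreal" where
  "quad_div n t A B = (SUP X\<in>carrier_mat n n. ennreal (ell t A B X))"

text \<open>On the open interval both \<open>t\<close> and \<open>1 - t\<close> are positive, so the
  quadratic form degenerates only where both eigenvalues involved vanish.\<close>

definition divergence :: "nat \<Rightarrow> complex mat \<Rightarrow> complex mat \<Rightarrow> ennreal" where
  "divergence n A B = (\<integral>\<^sup>+t. ennreal t * quad_div n t A B * indicator {0<..<1} t \<partial>lborel)"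

section \<open>Maximisation over the trial matrix\<close>

lemma ell_expand:
  assumes "A \<in> carrier_mat n n" "B \<in> carrier_mat n n" "X \<in> carrier_mat n n"
  shows "ell t A B X = Re (2 * mat_trace (X\<^sup>\<dagger> * B) - 2 * mat_trace (X\<^sup>\<dagger> * A)
     - of_real t * mat_trace (X * B * X\<^sup>\<dagger>) - of_real (1 - t) * mat_trace (X\<^sup>\<dagger> * A * X))"
proof -
  note [simp] = mult_carrier_mat[of _ n n _ n]
  have X': "X\<^sup>\<dagger> \<in> carrier_mat n n" using assms by simp
  have XX: "X\<^sup>\<dagger> * X \<in> carrier_mat n n" "X * X\<^sup>\<dagger> \<in> carrier_mat n n" using assms(3) X' by simp_all
  have "(2 \<cdot>\<^sub>m X\<^sup>\<dagger> - of_real t \<cdot>\<^sub>m (X\<^sup>\<dagger> * X)) * B = 2 \<cdot>\<^sub>m (X\<^sup>\<dagger> * B) - of_real t \<cdot>\<^sub>m (X\<^sup>\<dagger> * X * B)"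
    using assms(2) X' XX
    by (simp add: minus_mult_distrib_mat[of _ n n] mult_smult_assoc_mat[of _ n n])
  moreover have "(2 \<cdot>\<^sub>m X\<^sup>\<dagger> + of_real (1 - t) \<cdot>\<^sub>m (X * X\<^sup>\<dagger>)) * A
      = 2 \<cdot>\<^sub>m (X\<^sup>\<dagger> * A) + of_real (1 - t) \<cdot>\<^sub>m (X * X\<^sup>\<dagger> * A)"
    using assms(1) X' XX
    by (simp add: add_mult_distrib_mat[of _ n n] mult_smult_assoc_mat[of _ n n])
  moreover have "mat_trace (X\<^sup>\<dagger> * X * B) = mat_trace (X * B * X\<^sup>\<dagger>)"
    using trace_comm[of "X\<^sup>\<dagger>" n n "X * B"] assms X' by (simp add: assoc_mult_mat[of _ n n _ n _ n])
  moreover have "mat_trace (X * X\<^sup>\<dagger> * A) = mat_trace (X\<^sup>\<dagger> * A * X)"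
    using trace_comm[of X n n "X\<^sup>\<dagger> * A"] assms X' by (simp add: assoc_mult_mat[of _ n n _ n _ n])
  ultimately show ?thesis
    unfolding ell_def using assms X' XX
    by (simp add: trace_minus[of _ n] trace_add[of _ n] trace_smult[of _ n] assoc_mult_mat[of _ n n _ n _ n])
qed

text \<open>Completing the square: for positive \<open>m\<close> the maximum over \<open>y\<close>
  is reached at \<open>(t / m) c\<close>. In the degenerate case \<open>m = 0\<close> also
  \<open>t = 0\<close>, and both sides are 0 because division by zero gives 0.\<close>

lemma scalar_quadratic_bound:
  fixes c y :: complex and t m :: real
  assumes "0 \<le> m" "m = 0 \<Longrightarrow> t = 0"
  shows "2 * t * Re (cnj y * c) - m * (cmod y)\<^sup>2 \<le> (cmod c)\<^sup>2 * (t\<^sup>2 / m)"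
proof (cases "m = 0")
  case False
  then have m: "0 < m" using assms by simp
  have "t * Re (cnj y * c) \<le> \<bar>t\<bar> * (cmod y * cmod c)"
  proof -
    have "t * Re (cnj y * c) \<le> \<bar>t\<bar> * \<bar>Re (cnj y * c)\<bar>" by (metis abs_ge_self abs_mult)
    also have "\<bar>Re (cnj y * c)\<bar> \<le> cmod y * cmod c" using abs_Re_le_cmod[of "cnj y * c"] by (simp add: norm_mult)
    finally show ?thesis by (simp add: mult_left_mono)
  qed
  moreover have "0 \<le> (m * cmod y - \<bar>t\<bar> * cmod c)\<^sup>2 / m" using m by simp
  moreover have "(m * cmod y - \<bar>t\<bar> * cmod c)\<^sup>2 / m =
      m * (cmod y)\<^sup>2 + (cmod c)\<^sup>2 * (t\<^sup>2 / m) - 2 * (\<bar>t\<bar> * (cmod y * cmod c))"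
    using m by (simp add: power2_diff power_mult_distrib field_simps power2_eq_square)
  ultimately show ?thesis by linarith
qed (use assms in auto)

lemma scalar_quadratic_attained:
  fixes c :: complex and t m :: real
  shows "2 * t * Re (cnj (of_real (t / m) * c) * c) - m * (cmod (of_real (t / m) * c))\<^sup>2 = (cmod c)\<^sup>2 * (t\<^sup>2 / m)"
proof (cases "m = 0")
  case False
  have "cnj (of_real (t / m) * c) * c = of_real (t / m * (cmod c)\<^sup>2)"
    by (simp add: complex_norm_square del: of_real_power)
  then have "Re (cnj (of_real (t / m) * c) * c) = t / m * (cmod c)\<^sup>2"
    by (simp only: Re_complex_of_real)
  then show ?thesis using False
    by (simp add: norm_mult norm_divide power_mult_distrib power_divide field_simps power2_eq_square)
qed simp

lemma sum_sum_ennreal: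
  fixes f :: "nat \<Rightarrow> nat \<Rightarrow> real"
  assumes "\<And>i j. i < n \<Longrightarrow> j < m \<Longrightarrow> 0 \<le> f i j"
  shows "(\<Sum>i<n. \<Sum>j<m. ennreal (f i j)) = ennreal (\<Sum>i<n. \<Sum>j<m. f i j)"
proof -
  have "(\<Sum>i<n. \<Sum>j<m. ennreal (f i j)) = (\<Sum>i<n. ennreal (\<Sum>j<m. f i j))"
    by (intro sum.cong refl sum_ennreal) (auto intro: assms)
  also have "\<dots> = ennreal (\<Sum>i<n. \<Sum>j<m. f i j)"
    by (intro sum_ennreal sum_nonneg) (auto intro: assms)
  finally show ?thesis .
qed

text \<open>For eigenvectors \<open>u\<close> of \<open>A\<close> and \<open>v\<close> of
  \<open>B\<close>, the matrix with entries \<open>u_k cnj v_l\<close> is an eigenvector of left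
  multiplication by \<open>A\<close> and of right multiplication by \<open>B\<close>. These rank one
  matrices form an orthonormal basis in which the form \<open>T\<close> is diagonal with entries
  \<open>t b_j + (1 - t) a_i\<close>. The coordinate of \<open>B - A\<close> there is
  \<open>b_j - a_i\<close> times the overlap \<open>c i j\<close>.\<close>

locale spectral_pair =
  fixes n :: nat and A B U V :: "complex mat" and a b :: "nat \<Rightarrow> real"
  assumes dA: "diagonalises n U a A" and dB: "diagonalises n V b B"
    and a0: "i < n \<Longrightarrow> 0 \<le> a i" and b0: "i < n \<Longrightarrow> 0 \<le> b i"
begin

definition c :: "nat \<Rightarrow> nat \<Rightarrow> complex" where
  "c i j = (U\<^sup>\<dagger> * V) $$ (i, j)"

abbreviation "Da \<equiv> mat_diag n (\<lambda>i. complex_of_real (a i))"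
abbreviation "Db \<equiv> mat_diag n (\<lambda>i. complex_of_real (b i))"

lemmas U = diagonalisesD[OF dA] and V = diagonalisesD[OF dB]

lemma U' [simp]: "U\<^sup>\<dagger> \<in> carrier_mat n n" and V' [simp]: "V\<^sup>\<dagger> \<in> carrier_mat n n"
  using U(1) V(1) by auto

lemmas sq = mult_carrier_mat[of _ n n _ n] assoc_mult_mat[of _ n n _ n _ n] U(1) V(1) U(5) V(5)

lemma cancel:
  assumes "Z \<in> carrier_mat n n"
  shows "U\<^sup>\<dagger> * (U * Z) = Z" "U * (U\<^sup>\<dagger> * Z) = Z" "V\<^sup>\<dagger> * (V * Z) = Z" "V * (V\<^sup>\<dagger> * Z) = Z"
  using assms assoc_mult_mat[OF U' U(1) assms] assoc_mult_mat[OF U(1) U' assms]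
    assoc_mult_mat[OF V' V(1) assms] assoc_mult_mat[OF V(1) V' assms] U(2,3) V(2,3)
  by simp_all

lemma trace_conj:
  assumes "Z \<in> carrier_mat n n"
  shows "mat_trace (U * (Z * U\<^sup>\<dagger>)) = mat_trace Z" "mat_trace (V * (Z * V\<^sup>\<dagger>)) = mat_trace Z"
  using trace_comm[of U n n "Z * U\<^sup>\<dagger>"] trace_comm[of V n n "Z * V\<^sup>\<dagger>"] assms U(2) V(2)
  by (simp_all add: sq)

text \<open>The matrix \<open>U\<^sup>\<dagger> * V\<close> is unitary, so the squared moduli of the
  overlaps are doubly stochastic. This is what turns the double sums below into traces.\<close>

lemma row_col_sums:
  "i < n \<Longrightarrow> (\<Sum>j<n. (cmod (c i j))\<^sup>2) = 1" "j < n \<Longrightarrow> (\<Sum>i<n. (cmod (c i j))\<^sup>2) = 1"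
proof -
  let ?C = "U\<^sup>\<dagger> * V"
  have C: "?C \<in> carrier_mat n n" "?C\<^sup>\<dagger> \<in> carrier_mat n n" by (simp_all add: sq)
  have C': "?C\<^sup>\<dagger> = V\<^sup>\<dagger> * U" by (simp add: adjoint_mult[OF U' V(1)])
  have 1: "?C * ?C\<^sup>\<dagger> = 1\<^sub>m n" "?C\<^sup>\<dagger> * ?C = 1\<^sub>m n"
    unfolding C' using U(2) V(2) by (simp_all add: sq cancel)
  have adj: "?C\<^sup>\<dagger> $$ (j, i) = cnj (?C $$ (i, j))" if "i < n" "j < n" for i j
    using adjoint_index[of j ?C i] carrier_matD[OF C(1)] that by simp
  show "(\<Sum>j<n. (cmod (c i j))\<^sup>2) = 1" if i: "i < n"
  proof -
    have "complex_of_real (\<Sum>j<n. (cmod (c i j))\<^sup>2) = (\<Sum>j<n. ?C $$ (i, j) * ?C\<^sup>\<dagger> $$ (j, i))"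
      unfolding of_real_sum c_def using i
      by (intro sum.cong refl) (simp add: adj complex_norm_square del: of_real_power index_mult_mat(1))
    also have "\<dots> = (?C * ?C\<^sup>\<dagger>) $$ (i, i)" by (rule mult_index[OF C i i, symmetric])
    finally show ?thesis unfolding 1 using i by (metis index_one_mat(1) of_real_eq_1_iff)
  qed
  show "(\<Sum>i<n. (cmod (c i j))\<^sup>2) = 1" if j: "j < n"
  proof -
    have "complex_of_real (\<Sum>i<n. (cmod (c i j))\<^sup>2) = (\<Sum>i<n. ?C\<^sup>\<dagger> $$ (j, i) * ?C $$ (i, j))"
      unfolding of_real_sum c_def using j
      by (intro sum.cong refl) (simp add: adj complex_norm_square mult.commute del: of_real_power index_mult_mat(1))
    also have "\<dots> = (?C\<^sup>\<dagger> * ?C) $$ (j, j)" by (rule mult_index[OF C(2,1) j j, symmetric])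
    finally show ?thesis unfolding 1 using j by (metis index_one_mat(1) of_real_eq_1_iff)
  qed
qed

lemma trace_eigenvalues:
  "mat_trace A = of_real (\<Sum>i<n. a i)" "mat_trace B = of_real (\<Sum>i<n. b i)"
proof -
  show "mat_trace A = of_real (\<Sum>i<n. a i)"
    unfolding U(4) using trace_conj(1)[OF mat_diag_dim] by (simp add: sq) (simp add: mat_trace_def)
  show "mat_trace B = of_real (\<Sum>i<n. b i)"
    unfolding V(4) using trace_conj(2)[OF mat_diag_dim] by (simp add: sq) (simp add: mat_trace_def)
qed

lemma weighted_sums:
  "(\<Sum>i<n. \<Sum>j<n. (cmod (c i j))\<^sup>2 * f i) = (\<Sum>i<n. f i)"
  "(\<Sum>i<n. \<Sum>j<n. (cmod (c i j))\<^sup>2 * f j) = (\<Sum>j<n. f j)"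
proof -
  show "(\<Sum>i<n. \<Sum>j<n. (cmod (c i j))\<^sup>2 * f i) = (\<Sum>i<n. f i)"
    by (intro sum.cong refl) (simp add: row_col_sums flip: sum_distrib_right)
  show "(\<Sum>i<n. \<Sum>j<n. (cmod (c i j))\<^sup>2 * f j) = (\<Sum>j<n. f j)"
    by (subst sum.swap, intro sum.cong refl) (simp add: row_col_sums flip: sum_distrib_right)
qed

text \<open>The entries of \<open>Y\<close> are the coordinates of the trial matrix in the rank one
  basis. The two linear traces contain the overlap once with each eigenvalue, while the two
  quadratic traces see only the modulus of each coordinate.\<close>

lemma ell_spectral:
  assumes Y: "Y \<in> carrier_mat n n"
  shows "ell t A B (U * Y * V\<^sup>\<dagger>) = (\<Sum>i<n. \<Sum>j<n. 2 * (b j - a i) * Re (cnj (Y $$ (i, j)) * c i j)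
      - (t * b j + (1 - t) * a i) * (cmod (Y $$ (i, j)))\<^sup>2)"
proof -
  let ?X = "U * Y * V\<^sup>\<dagger>" and ?C = "U\<^sup>\<dagger> * V"
  have Y': "Y\<^sup>\<dagger> \<in> carrier_mat n n" using Y by simp
  have C: "?C \<in> carrier_mat n n" by (simp add: sq)
  have UY: "U * Y \<in> carrier_mat n n" using Y by (simp add: sq)
  have X: "?X \<in> carrier_mat n n" using Y by (simp add: sq)
  have X': "?X\<^sup>\<dagger> = V * (Y\<^sup>\<dagger> * U\<^sup>\<dagger>)"
    by (simp add: adjoint_mult[OF UY V'] adjoint_mult[OF U(1) Y])
  have 1: "mat_trace (?X\<^sup>\<dagger> * B) = (\<Sum>i<n. \<Sum>j<n. cnj (Y $$ (i, j)) * c i j * b j)"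
  proof -
    have "?X\<^sup>\<dagger> * B = V * (Y\<^sup>\<dagger> * (?C * Db) * V\<^sup>\<dagger>)"
      unfolding X' V(4) using Y' by (simp add: sq)
    then have "mat_trace (?X\<^sup>\<dagger> * B) = mat_trace (Y\<^sup>\<dagger> * (?C * Db))"
      using trace_conj(2)[of "Y\<^sup>\<dagger> * (?C * Db)"] Y' by (simp add: sq)
    also have "\<dots> = (\<Sum>j<n. \<Sum>i<n. cnj (Y $$ (i, j)) * c i j * b j)"
      unfolding mat_diag_mult_right[OF C]
      by (subst trace_mult[OF Y']) (use Y C in \<open>auto simp: c_def simp del: index_mult_mat(1) intro!: sum.cong\<close>)
    finally show ?thesis by (subst sum.swap)
  qed
  have 2: "mat_trace (?X\<^sup>\<dagger> * A) = (\<Sum>i<n. \<Sum>j<n. cnj (Y $$ (i, j)) * c i j * a i)"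
  proof -
    have "?X\<^sup>\<dagger> * A = V * (Y\<^sup>\<dagger> * (Da * U\<^sup>\<dagger>))"
      unfolding X' U(4) using Y' by (simp add: sq cancel)
    then have "mat_trace (?X\<^sup>\<dagger> * A) = mat_trace (Y\<^sup>\<dagger> * (Da * ?C))"
      using trace_comm[of V n n "Y\<^sup>\<dagger> * (Da * U\<^sup>\<dagger>)"] Y' by (simp add: sq)
    also have "\<dots> = (\<Sum>j<n. \<Sum>i<n. cnj (Y $$ (i, j)) * c i j * a i)"
      unfolding mat_diag_mult_left[OF C]
      by (subst trace_mult[OF Y']) (use Y C in \<open>auto simp: c_def simp del: index_mult_mat(1) intro!: sum.cong\<close>)
    finally show ?thesis by (subst sum.swap)
  qed
  have 3: "mat_trace (?X * B * ?X\<^sup>\<dagger>) = (\<Sum>i<n. \<Sum>j<n. of_real (b j * (cmod (Y $$ (i, j)))\<^sup>2))"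
  proof -
    have "?X * B * ?X\<^sup>\<dagger> = U * (Y * Db * Y\<^sup>\<dagger> * U\<^sup>\<dagger>)"
      unfolding X' V(4) using Y Y' by (simp add: sq cancel)
    then have "mat_trace (?X * B * ?X\<^sup>\<dagger>) = mat_trace (Y * Db * Y\<^sup>\<dagger>)"
      using trace_conj(1)[of "Y * Db * Y\<^sup>\<dagger>"] Y Y' by (simp add: sq)
    also have "\<dots> = (\<Sum>i<n. \<Sum>j<n. of_real (b j * (cmod (Y $$ (i, j)))\<^sup>2))"
      unfolding mat_diag_mult_right[OF Y]
      by (subst trace_mult[OF _ Y'])
         (use Y in \<open>auto simp: complex_norm_square mult_ac simp del: of_real_power intro!: sum.cong\<close>)
    finally show ?thesis .
  qed
  have 4: "mat_trace (?X\<^sup>\<dagger> * A * ?X) = (\<Sum>i<n. \<Sum>j<n. of_real (a i * (cmod (Y $$ (i, j)))\<^sup>2))"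
  proof -
    have "?X\<^sup>\<dagger> * A * ?X = V * (Y\<^sup>\<dagger> * (Da * Y) * V\<^sup>\<dagger>)"
      unfolding X' U(4) using Y Y' by (simp add: sq cancel)
    then have "mat_trace (?X\<^sup>\<dagger> * A * ?X) = mat_trace (Y\<^sup>\<dagger> * (Da * Y))"
      using trace_conj(2)[of "Y\<^sup>\<dagger> * (Da * Y)"] Y Y' by (simp add: sq)
    also have "\<dots> = (\<Sum>j<n. \<Sum>i<n. of_real (a i * (cmod (Y $$ (i, j)))\<^sup>2))"
      unfolding mat_diag_mult_left[OF Y]
      by (subst trace_mult[OF Y'])
         (use Y in \<open>auto simp: complex_norm_square mult_ac simp del: of_real_power intro!: sum.cong\<close>)
    finally show ?thesis by (subst sum.swap)
  qed
  show ?thesis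
    unfolding ell_expand[OF U(5) V(5) X] 1 2 3 4
    by (simp add: sum_distrib_left algebra_simps flip: sum_subtractf sum.distrib)
qed

lemma weight_nonneg:
  assumes "0 < t" "t < 1" "i < n" "j < n"
  shows "0 \<le> t * b j + (1 - t) * a i" "t * b j + (1 - t) * a i = 0 \<Longrightarrow> b j - a i = 0"
proof -
  have *: "0 \<le> t * b j" "0 \<le> (1 - t) * a i" using assms a0 b0 by auto
  then show "0 \<le> t * b j + (1 - t) * a i" by simp
  show "b j - a i = 0" if "t * b j + (1 - t) * a i = 0"
  proof -
    have "t * b j = 0" "(1 - t) * a i = 0" using * that by linarith+
    then show ?thesis using assms by simp
  qed
qed

lemma quad_div_spectral:
  assumes t: "0 < t" "t < 1"
  shows "quad_div n t A B = ennreal (\<Sum>i<n. \<Sum>j<n. (cmod (c i j))\<^sup>2 * ((b j - a i)\<^sup>2 / (t * b j + (1 - t) * a i)))"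
    (is "_ = ennreal ?S")
proof (rule antisym)
  show "quad_div n t A B \<le> ennreal ?S"
    unfolding quad_div_def
  proof (rule SUP_least)
    fix X :: "complex mat" assume X: "X \<in> carrier_mat n n"
    define Y where "Y = U\<^sup>\<dagger> * X * V"
    have Y: "Y \<in> carrier_mat n n" using X by (simp add: Y_def sq)
    have XY: "X = U * Y * V\<^sup>\<dagger>" using X V(3) by (simp add: Y_def sq cancel)
    have "ell t A B X \<le> ?S"
      unfolding XY ell_spectral[OF Y]
      by (intro sum_mono scalar_quadratic_bound weight_nonneg[OF t]) auto
    then show "ennreal (ell t A B X) \<le> ennreal ?S" by (rule ennreal_leI)
  qed
  \<comment> \<open>Each coordinate is the scalar maximiser of its own term, so the termwise bound
    is attained by a single matrix.\<close>
  define Y where "Y = mat n n (\<lambda>(i, j). of_real ((b j - a i) / (t * b j + (1 - t) * a i)) * c i j)"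
  have Y: "Y \<in> carrier_mat n n" by (simp add: Y_def)
  then have X: "U * Y * V\<^sup>\<dagger> \<in> carrier_mat n n" by (simp add: sq)
  have "?S = ell t A B (U * Y * V\<^sup>\<dagger>)"
    unfolding ell_spectral[OF Y]
    by (intro sum.cong refl) (simp only: Y_def index_mat(1) lessThan_iff prod.case scalar_quadratic_attained)
  then show "ennreal ?S \<le> quad_div n t A B"
    unfolding quad_div_def using X by (metis (no_types, lifting) SUP_upper)
qed

text \<open>The dependence on \<open>t\<close> is now a finite combination of the scalar kernels
  integrated in \<open>phi_integral\<close>.\<close>

lemma weighted_quad_div:
  "ennreal t * quad_div n t A B * indicator {0<..<1} t =
    (\<Sum>i<n. \<Sum>j<n. ennreal ((cmod (c i j))\<^sup>2) *
      (ennreal (t * (b j - a i)\<^sup>2 / (t * b j + (1 - t) * a i)) * indicator {0<..<1} t))"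
proof (cases "0 < t \<and> t < 1")
  case True
  then have t: "0 < t" "t < 1" by auto
  define q where "q = (\<lambda>i j. (b j - a i)\<^sup>2 / (t * b j + (1 - t) * a i))"
  have q: "0 \<le> q i j" if "i < n" "j < n" for i j
    unfolding q_def using weight_nonneg(1)[OF t that] by simp
  have "ennreal t * quad_div n t A B = ennreal (\<Sum>i<n. \<Sum>j<n. (cmod (c i j))\<^sup>2 * (t * q i j))"
  proof -
    have "quad_div n t A B = ennreal (\<Sum>i<n. \<Sum>j<n. (cmod (c i j))\<^sup>2 * q i j)"
      unfolding quad_div_spectral[OF t] q_def ..
    then show ?thesis using t q
      by (simp add: sum_distrib_left mult.left_commute flip: ennreal_mult')
  qed
  also have "\<dots> = (\<Sum>i<n. \<Sum>j<n. ennreal ((cmod (c i j))\<^sup>2 * (t * q i j)))"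
    using t q by (intro sum_sum_ennreal[symmetric]) simp
  also have "\<dots> = (\<Sum>i<n. \<Sum>j<n. ennreal ((cmod (c i j))\<^sup>2) * ennreal (t * q i j))"
    by (intro sum.cong refl ennreal_mult') simp
  finally show ?thesis using t by (simp add: q_def)
qed auto

text \<open>The definition involves an uncountable supremum, so measurability is read off from the
  closed form.\<close>

lemma measurable_weighted_quad_div:
  "(\<lambda>t. ennreal t * quad_div n t A B * indicator {0<..<1} t) \<in> borel_measurable lborel"
  unfolding weighted_quad_div by measurable

text \<open>By homogeneity of \<open>phi\<close> the right-hand side is the classical divergence of
  the weights \<open>|c i j|^2 a i\<close> from \<open>|c i j|^2 b j\<close>, the Nussbaum-Szkola
  distributions of the pair.\<close>

lemma divergence_spectral:
  "divergence n A B = (\<Sum>i<n. \<Sum>j<n. ennreal ((cmod (c i j))\<^sup>2) * phi (a i) (b j))"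
  unfolding divergence_def weighted_quad_div
  by (subst nn_integral_sum, measurable, subst nn_integral_sum, measurable, subst nn_integral_cmult, measurable)
     (intro sum.cong refl arg_cong2[of _ _ _ _ "(*)"] phi_integral; simp add: a0 b0)

lemma divergence_infinite:
  assumes "i < n" "j < n" "c i j \<noteq> 0" "0 < a i" "b j = 0"
  shows "divergence n A B = \<infinity>"
proof -
  have "\<infinity> = ennreal ((cmod (c i j))\<^sup>2) * phi (a i) (b j)"
    using assms by (simp add: phi_def ennreal_mult_top)
  also have "\<dots> \<le> (\<Sum>j<n. ennreal ((cmod (c i j))\<^sup>2) * phi (a i) (b j))"
    by (rule member_le_sum) (use assms in auto)
  also have "\<dots> \<le> divergence n A B"
    unfolding divergence_spectral
    by (rule member_le_sum[where f = "\<lambda>i. \<Sum>j<n. ennreal ((cmod (c i j))\<^sup>2) * phi (a i) (b j)"])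
       (use assms in auto)
  finally show ?thesis by (simp add: top_unique)
qed

text \<open>The trace of \<open>A (log A - log B)\<close> in eigenbases;
  \<open>trace_relative_entropy\<close> makes the identification.\<close>

definition rel_ent :: real where
  "rel_ent = (\<Sum>i<n. \<Sum>j<n. (cmod (c i j))\<^sup>2 * (a i * (lg (a i) - lg (b j))))"

text \<open>The hypothesis is the support condition in spectral form, see
  \<open>supp_subset_iff\<close>. Under it every infinite value of \<open>phi\<close> is multiplied
  by a vanishing overlap, and the doubly stochastic weights turn the linear terms into
  traces.\<close>

lemma divergence_finite:
  assumes "\<And>i j. i < n \<Longrightarrow> j < n \<Longrightarrow> 0 < a i \<Longrightarrow> b j = 0 \<Longrightarrow> c i j = 0"
  shows "divergence n A B = ennreal (rel_ent - Re (mat_trace A) + Re (mat_trace B))"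
    "0 \<le> rel_ent - Re (mat_trace A) + Re (mat_trace B)"
proof -
  let ?f = "\<lambda>i j. (cmod (c i j))\<^sup>2 * (a i * (lg (a i) - lg (b j)) - a i + b j)"
  have f0: "0 \<le> ?f i j" if "i < n" "j < n" for i j
    using assms[OF that] phi_real_nonneg[OF a0[OF that(1)] b0[OF that(2)]]
    by (cases "0 < a i \<and> b j = 0") auto
  have eq: "(\<Sum>i<n. \<Sum>j<n. ?f i j) = rel_ent - Re (mat_trace A) + Re (mat_trace B)"
  proof -
    have "(\<Sum>i<n. \<Sum>j<n. ?f i j) = rel_ent - (\<Sum>i<n. \<Sum>j<n. (cmod (c i j))\<^sup>2 * a i) + (\<Sum>i<n. \<Sum>j<n. (cmod (c i j))\<^sup>2 * b j)"
      unfolding rel_ent_def by (simp add: algebra_simps sum.distrib sum_subtractf)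
    then show ?thesis unfolding weighted_sums trace_eigenvalues by simp
  qed
  have "divergence n A B = (\<Sum>i<n. \<Sum>j<n. ennreal (?f i j))"
    unfolding divergence_spectral
  proof (intro sum.cong refl)
    fix i j assume "i \<in> {..<n}" "j \<in> {..<n}"
    then have ij: "i < n" "j < n" by auto
    show "ennreal ((cmod (c i j))\<^sup>2) * phi (a i) (b j) = ennreal (?f i j)"
      using assms[OF ij] phi_real_nonneg[OF a0[OF ij(1)] b0[OF ij(2)]]
      by (cases "0 < a i \<and> b j = 0") (auto simp: phi_def ennreal_mult)
  qed
  also have "\<dots> = ennreal (\<Sum>i<n. \<Sum>j<n. ?f i j)"
    by (rule sum_sum_ennreal) (rule f0)
  finally show "divergence n A B = ennreal (rel_ent - Re (mat_trace A) + Re (mat_trace B))"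
    unfolding eq .
  show "0 \<le> rel_ent - Re (mat_trace A) + Re (mat_trace B)"
    unfolding eq[symmetric] by (auto intro!: sum_nonneg f0)
qed

end

section \<open>Properties of the divergence\<close>

lemma exists_spectral_pair:
  assumes "psd n A" "psd n B"
  obtains U V a b where "spectral_pair n A B U V a b"
proof -
  obtain U a where "diagonalises n U a A" "\<forall>i<n. 0 \<le> a i" by (rule psd_diagonalisable[OF assms(1)])
  moreover obtain V b where "diagonalises n V b B" "\<forall>i<n. 0 \<le> b i" by (rule psd_diagonalisable[OF assms(2)])
  ultimately show ?thesis using that by (simp add: spectral_pair_def)
qed

lemma measurable_divergence_integrand:
  assumes "psd n A" "psd n B"
  shows "(\<lambda>t. ennreal t * quad_div n t A B * indicator {0<..<1} t) \<in> borel_measurable lborel"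
proof -
  obtain U V a b where "spectral_pair n A B U V a b" by (rule exists_spectral_pair[OF assms])
  then show ?thesis by (rule spectral_pair.measurable_weighted_quad_div)
qed

lemma trace_mult_weighted_sum:
  assumes M: "M \<in> carrier_mat n n" and A: "\<And>k. k \<in> I \<Longrightarrow> A k \<in> carrier_mat n n"
  shows "mat_trace (M * mat_sum n n I (\<lambda>k. c k \<cdot>\<^sub>m A k)) = (\<Sum>k\<in>I. c k * mat_trace (M * A k))"
proof -
  have cA: "c k \<cdot>\<^sub>m A k \<in> carrier_mat n n" if "k \<in> I" for k using A[OF that] by simp
  have MA: "M * A k \<in> carrier_mat n n" if "k \<in> I" for k by (rule mult_carrier_mat[OF M A[OF that]])
  have "mat_trace (M * mat_sum n n I (\<lambda>k. c k \<cdot>\<^sub>m A k)) = mat_trace (mat_sum n n I (\<lambda>k. M * (c k \<cdot>\<^sub>m A k)))"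
    by (rule arg_cong[of _ _ mat_trace], rule mult_mat_sum[OF M cA])
  also have "\<dots> = (\<Sum>k\<in>I. mat_trace (M * (c k \<cdot>\<^sub>m A k)))"
    by (rule trace_mat_sum) (rule mult_carrier_mat[OF M cA])
  also have "\<dots> = (\<Sum>k\<in>I. c k * mat_trace (M * A k))"
    by (intro sum.cong refl) (simp only: mult_smult_distrib[OF M A] trace_smult[OF MA])
  finally show ?thesis .
qed

lemma ell_coeffs_carrier:
  fixes X :: "complex mat"
  assumes "X \<in> carrier_mat n n"
  shows "2 \<cdot>\<^sub>m X\<^sup>\<dagger> - complex_of_real t \<cdot>\<^sub>m (X\<^sup>\<dagger> * X) \<in> carrier_mat n n"
    "2 \<cdot>\<^sub>m X\<^sup>\<dagger> + complex_of_real (1 - t) \<cdot>\<^sub>m (X * X\<^sup>\<dagger>) \<in> carrier_mat n n"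
proof -
  have X': "X\<^sup>\<dagger> \<in> carrier_mat n n" using assms by simp
  have "X\<^sup>\<dagger> * X \<in> carrier_mat n n" "X * X\<^sup>\<dagger> \<in> carrier_mat n n"
    by (rule mult_carrier_mat[OF X' assms], rule mult_carrier_mat[OF assms X'])
  then show "2 \<cdot>\<^sub>m X\<^sup>\<dagger> - complex_of_real t \<cdot>\<^sub>m (X\<^sup>\<dagger> * X) \<in> carrier_mat n n"
    "2 \<cdot>\<^sub>m X\<^sup>\<dagger> + complex_of_real (1 - t) \<cdot>\<^sub>m (X * X\<^sup>\<dagger>) \<in> carrier_mat n n"
    using X' by (auto intro: minus_carrier_mat)
qed

lemma ell_weighted_sum:
  assumes "\<And>k. k \<in> I \<Longrightarrow> A k \<in> carrier_mat n n" "\<And>k. k \<in> I \<Longrightarrow> B k \<in> carrier_mat n n"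
    and X: "X \<in> carrier_mat n n"
  shows "ell t (mat_sum n n I (\<lambda>k. complex_of_real (c k) \<cdot>\<^sub>m A k)) (mat_sum n n I (\<lambda>k. complex_of_real (c k) \<cdot>\<^sub>m B k)) X
    = (\<Sum>k\<in>I. c k * ell t (A k) (B k) X)"
proof -
  have "mat_trace (M * mat_sum n n I (\<lambda>k. complex_of_real (c k) \<cdot>\<^sub>m B k)) = (\<Sum>k\<in>I. complex_of_real (c k) * mat_trace (M * B k))"
    if "M \<in> carrier_mat n n" for M
    by (rule trace_mult_weighted_sum) (use that assms in auto)
  moreover have "mat_trace (M * mat_sum n n I (\<lambda>k. complex_of_real (c k) \<cdot>\<^sub>m A k)) = (\<Sum>k\<in>I. complex_of_real (c k) * mat_trace (M * A k))"
    if "M \<in> carrier_mat n n" for M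
    by (rule trace_mult_weighted_sum) (use that assms in auto)
  ultimately show ?thesis
    unfolding ell_def using ell_coeffs_carrier[OF X, of t]
    by (simp add: algebra_simps flip: sum_subtractf)
qed

text \<open>For a homogeneous function this subadditivity is joint convexity.\<close>

lemma divergence_weighted_sum_le:
  assumes A: "\<And>k. k \<in> I \<Longrightarrow> psd n (A k)" and B: "\<And>k. k \<in> I \<Longrightarrow> psd n (B k)"
    and c: "\<And>k. k \<in> I \<Longrightarrow> 0 \<le> c k"
  shows "divergence n (mat_sum n n I (\<lambda>k. complex_of_real (c k) \<cdot>\<^sub>m A k))
      (mat_sum n n I (\<lambda>k. complex_of_real (c k) \<cdot>\<^sub>m B k))
    \<le> (\<Sum>k\<in>I. ennreal (c k) * divergence n (A k) (B k))" (is "divergence n ?A ?B \<le> _")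
proof -
  have q: "quad_div n t ?A ?B \<le> (\<Sum>k\<in>I. ennreal (c k) * quad_div n t (A k) (B k))" for t
    unfolding quad_div_def[of n t ?A]
  proof (rule SUP_least)
    fix X :: "complex mat" assume X: "X \<in> carrier_mat n n"
    have "ennreal (ell t ?A ?B X) = ennreal (\<Sum>k\<in>I. c k * ell t (A k) (B k) X)"
      by (subst ell_weighted_sum[OF psdD(1)[OF A] psdD(1)[OF B] X]) auto
    \<comment> \<open>The function \<open>ennreal\<close> is additive only on nonnegative summands,
      so negative ones are first replaced by 0.\<close>
    also have "\<dots> \<le> ennreal (\<Sum>k\<in>I. max 0 (c k * ell t (A k) (B k) X))"
      by (intro ennreal_leI sum_mono) simp
    also have "\<dots> = (\<Sum>k\<in>I. ennreal (max 0 (c k * ell t (A k) (B k) X)))"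
      by (rule sum_ennreal[symmetric]) simp
    also have "\<dots> = (\<Sum>k\<in>I. ennreal (c k * ell t (A k) (B k) X))"
      by (simp add: ennreal_max_0)
    also have "\<dots> = (\<Sum>k\<in>I. ennreal (c k) * ennreal (ell t (A k) (B k) X))"
      by (intro sum.cong refl ennreal_mult' c)
    also have "\<dots> \<le> (\<Sum>k\<in>I. ennreal (c k) * quad_div n t (A k) (B k))"
      unfolding quad_div_def by (intro sum_mono mult_left_mono SUP_upper X) simp
    finally show "ennreal (ell t ?A ?B X) \<le> (\<Sum>k\<in>I. ennreal (c k) * quad_div n t (A k) (B k))" .
  qed
  have "divergence n ?A ?B \<le> (\<integral>\<^sup>+t. (\<Sum>k\<in>I. ennreal (c k) *
      (ennreal t * quad_div n t (A k) (B k) * indicator {0<..<1} t)) \<partial>lborel)"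
    unfolding divergence_def
  proof (rule nn_integral_mono)
    fix t
    have "ennreal t * quad_div n t ?A ?B * indicator {0<..<1} t
        \<le> ennreal t * (\<Sum>k\<in>I. ennreal (c k) * quad_div n t (A k) (B k)) * indicator {0<..<1} t"
      by (intro mult_right_mono mult_left_mono q) auto
    then show "ennreal t * quad_div n t ?A ?B * indicator {0<..<1} t
        \<le> (\<Sum>k\<in>I. ennreal (c k) * (ennreal t * quad_div n t (A k) (B k) * indicator {0<..<1} t))"
      by (simp add: sum_distrib_left sum_distrib_right mult_ac)
  qed
  also have "\<dots> = (\<Sum>k\<in>I. \<integral>\<^sup>+t. ennreal (c k) *
      (ennreal t * quad_div n t (A k) (B k) * indicator {0<..<1} t) \<partial>lborel)"
    by (rule nn_integral_sum) (intro borel_measurable_times_ennreal borel_measurable_const measurable_divergence_integrand A B; assumption)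
  also have "\<dots> = (\<Sum>k\<in>I. ennreal (c k) * divergence n (A k) (B k))"
    unfolding divergence_def
    by (intro sum.cong refl nn_integral_cmult measurable_divergence_integrand A B)
  finally show ?thesis .
qed

text \<open>For fixed \<open>t\<close> and \<open>X\<close> the value of \<open>ell\<close> is
  continuous in the second matrix. A supremum of such functions is lower semicontinuous, and Fatou's
  lemma carries this through the integral.\<close>

lemma divergence_lower_semicontinuous:
  assumes A: "psd n A" and B: "\<And>N. psd n (B N)" and C: "C \<in> carrier_mat n n"
    and lim: "\<And>i j. i < n \<Longrightarrow> j < n \<Longrightarrow> (\<lambda>N. B N $$ (i, j)) \<longlonglongrightarrow> C $$ (i, j)"
  shows "divergence n A C \<le> liminf (\<lambda>N. divergence n A (B N))"
proof -
  have ell_lim: "(\<lambda>N. ell t A (B N) X) \<longlonglongrightarrow> ell t A C X" if X: "X \<in> carrier_mat n n" for t X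
    unfolding ell_def trace_mult[OF ell_coeffs_carrier(1)[OF X] psdD(1)[OF B]]
      trace_mult[OF ell_coeffs_carrier(1)[OF X] C]
    by (intro tendsto_Re tendsto_diff tendsto_sum tendsto_mult tendsto_const lim) auto
  have q: "quad_div n t A C \<le> liminf (\<lambda>N. quad_div n t A (B N))" for t
    unfolding quad_div_def[of n t A C]
  proof (rule SUP_least)
    fix X :: "complex mat" assume X: "X \<in> carrier_mat n n"
    have "ennreal (ell t A C X) = liminf (\<lambda>N. ennreal (ell t A (B N) X))"
      by (intro lim_imp_Liminf[symmetric] tendsto_ennrealI ell_lim X) simp
    also have "\<dots> \<le> liminf (\<lambda>N. quad_div n t A (B N))"
      unfolding quad_div_def by (intro Liminf_mono always_eventually allI SUP_upper X)
    finally show "ennreal (ell t A C X) \<le> liminf (\<lambda>N. quad_div n t A (B N))" .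
  qed
  have "divergence n A C \<le> (\<integral>\<^sup>+t. liminf (\<lambda>N. ennreal t * quad_div n t A (B N) * indicator {0<..<1} t) \<partial>lborel)"
    unfolding divergence_def
  proof (rule nn_integral_mono)
    fix t :: real
    show "ennreal t * quad_div n t A C * indicator {0<..<1} t
        \<le> liminf (\<lambda>N. ennreal t * quad_div n t A (B N) * indicator {0<..<1} t)"
    proof (cases "0 < t \<and> t < 1")
      case True
      have "ennreal t * quad_div n t A C \<le> ennreal t * liminf (\<lambda>N. quad_div n t A (B N))"
        by (intro mult_left_mono q) simp
      also have "\<dots> = liminf (\<lambda>N. ennreal t * quad_div n t A (B N))"
        by (rule Liminf_compose_continuous_mono[symmetric, where f = "\<lambda>x. ennreal t * x"])
           (auto intro!: monoI mult_left_mono ennreal_continuous_on_cmult)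
      finally show ?thesis using True by simp
    qed simp
  qed
  also have "\<dots> \<le> liminf (\<lambda>N. divergence n A (B N))"
    unfolding divergence_def by (intro nn_integral_liminf measurable_divergence_integrand A B)
  finally show ?thesis .
qed

lemma trace_psd_conj_nonneg:
  assumes "psd n A" "X \<in> carrier_mat m n"
  shows "0 \<le> Re (mat_trace (X * A * X\<^sup>\<dagger>))"
  using psd_trace(2)[OF psd_congruence[OF assms]] .

text \<open>For a partial isometry \<open>V\<close> the operator \<open>1 - V V\<^sup>\<dagger>\<close> is a projection, which gives the inequality
  \<open>mat_trace (V\<^sup>\<dagger> M V) \<le> mat_trace M\<close> for positive \<open>M\<close>.\<close>

lemma ell_partial_isometry_le:
  assumes A: "psd n A" and B: "psd n B" and V: "V \<in> carrier_mat m n" "V * V\<^sup>\<dagger> * V = V"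
    and X: "X \<in> carrier_mat m m" and t: "0 \<le> t" "t \<le> 1"
  shows "ell t (V * A * V\<^sup>\<dagger>) (V * B * V\<^sup>\<dagger>) X \<le> ell t A B (V\<^sup>\<dagger> * X * V)"
proof -
  note car = mult_carrier_mat[of _ m n _ n] mult_carrier_mat[of _ m m _ m] mult_carrier_mat[of _ n n _ n]
    mult_carrier_mat[of _ n m _ m] mult_carrier_mat[of _ n m _ n] mult_carrier_mat[of _ m n _ m]
    mult_carrier_mat[of _ m m _ n] mult_carrier_mat[of _ n n _ m]
  note [simp] = psdD(1)[OF A] psdD(1)[OF B] V(1) X car
  have [simp]: "V\<^sup>\<dagger> \<in> carrier_mat n m" "X\<^sup>\<dagger> \<in> carrier_mat m m" by simp_all
  \<comment> \<open>The compressed trial matrix reproduces the linear terms of \<open>ell\<close>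
    exactly, by cyclicity of the trace. Only the two quadratic terms change, and they can only
    become smaller.\<close>
  define Z where "Z = V\<^sup>\<dagger> * X * V"
  have Z: "Z \<in> carrier_mat n n" by (simp add: Z_def)
  have Z': "Z\<^sup>\<dagger> = V\<^sup>\<dagger> * X\<^sup>\<dagger> * V"
  proof -
    have VX: "V\<^sup>\<dagger> * X \<in> carrier_mat n m" by simp
    show ?thesis
      unfolding Z_def adjoint_mult[OF VX V(1)] adjoint_mult[OF \<open>V\<^sup>\<dagger> \<in> carrier_mat n m\<close> X]
      by (simp add: assoc_mult_mat[of _ n m _ m _ n])
  qed
  define R where "R = 1\<^sub>m m - V * V\<^sup>\<dagger>"
  have R: "R \<in> carrier_mat m m" by (simp add: R_def minus_carrier_mat)
  have R': "R\<^sup>\<dagger> = R"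
    unfolding R_def by (simp add: adjoint_minus[of _ m m] adjoint_mult[of _ m n _ m])
  have VV: "V * V\<^sup>\<dagger> * (V * V\<^sup>\<dagger>) = V * V\<^sup>\<dagger>"
    using V(2) by (simp add: assoc_mult_mat[of "V * V\<^sup>\<dagger>" m m V n "V\<^sup>\<dagger>" m, symmetric])
  have RR: "R * R = R"
  proof -
    let ?P = "V * V\<^sup>\<dagger>"
    have P: "?P \<in> carrier_mat m m" by simp
    have "R * ?P = 0\<^sub>m m m"
      unfolding R_def minus_mult_distrib_mat[OF one_carrier_mat P P] left_mult_one_mat[OF P] VV
      by (rule minus_r_inv_mat[OF P])
    moreover have "R * R = R * 1\<^sub>m m - R * ?P"
      using mult_minus_distrib_mat[OF R one_carrier_mat P] by (simp add: R_def)
    moreover have "R - 0\<^sub>m m m = R" using R by (intro eq_matI) auto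
    ultimately show ?thesis using R by simp
  qed
  have contract: "Re (mat_trace (V\<^sup>\<dagger> * M * V)) \<le> Re (mat_trace M)" if M: "psd m M" for M
  proof -
    note [simp] = psdD(1)[OF M]
    have "mat_trace (R * M * R\<^sup>\<dagger>) = mat_trace (R * R * M)"
      unfolding R' using trace_comm[of "R * M" m m R] R by (simp add: assoc_mult_mat[of _ m m _ m _ m])
    also have "\<dots> = mat_trace M - mat_trace (V * V\<^sup>\<dagger> * M)"
      unfolding RR unfolding R_def
      by (simp add: minus_mult_distrib_mat[of _ m m _ _ m] left_mult_one_mat[OF psdD(1)[OF M]] trace_minus[of _ m])
    also have "mat_trace (V * V\<^sup>\<dagger> * M) = mat_trace (V\<^sup>\<dagger> * M * V)"
      using trace_comm[of V m n "V\<^sup>\<dagger> * M"] by (simp add: assoc_mult_mat[of _ m n _ m _ m])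
    finally show ?thesis using trace_psd_conj_nonneg[OF M R] by simp
  qed
  have 1: "mat_trace (X\<^sup>\<dagger> * (V * C * V\<^sup>\<dagger>)) = mat_trace (Z\<^sup>\<dagger> * C)" if [simp]: "C \<in> carrier_mat n n" for C
  proof -
    have "X\<^sup>\<dagger> * (V * C * V\<^sup>\<dagger>) = (X\<^sup>\<dagger> * V * C) * V\<^sup>\<dagger>"
      by (simp add: assoc_mult_mat[of _ m m _ n _ n] assoc_mult_mat[of _ m m _ n _ m])
    then have "mat_trace (X\<^sup>\<dagger> * (V * C * V\<^sup>\<dagger>)) = mat_trace (V\<^sup>\<dagger> * (X\<^sup>\<dagger> * V * C))"
      using trace_comm[of "X\<^sup>\<dagger> * V * C" m n "V\<^sup>\<dagger>"] by simp
    also have "V\<^sup>\<dagger> * (X\<^sup>\<dagger> * V * C) = Z\<^sup>\<dagger> * C"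
      unfolding Z' by (simp add: assoc_mult_mat[of _ n m _ m _ n] assoc_mult_mat[of _ n m _ n _ n])
    finally show ?thesis .
  qed
  have 2: "Re (mat_trace (Z * B * Z\<^sup>\<dagger>)) \<le> Re (mat_trace (X * (V * B * V\<^sup>\<dagger>) * X\<^sup>\<dagger>))"
  proof -
    have "psd m (X * (V * B * V\<^sup>\<dagger>) * X\<^sup>\<dagger>)" by (intro psd_congruence[of m] psd_congruence[of n] B) simp_all
    moreover have "Z * B * Z\<^sup>\<dagger> = V\<^sup>\<dagger> * (X * (V * B * V\<^sup>\<dagger>) * X\<^sup>\<dagger>) * V"
      unfolding Z' unfolding Z_def
      by (simp add: assoc_mult_mat[of _ n m _ m _ n] assoc_mult_mat[of _ n m _ n _ n] assoc_mult_mat[of _ m m _ m _ n]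
         assoc_mult_mat[of _ m n _ n _ n] assoc_mult_mat[of _ m m _ n _ n] assoc_mult_mat[of _ n n _ n _ n]
         assoc_mult_mat[of _ m n _ m _ n] assoc_mult_mat[of _ m n _ n _ m]
         assoc_mult_mat[of _ m n _ m _ m] assoc_mult_mat[of _ n n _ m _ n])
    ultimately show ?thesis using contract by simp
  qed
  have 3: "Re (mat_trace (Z\<^sup>\<dagger> * A * Z)) \<le> Re (mat_trace (X\<^sup>\<dagger> * (V * A * V\<^sup>\<dagger>) * X))"
  proof -
    have "psd m (X\<^sup>\<dagger> * (V * A * V\<^sup>\<dagger>) * (X\<^sup>\<dagger>)\<^sup>\<dagger>)" by (intro psd_congruence[of m] psd_congruence[of n] A) simp_all
    moreover have "Z\<^sup>\<dagger> * A * Z = V\<^sup>\<dagger> * (X\<^sup>\<dagger> * (V * A * V\<^sup>\<dagger>) * (X\<^sup>\<dagger>)\<^sup>\<dagger>) * V"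
      unfolding Z' unfolding Z_def
      by (simp add: assoc_mult_mat[of _ n m _ m _ n] assoc_mult_mat[of _ n m _ n _ n] assoc_mult_mat[of _ m m _ m _ n]
         assoc_mult_mat[of _ m n _ n _ n] assoc_mult_mat[of _ m m _ n _ n] assoc_mult_mat[of _ n n _ n _ n]
         assoc_mult_mat[of _ m n _ m _ n] assoc_mult_mat[of _ m n _ n _ m]
         assoc_mult_mat[of _ m n _ m _ m] assoc_mult_mat[of _ n n _ m _ n])
    ultimately show ?thesis using contract by simp
  qed
  have "ell t A B Z - ell t (V * A * V\<^sup>\<dagger>) (V * B * V\<^sup>\<dagger>) X =
      t * (Re (mat_trace (X * (V * B * V\<^sup>\<dagger>) * X\<^sup>\<dagger>)) - Re (mat_trace (Z * B * Z\<^sup>\<dagger>))) +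
      (1 - t) * (Re (mat_trace (X\<^sup>\<dagger> * (V * A * V\<^sup>\<dagger>) * X)) - Re (mat_trace (Z\<^sup>\<dagger> * A * Z)))"
    by (subst ell_expand[of _ n], simp, simp, rule Z, subst ell_expand[of _ m], simp, simp, simp)
       (simp add: 1 algebra_simps)
  also have "\<dots> \<ge> 0" using t 2 3 by (intro add_nonneg_nonneg mult_nonneg_nonneg) auto
  finally show ?thesis by (simp add: Z_def)
qed

lemma divergence_partial_isometry_le:
  assumes A: "psd n A" and B: "psd n B" and V: "V \<in> carrier_mat m n" "V * V\<^sup>\<dagger> * V = V"
  shows "divergence m (V * A * V\<^sup>\<dagger>) (V * B * V\<^sup>\<dagger>) \<le> divergence n A B"
  unfolding divergence_def
proof (rule nn_integral_mono)
  fix t :: real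
  show "ennreal t * quad_div m t (V * A * V\<^sup>\<dagger>) (V * B * V\<^sup>\<dagger>) * indicator {0<..<1} t
      \<le> ennreal t * quad_div n t A B * indicator {0<..<1} t"
  proof (cases "0 < t \<and> t < 1")
    case True
    have V': "V\<^sup>\<dagger> \<in> carrier_mat n m" using V(1) by simp
    have "quad_div m t (V * A * V\<^sup>\<dagger>) (V * B * V\<^sup>\<dagger>) \<le> quad_div n t A B"
      unfolding quad_div_def[of m]
    proof (rule SUP_least)
      fix X :: "complex mat" assume X: "X \<in> carrier_mat m m"
      have Z: "V\<^sup>\<dagger> * X * V \<in> carrier_mat n n"
        by (rule mult_carrier_mat[OF mult_carrier_mat[OF V' X] V(1)])
      have "ennreal (ell t (V * A * V\<^sup>\<dagger>) (V * B * V\<^sup>\<dagger>) X) \<le> ennreal (ell t A B (V\<^sup>\<dagger> * X * V))"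
        using True by (intro ennreal_leI ell_partial_isometry_le[OF A B V X]) auto
      also have "\<dots> \<le> quad_div n t A B" unfolding quad_div_def by (rule SUP_upper[OF Z])
      finally show "ennreal (ell t (V * A * V\<^sup>\<dagger>) (V * B * V\<^sup>\<dagger>) X) \<le> quad_div n t A B" .
    qed
    then show ?thesis by (intro mult_right_mono mult_left_mono) auto
  qed simp
qed

text \<open>A one-way LOCC may change the dimension, whereas \<^const>\<open>S_A\<close> only admits square measurement
  operators; the square factor \<open>F\<close> replaces the rectangular operator \<open>E\<close>.\<close>

lemma polar_decomposition:
  fixes E :: "complex mat"
  assumes E: "E \<in> carrier_mat m n"
  obtains V F where "V \<in> carrier_mat m n" "V * V\<^sup>\<dagger> * V = V" "F \<in> carrier_mat n n" "E = V * F"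
    "F\<^sup>\<dagger> * F = E\<^sup>\<dagger> * E"
proof -
  have E': "E\<^sup>\<dagger> \<in> carrier_mat n m" using E by simp
  have "psd n (E\<^sup>\<dagger> * E)" using psd_gram[OF E'] by simp
  then obtain U l where d: "diagonalises n U l (E\<^sup>\<dagger> * E)" and l: "\<forall>i<n. 0 \<le> l i"
    by (rule psd_diagonalisable)
  note dd = diagonalisesD[OF d]
  define L where "L = mat_diag n (\<lambda>i. complex_of_real (sqrt (l i)))"
  \<comment> \<open>Because \<open>1 / 0 = 0\<close>, this is the pseudoinverse of \<open>L\<close>,
    and \<open>Q\<close> is the projection onto the eigenvectors with nonzero eigenvalue. The
    partial isometry is \<open>E U J\<close>.\<close>
  define J where "J = mat_diag n (\<lambda>i. complex_of_real (1 / sqrt (l i)))"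
  define Q where "Q = mat_diag n (\<lambda>i. complex_of_real (if l i = 0 then 0 else 1))"
  define D where "D = mat_diag n (\<lambda>i. complex_of_real (l i))"
  have dg: "L \<in> carrier_mat n n" "J \<in> carrier_mat n n" "Q \<in> carrier_mat n n" "D \<in> carrier_mat n n"
    by (simp_all add: L_def J_def Q_def D_def)
  have adj: "L\<^sup>\<dagger> = L" "J\<^sup>\<dagger> = J" "Q\<^sup>\<dagger> = Q" unfolding L_def J_def Q_def by (rule adjoint_mat_diag_real)+
  have LL: "L * L = D"
    unfolding L_def D_def mat_diag_diag
    by (rule eq_matI) (use l in \<open>auto simp flip: of_real_mult\<close>)
  have JL: "J * L = Q"
    unfolding L_def J_def Q_def mat_diag_diag by (rule eq_matI) (auto simp flip: of_real_mult)
  have JDJ: "J * (D * J) = Q"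
    unfolding J_def Q_def D_def mat_diag_diag
    by (rule eq_matI) (use l in \<open>auto simp: field_simps simp flip: of_real_mult\<close>)
  have JQ: "J * Q = J"
    unfolding J_def Q_def mat_diag_diag by (rule eq_matI) auto
  have RDR: "(1\<^sub>m n - Q) * (D * (1\<^sub>m n - Q)) = 0\<^sub>m n n"
  proof -
    have "1\<^sub>m n - Q = mat_diag n (\<lambda>i. complex_of_real (if l i = 0 then 1 else 0))"
      unfolding Q_def by (rule eq_matI) auto
    then show ?thesis unfolding D_def
      by (simp add: mat_diag_diag) (rule eq_matI, auto)
  qed
  have U': "U\<^sup>\<dagger> \<in> carrier_mat n n" using dd(1) by simp
  have EU: "E * U \<in> carrier_mat m n" by (rule mult_carrier_mat[OF E dd(1)])
  have EU': "(E * U)\<^sup>\<dagger> = U\<^sup>\<dagger> * E\<^sup>\<dagger>" by (rule adjoint_mult[OF E dd(1)])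
  have EUEU: "(E * U)\<^sup>\<dagger> * (E * U) = D"
    using diagonalises_conj[OF d] assoc_mult_mat[OF U' E' EU] assoc_mult_mat[OF E' E dd(1)]
    unfolding EU' D_def by simp
  define F where "F = L * U\<^sup>\<dagger>"
  define V where "V = (E * U) * J"
  have F: "F \<in> carrier_mat n n" unfolding F_def by (rule mult_carrier_mat[OF dg(1) U'])
  have V: "V \<in> carrier_mat m n" unfolding V_def by (rule mult_carrier_mat[OF EU dg(2)])
  have V': "V\<^sup>\<dagger> = J * (E * U)\<^sup>\<dagger>" unfolding V_def by (simp add: adjoint_mult[OF EU dg(2)] adj)
  have EUt: "(E * U)\<^sup>\<dagger> \<in> carrier_mat n m" using EU by simp
  have DJ: "D * J \<in> carrier_mat n n" by (rule mult_carrier_mat[OF dg(4,2)])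
  have "V\<^sup>\<dagger> * V = J * ((E * U)\<^sup>\<dagger> * (E * U * J))"
    unfolding V' unfolding V_def by (rule assoc_mult_mat[OF dg(2) EUt]) (rule mult_carrier_mat[OF EU dg(2)])
  also have "(E * U)\<^sup>\<dagger> * (E * U * J) = D * J"
    using assoc_mult_mat[OF EUt EU dg(2)] EUEU by simp
  finally have VV: "V\<^sup>\<dagger> * V = Q" unfolding JDJ .
  have "V * V\<^sup>\<dagger> * V = V * Q"
    using assoc_mult_mat[OF V adjoint_carrier[OF V] V] VV by simp
  also have "\<dots> = V" unfolding V_def using assoc_mult_mat[OF EU dg(2,3)] JQ by simp
  finally have pi: "V * V\<^sup>\<dagger> * V = V" .
  have FF: "F\<^sup>\<dagger> * F = E\<^sup>\<dagger> * E"
  proof -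
    have UL: "U * L \<in> carrier_mat n n" by (rule mult_carrier_mat[OF dd(1) dg(1)])
    have "F\<^sup>\<dagger> = U * L" unfolding F_def by (simp add: adjoint_mult[OF dg(1) U'] adj)
    then have "F\<^sup>\<dagger> * F = U * L * (L * U\<^sup>\<dagger>)" by (simp add: F_def)
    also have "\<dots> = U * (L * L) * U\<^sup>\<dagger>"
      using assoc_mult_mat[OF UL dg(1) U'] assoc_mult_mat[OF dd(1) dg(1,1)] by simp
    finally show ?thesis unfolding LL using dd(4) by (simp add: D_def)
  qed
  \<comment> \<open>A vector killed by \<open>E\<^sup>\<dagger> * E\<close> is killed by
    \<open>E\<close>. In matrix form, the part \<open>W\<close> of \<open>E U\<close> on the null
    eigenvectors satisfies \<open>W\<^sup>\<dagger> * W = 0\<close> and therefore vanishes.\<close>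
  have EUQ: "E * U * Q = E * U"
  proof -
    define R where "R = 1\<^sub>m n - Q"
    have R: "R \<in> carrier_mat n n" using dg(3) by (auto simp: R_def intro: minus_carrier_mat)
    have R': "R\<^sup>\<dagger> = R" unfolding R_def by (simp add: adjoint_minus[OF one_carrier_mat dg(3)] adj)
    define W where "W = E * U * R"
    have W: "W \<in> carrier_mat m n" unfolding W_def by (rule mult_carrier_mat[OF EU R])
    have W': "W\<^sup>\<dagger> = R * (E * U)\<^sup>\<dagger>" unfolding W_def by (simp add: adjoint_mult[OF EU R] R')
    have "W\<^sup>\<dagger> * W = R * ((E * U)\<^sup>\<dagger> * (E * U * R))"
      unfolding W' unfolding W_def by (rule assoc_mult_mat[OF R EUt]) (rule mult_carrier_mat[OF EU R])
    also have "(E * U)\<^sup>\<dagger> * (E * U * R) = D * R"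
      using assoc_mult_mat[OF EUt EU R] EUEU by simp
    finally have "W\<^sup>\<dagger> * (W\<^sup>\<dagger>)\<^sup>\<dagger> = 0\<^sub>m n n" using RDR by (simp add: R_def)
    then have "W\<^sup>\<dagger> = 0\<^sub>m n m" by (rule mult_adjoint_eq_0[OF adjoint_carrier[OF W]])
    then have "(W\<^sup>\<dagger>)\<^sup>\<dagger> = (0\<^sub>m n m)\<^sup>\<dagger>" by simp
    then have W0: "W = 0\<^sub>m m n" using W by (intro eq_matI) auto
    have EUQc: "E * U * Q \<in> carrier_mat m n" by (rule mult_carrier_mat[OF EU dg(3)])
    have "E * U - E * U * Q = 0\<^sub>m m n"
      using mult_minus_distrib_mat[OF EU one_carrier_mat dg(3)] W0 EU right_mult_one_mat[OF EU]
      by (simp add: W_def R_def)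
    then show ?thesis
      using EU EUQc by (intro eq_matI) (auto simp: mat_eq_iff)
  qed
  have "V * F = E * U * (J * (L * U\<^sup>\<dagger>))"
    unfolding V_def F_def by (rule assoc_mult_mat[OF EU dg(2)]) (rule mult_carrier_mat[OF dg(1) U'])
  also have "J * (L * U\<^sup>\<dagger>) = Q * U\<^sup>\<dagger>" using assoc_mult_mat[OF dg(2,1) U'] JL by simp
  also have "E * U * (Q * U\<^sup>\<dagger>) = E * U * U\<^sup>\<dagger>" using assoc_mult_mat[OF EU dg(3) U'] EUQ by simp
  also have "\<dots> = E" using assoc_mult_mat[OF E dd(1) U'] dd(3) E by simp
  finally show ?thesis using that[OF V pi F _ FF] by simp
qed

section \<open>A bound for dominated pairs\<close>

lemma trace_adjoint: "mat_trace (A\<^sup>\<dagger>) = cnj (mat_trace A)" if "A \<in> carrier_mat n n"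
  using that by (simp add: mat_trace_def)

text \<open>The bound comes from completing squares in both linear terms of \<^const>\<open>ell\<close> with respect to the form \<open>mat_trace (X B X\<^sup>\<dagger>)\<close>.\<close>

lemma divergence_dominated:
  assumes A: "psd n A" and B: "psd n B" and AB: "psd n (complex_of_real k \<cdot>\<^sub>m B - A)" and k: "0 \<le> k"
  shows "divergence n A B \<le> ennreal ((1 + k) * (Re (mat_trace A) + Re (mat_trace B)))"
proof -
  note c [simp] = psdD(1)[OF A] psdD(1)[OF B]
  define T where "T = Re (mat_trace A) + Re (mat_trace B)"
  have T: "0 \<le> T" using psd_trace(2)[OF A] psd_trace(2)[OF B] by (simp add: T_def)
  have square: "\<bar>2 * Re (mat_trace (X\<^sup>\<dagger> * C))\<bar> \<le> e * Re (mat_trace (X * C * X\<^sup>\<dagger>)) + Re (mat_trace C) / e"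
    if C: "psd n C" and X: "X \<in> carrier_mat n n" and e: "0 < e" for C X e
  proof -
    have X': "X\<^sup>\<dagger> \<in> carrier_mat n n" using X by simp
    note [simp] = psdD(1)[OF C] X X' mult_carrier_mat[of _ n n _ n]
    have sgn: "0 \<le> e * Re (mat_trace (X * C * X\<^sup>\<dagger>)) + s * (2 * Re (mat_trace (X\<^sup>\<dagger> * C))) + Re (mat_trace C) / e"
      if s: "s = 1 \<or> s = - 1" for s :: real
    proof -
      \<comment> \<open>The trace of \<open>Z * C * Z\<^sup>\<dagger>\<close> is nonnegative.
        Expanding it and dividing by \<open>e\<close> gives the inequality for the sign
        \<open>s\<close>; the two signs together bound the absolute value.\<close>
      define Z where "Z = complex_of_real e \<cdot>\<^sub>m X + complex_of_real s \<cdot>\<^sub>m 1\<^sub>m n"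
      have Z: "Z \<in> carrier_mat n n" by (simp add: Z_def)
      have Z': "Z\<^sup>\<dagger> = complex_of_real e \<cdot>\<^sub>m X\<^sup>\<dagger> + complex_of_real s \<cdot>\<^sub>m 1\<^sub>m n"
        unfolding Z_def by (simp add: adjoint_add[of _ n n] adjoint_smult)
      have ZC: "Z * C = complex_of_real e \<cdot>\<^sub>m (X * C) + complex_of_real s \<cdot>\<^sub>m C"
        unfolding Z_def by (simp add: left_mult_one_mat[OF psdD(1)[OF C]] add_mult_distrib_mat[of _ n n _ _ n] mult_smult_assoc_mat[of _ n n _ n])
      have ZC': "Z * C \<in> carrier_mat n n" using Z by simp
      have "mat_trace (Z * C * Z\<^sup>\<dagger>) = mat_trace (complex_of_real e \<cdot>\<^sub>m (Z * C * X\<^sup>\<dagger>) + complex_of_real s \<cdot>\<^sub>m (Z * C))"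
        unfolding Z' using ZC'
        by (simp add: right_mult_one_mat[OF ZC'] mult_add_distrib_mat[of _ n n _ n] mult_smult_distrib[of _ n n _ n])
      also have "\<dots> = of_real e * mat_trace (Z * C * X\<^sup>\<dagger>) + of_real s * mat_trace (Z * C)"
        using ZC' by (simp add: trace_add[of _ n] trace_smult[of _ n])
      also have "mat_trace (Z * C * X\<^sup>\<dagger>) = of_real e * mat_trace (X * C * X\<^sup>\<dagger>) + of_real s * mat_trace (C * X\<^sup>\<dagger>)"
        unfolding ZC
        by (simp add: add_mult_distrib_mat[of _ n n _ _ n] mult_smult_assoc_mat[of _ n n _ n] trace_add[of _ n] trace_smult[of _ n])
      also have "mat_trace (Z * C) = of_real e * mat_trace (X * C) + of_real s * mat_trace C"
        unfolding ZC by (simp add: trace_add[of _ n] trace_smult[of _ n])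
      finally have eq: "mat_trace (Z * C * Z\<^sup>\<dagger>) = of_real e * (of_real e * mat_trace (X * C * X\<^sup>\<dagger>)
          + of_real s * mat_trace (C * X\<^sup>\<dagger>)) + of_real s * (of_real e * mat_trace (X * C) + of_real s * mat_trace C)" .
      have "mat_trace (C * X\<^sup>\<dagger>) = mat_trace (X\<^sup>\<dagger> * C)" by (rule trace_comm[OF psdD(1)[OF C] X'])
      moreover have "Re (mat_trace (X * C)) = Re (mat_trace (X\<^sup>\<dagger> * C))"
      proof -
        have "mat_trace ((C * X\<^sup>\<dagger>)\<^sup>\<dagger>) = cnj (mat_trace (C * X\<^sup>\<dagger>))"
          by (rule trace_adjoint[of _ n]) simp
        moreover have "(C * X\<^sup>\<dagger>)\<^sup>\<dagger> = X * C" using adjoint_mult[OF psdD(1)[OF C] X'] psdD(2)[OF C] by simp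
        ultimately show ?thesis using trace_comm[OF psdD(1)[OF C] X'] by simp
      qed
      ultimately have "Re (mat_trace (Z * C * Z\<^sup>\<dagger>)) =
          e * (e * Re (mat_trace (X * C * X\<^sup>\<dagger>)) + s * (2 * Re (mat_trace (X\<^sup>\<dagger> * C)))) + s * s * Re (mat_trace C)"
        unfolding eq by (simp add: algebra_simps)
      also have "\<dots> = e * (e * Re (mat_trace (X * C * X\<^sup>\<dagger>)) + s * (2 * Re (mat_trace (X\<^sup>\<dagger> * C))) + Re (mat_trace C) / e)"
        using e s by (auto simp: distrib_left)
      finally have "Re (mat_trace (Z * C * Z\<^sup>\<dagger>)) =
          e * (e * Re (mat_trace (X * C * X\<^sup>\<dagger>)) + s * (2 * Re (mat_trace (X\<^sup>\<dagger> * C))) + Re (mat_trace C) / e)" .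
      then show ?thesis using trace_psd_conj_nonneg[OF C Z] e by (simp add: zero_le_mult_iff)
    qed
    show ?thesis using sgn[of 1] sgn[of "- 1"] by linarith
  qed
  have quad: "ennreal t * quad_div n t A B \<le> ennreal ((1 + k) * T)" if t: "0 < t" "t < 1" for t
  proof -
    \<comment> \<open>The bound blows up like \<open>1 / t\<close>, which the weight
      \<open>t\<close> in the divergence cancels.\<close>
    have "quad_div n t A B \<le> ennreal ((1 + k) * T / t)"
      unfolding quad_div_def
    proof (rule SUP_least)
      fix X :: "complex mat" assume X [simp]: "X \<in> carrier_mat n n"
      have X' [simp]: "X\<^sup>\<dagger> \<in> carrier_mat n n" by simp
      \<comment> \<open>The quadratic terms left by the two squares are at most
        \<open>e (1 + k)\<close> times the form of \<open>B\<close>. This choice makes that factor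
        equal to \<open>t\<close>, so the negative quadratic term of \<open>ell\<close> absorbs
        them.\<close>
      define e where "e = t / (1 + k)"
      have e: "0 < e" using t k by (simp add: e_def)
      define xB where "xB = Re (mat_trace (X * B * X\<^sup>\<dagger>))"
      define xA where "xA = Re (mat_trace (X * A * X\<^sup>\<dagger>))"
      have "xA \<le> k * xB"
      proof -
        note [simp] = mult_carrier_mat[of _ n n _ n]
        have "mat_trace (X * (complex_of_real k \<cdot>\<^sub>m B - A) * X\<^sup>\<dagger>) =
            of_real k * mat_trace (X * B * X\<^sup>\<dagger>) - mat_trace (X * A * X\<^sup>\<dagger>)"
          by (simp add: mult_minus_distrib_mat[of _ n n _ n] mult_smult_distrib[of _ n n _ n] minus_mult_distrib_mat[of _ n n _ _ n]
            mult_smult_assoc_mat[of _ n n _ n] trace_minus[of _ n] trace_smult[of _ n])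
        then show ?thesis using trace_psd_conj_nonneg[OF AB X] by (simp add: xA_def xB_def)
      qed
      then have "e * xB + e * xA \<le> e * (1 + k) * xB"
        using mult_left_mono[of xA "k * xB" e] e by (simp add: algebra_simps)
      also have "e * (1 + k) = t" using k by (simp add: e_def)
      finally have le: "e * xB + e * xA \<le> t * xB" .
      have "0 \<le> (1 - t) * Re (mat_trace (X\<^sup>\<dagger> * A * X))"
        using trace_psd_conj_nonneg[OF A X'] t by simp
      then have "ell t A B X \<le> 2 * Re (mat_trace (X\<^sup>\<dagger> * B)) - 2 * Re (mat_trace (X\<^sup>\<dagger> * A)) - t * xB"
        by (simp add: ell_expand[of _ n] xB_def)
      also have "\<dots> \<le> (e * xB + Re (mat_trace B) / e) + (e * xA + Re (mat_trace A) / e) - t * xB"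
        using square[OF B X e] square[OF A X e] unfolding xA_def xB_def by linarith
      also have "\<dots> \<le> T / e" using le by (simp add: T_def add_divide_distrib)
      finally show "ennreal (ell t A B X) \<le> ennreal ((1 + k) * T / t)"
        by (intro ennreal_leI) (simp add: e_def mult.commute)
    qed
    then have "ennreal t * quad_div n t A B \<le> ennreal t * ennreal ((1 + k) * T / t)"
      by (rule mult_left_mono) simp
    also have "\<dots> = ennreal ((1 + k) * T)" using t by (subst ennreal_mult'[symmetric]) auto
    finally show ?thesis .
  qed
  have "divergence n A B \<le> (\<integral>\<^sup>+t. ennreal ((1 + k) * T) * indicator {0<..<1} (t :: real) \<partial>lborel)"
    unfolding divergence_def by (intro nn_integral_mono) (auto simp: quad split: split_indicator)
  also have "\<dots> = ennreal ((1 + k) * T)" by (subst nn_integral_cmult_indicator) auto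
  finally show ?thesis by (simp add: T_def)
qed

section \<open>The quantum relative entropy in terms of the divergence\<close>

text \<open>For uniqueness, two diagonalisations of \<open>A\<close> are compared by the unitary
  \<open>W\<close> between their eigenbases. Its entries vanish unless the two eigenvalues agree, so
  \<open>W\<close> also intertwines the diagonal matrices obtained by applying
  \<open>f\<close>.\<close>

lemma herm_fun_diagonalises:
  assumes "diagonalises n U l A"
  shows "herm_fun f A = U * mat_diag n (\<lambda>i. complex_of_real (f (l i))) * U\<^sup>\<dagger>"
  unfolding herm_fun_def
proof (rule the_equality)
  note U = diagonalisesD[OF assms]
  have dim: "dim_row A = n" using U(5) by simp
  let ?B = "U * mat_diag n (\<lambda>i. complex_of_real (f (l i))) * U\<^sup>\<dagger>"
  show "\<exists>U l. U \<in> carrier_mat (dim_row A) (dim_row A) \<and> U\<^sup>\<dagger> * U = 1\<^sub>m (dim_row A) \<and>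
      A = U * mat_diag (dim_row A) (\<lambda>i. complex_of_real (l i)) * U\<^sup>\<dagger> \<and>
      ?B = U * mat_diag (dim_row A) (\<lambda>i. complex_of_real (f (l i))) * U\<^sup>\<dagger>"
    unfolding dim using U(1,2,4) by blast
  fix B
  assume "\<exists>U l. U \<in> carrier_mat (dim_row A) (dim_row A) \<and> U\<^sup>\<dagger> * U = 1\<^sub>m (dim_row A) \<and>
      A = U * mat_diag (dim_row A) (\<lambda>i. complex_of_real (l i)) * U\<^sup>\<dagger> \<and>
      B = U * mat_diag (dim_row A) (\<lambda>i. complex_of_real (f (l i))) * U\<^sup>\<dagger>"
  then obtain V m where "diagonalises n V m A"
    and B: "B = V * mat_diag n (\<lambda>i. complex_of_real (f (m i))) * V\<^sup>\<dagger>"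
    unfolding dim diagonalises_def by blast
  note d = this(1)
  note V = diagonalisesD[OF d]
  have U': "U\<^sup>\<dagger> \<in> carrier_mat n n" and V': "V\<^sup>\<dagger> \<in> carrier_mat n n" using U(1) V(1) by auto
  define W where "W = V\<^sup>\<dagger> * U"
  have W: "W \<in> carrier_mat n n" unfolding W_def by (rule mult_carrier_mat[OF V' U(1)])
  note sq = mult_carrier_mat[of _ n n _ n] assoc_mult_mat[of _ n n _ n _ n] U(1) V(1) U(5) V(5) U' V' W
  have cancel: "V * (V\<^sup>\<dagger> * Z) = Z" "U * (U\<^sup>\<dagger> * Z) = Z" "U\<^sup>\<dagger> * (U * Z) = Z"  if "Z \<in> carrier_mat n n" for Z
    using that assoc_mult_mat[OF V(1) V' that] assoc_mult_mat[OF U(1) U' that]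
      assoc_mult_mat[OF U' U(1) that] U(2,3) V(3) by simp_all
  have "W * mat_diag n (\<lambda>i. complex_of_real (l i)) = V\<^sup>\<dagger> * (A * U)"
    unfolding diagonalises_conj[OF assms, symmetric] W_def by (simp add: sq cancel)
  also have "V\<^sup>\<dagger> * (A * U) = mat_diag n (\<lambda>i. complex_of_real (m i)) * W"
    unfolding diagonalises_conj[OF d, symmetric] W_def by (simp add: sq cancel)
  finally have WD: "W * mat_diag n (\<lambda>i. complex_of_real (l i)) = mat_diag n (\<lambda>i. complex_of_real (m i)) * W" .
  have entry: "W $$ (j, i) * complex_of_real (l i) = complex_of_real (m j) * W $$ (j, i)" if "i < n" "j < n" for i j
    using arg_cong[OF WD, of "\<lambda>X. X $$ (j, i)"] that
    unfolding mat_diag_mult_right[OF W] mat_diag_mult_left[OF W] by simp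
  have "W * mat_diag n (\<lambda>i. complex_of_real (f (l i))) = mat_diag n (\<lambda>i. complex_of_real (f (m i))) * W"
    unfolding mat_diag_mult_right[OF W] mat_diag_mult_left[OF W]
  proof (rule eq_matI, goal_cases)
    case (1 j i)
    then have ij: "i < n" "j < n" by auto
    have "W $$ (j, i) = 0 \<or> l i = m j"
      using entry[OF ij] by (simp add: mult.commute)
    then show ?case using ij by auto
  qed auto
  then have "V * (W * mat_diag n (\<lambda>i. complex_of_real (f (l i))) * U\<^sup>\<dagger>) =
      V * (mat_diag n (\<lambda>i. complex_of_real (f (m i))) * W * U\<^sup>\<dagger>)" by simp
  then show "B = ?B" unfolding B W_def using U(3) by (simp add: sq cancel right_mult_one_mat[OF V'])
qed

lemma mat_log_diagonalises:
  assumes "diagonalises n U l A"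
  shows "mat_log A = U * mat_diag n (\<lambda>i. complex_of_real (lg (l i))) * U\<^sup>\<dagger>"
  unfolding mat_log_def herm_fun_diagonalises[OF assms] lg_def ..

context spectral_pair
begin

lemma trace_relative_entropy: "Re (mat_trace (A * (mat_log A - mat_log B))) = rel_ent"
proof -
  let ?la = "mat_diag n (\<lambda>i. complex_of_real (lg (a i)))" and ?lb = "mat_diag n (\<lambda>i. complex_of_real (lg (b i)))"
  let ?C = "U\<^sup>\<dagger> * V"
  have C: "?C \<in> carrier_mat n n" by (simp add: sq)
  have C': "?C\<^sup>\<dagger> = V\<^sup>\<dagger> * U" by (simp add: adjoint_mult[OF U' V(1)])
  have logs: "mat_log A = U * ?la * U\<^sup>\<dagger>" "mat_log B = V * ?lb * V\<^sup>\<dagger>"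
    by (rule mat_log_diagonalises[OF dA], rule mat_log_diagonalises[OF dB])
  have logs_carrier: "mat_log A \<in> carrier_mat n n" "mat_log B \<in> carrier_mat n n"
    unfolding logs by (simp_all add: sq)
  have 1: "mat_trace (A * mat_log A) = of_real (\<Sum>i<n. a i * lg (a i))"
  proof -
    have "A * mat_log A = U * (Da * ?la * U\<^sup>\<dagger>)"
      unfolding logs unfolding U(4) by (simp add: sq cancel del: mat_diag_diag)
    then have "mat_trace (A * mat_log A) = mat_trace (Da * ?la)"
      using trace_conj(1)[of "Da * ?la"] by (simp add: sq del: mat_diag_diag)
    also have "\<dots> = of_real (\<Sum>i<n. a i * lg (a i))"
      unfolding mat_diag_diag by (simp add: mat_trace_def)
    finally show ?thesis .
  qed
  have 2: "mat_trace (A * mat_log B) = of_real (\<Sum>i<n. \<Sum>j<n. (cmod (c i j))\<^sup>2 * (a i * lg (b j)))"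
  proof -
    have "A * mat_log B = U * (Da * (?C * ?lb * V\<^sup>\<dagger>))"
      unfolding logs unfolding U(4) by (simp add: sq cancel)
    then have "mat_trace (A * mat_log B) = mat_trace ((Da * ?C) * (?lb * ?C\<^sup>\<dagger>))"
      using trace_comm[of U n n "Da * (?C * ?lb * V\<^sup>\<dagger>)"] unfolding C' by (simp add: sq)
    also have "\<dots> = (\<Sum>i<n. \<Sum>j<n. of_real (a i) * c i j * (of_real (lg (b j)) * cnj (c i j)))"
    proof -
      have adj: "?C\<^sup>\<dagger> $$ (j, i) = cnj (?C $$ (i, j))" if "i < n" "j < n" for i j
        using adjoint_index[of j ?C i] carrier_matD[OF C] that by simp
      show ?thesis
        unfolding mat_diag_mult_left[OF C] mat_diag_mult_left[OF adjoint_carrier[OF C]]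
        by (subst trace_mult[of _ n n]) (auto simp: c_def adj simp del: index_mult_mat(1) intro!: sum.cong)
    qed
    also have "\<dots> = of_real (\<Sum>i<n. \<Sum>j<n. (cmod (c i j))\<^sup>2 * (a i * lg (b j)))"
      unfolding of_real_sum by (intro sum.cong refl) (simp add: complex_norm_square mult_ac del: of_real_power)
    finally show ?thesis .
  qed
  have "A * (mat_log A - mat_log B) = A * mat_log A - A * mat_log B"
    by (rule mult_minus_distrib_mat[OF U(5) logs_carrier])
  then have "mat_trace (A * (mat_log A - mat_log B)) = mat_trace (A * mat_log A) - mat_trace (A * mat_log B)"
    using trace_minus[OF mult_carrier_mat[OF U(5) logs_carrier(1)] mult_carrier_mat[OF U(5) logs_carrier(2)]] by simp
  then have "Re (mat_trace (A * (mat_log A - mat_log B))) =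
      (\<Sum>i<n. \<Sum>j<n. (cmod (c i j))\<^sup>2 * (a i * lg (a i))) - (\<Sum>i<n. \<Sum>j<n. (cmod (c i j))\<^sup>2 * (a i * lg (b j)))"
    unfolding 1 2 weighted_sums(1) by simp
  also have "\<dots> = rel_ent" unfolding rel_ent_def by (simp add: algebra_simps flip: sum_subtractf)
  finally show ?thesis .
qed

lemma eigenvectors:
  assumes "j < n"
  shows "A *\<^sub>v col U j = complex_of_real (a j) \<cdot>\<^sub>v col U j" "B *\<^sub>v col V j = complex_of_real (b j) \<cdot>\<^sub>v col V j"
proof -
  have *: "A *\<^sub>v col U j = complex_of_real (a j) \<cdot>\<^sub>v col U j" if d: "diagonalises n U a A" for U a A
  proof -
    note U = diagonalisesD[OF d]
    have U': "U\<^sup>\<dagger> \<in> carrier_mat n n" using U(1) by simp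
    let ?D = "mat_diag n (\<lambda>i. complex_of_real (a i))"
    have UD: "U * ?D \<in> carrier_mat n n" by (rule mult_carrier_mat[OF U(1) mat_diag_dim])
    have "A * U = U * ?D"
      using assoc_mult_mat[OF UD U' U(1)] U(2) UD unfolding U(4)[symmetric] by simp
    then have "col (A * U) j = col (U * ?D) j" by simp
    moreover have "col (A * U) j = A *\<^sub>v col U j" by (rule col_mult2[OF U(5,1) assms])
    moreover have "col (U * ?D) j = complex_of_real (a j) \<cdot>\<^sub>v col U j"
      unfolding mat_diag_mult_right[OF U(1)] using assms U(1) by (intro eq_vecI) auto
    ultimately show ?thesis by simp
  qed
  show "A *\<^sub>v col U j = complex_of_real (a j) \<cdot>\<^sub>v col U j" "B *\<^sub>v col V j = complex_of_real (b j) \<cdot>\<^sub>v col V j"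
    by (rule *[OF dA], rule *[OF dB])
qed

lemma hermitian: "A\<^sup>\<dagger> = A"
proof -
  have UD: "U * Da \<in> carrier_mat n n" by (simp add: sq)
  have "A\<^sup>\<dagger> = U * (Da * U\<^sup>\<dagger>)"
    unfolding U(4) by (simp add: adjoint_mult[OF UD U'] adjoint_mult[OF U(1) mat_diag_dim])
  then show ?thesis unfolding U(4) by (simp add: sq)
qed

text \<open>The support is the orthogonal complement of the kernel. An eigenvector of
  \<open>A\<close> with positive eigenvalue lies in the support, one of \<open>B\<close> with
  eigenvalue 0 in the kernel, so inclusion makes them orthogonal. Conversely a kernel vector of
  \<open>B\<close> only has coordinates on null eigenvectors of \<open>B\<close>, and vanishing
  overlaps let \<open>A\<close> kill it; inclusion of kernels reverses to supports.\<close>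

lemma supp_subset_iff:
  "supp A \<subseteq> supp B \<longleftrightarrow> (\<forall>i<n. \<forall>j<n. 0 < a i \<longrightarrow> b j = 0 \<longrightarrow> c i j = 0)"
proof
  have dims: "dim_col A = n" "dim_col B = n" "dim_row A = n" "dim_row B = n" using U(5) V(5) by auto
  have kerA: "mat_kernel A = {w \<in> carrier_vec n. A *\<^sub>v w = 0\<^sub>v n}"
    and kerB: "mat_kernel B = {w \<in> carrier_vec n. B *\<^sub>v w = 0\<^sub>v n}"
    by (auto simp: mat_kernel_def dims)
  {
    assume sub: "supp A \<subseteq> supp B"
    show "\<forall>i<n. \<forall>j<n. 0 < a i \<longrightarrow> b j = 0 \<longrightarrow> c i j = 0"
    proof (intro allI impI)
      fix i j assume ij: "i < n" "j < n" and ai: "0 < a i" and bj: "b j = 0"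
      let ?u = "col U i" and ?v = "col V j"
      have uv: "?u \<in> carrier_vec n" "?v \<in> carrier_vec n" using U(1) V(1) ij by auto
      have "?u \<in> supp A"
        unfolding supp_def dims kerA
      proof (intro CollectI conjI ballI uv(1))
        fix w assume "w \<in> {w \<in> carrier_vec n. A *\<^sub>v w = 0\<^sub>v n}"
        then have w: "w \<in> carrier_vec n" "A *\<^sub>v w = 0\<^sub>v n" by auto
        have "(A *\<^sub>v ?u) \<bullet>c w = 0"
          using cscalar_prod_adjoint[OF U(5) uv(1) w(1)] uv(1) unfolding hermitian w(2) by simp
        then have "of_real (a i) * (?u \<bullet>c w) = 0"
          unfolding eigenvectors(1)[OF ij(1)] using uv(1) w(1) by simp
        then show "?u \<bullet>c w = 0" using ai by simp
      qed
      then have "?u \<in> supp B" using sub by blast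
      moreover have "?v \<in> mat_kernel B"
        unfolding kerB using eigenvectors(2)[OF ij(2)] bj uv(2) carrier_matD[OF V(1)] by (auto intro!: eq_vecI)
      ultimately have "?u \<bullet>c ?v = 0" by (simp add: supp_def)
      moreover have "c i j = cnj (?u \<bullet>c ?v)"
        unfolding c_def mult_index[OF U' V(1) ij] using ij U(1) V(1)
        by (simp add: scalar_prod_def atLeast0LessThan)
      ultimately show "c i j = 0" by simp
    qed
  }
  {
    assume c0: "\<forall>i<n. \<forall>j<n. 0 < a i \<longrightarrow> b j = 0 \<longrightarrow> c i j = 0"
    have "mat_kernel B \<subseteq> mat_kernel A"
    proof
      fix w assume "w \<in> mat_kernel B"
      then have w: "w \<in> carrier_vec n" "B *\<^sub>v w = 0\<^sub>v n" by (auto simp: kerB)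
      define z where "z = V\<^sup>\<dagger> *\<^sub>v w"
      have z: "z \<in> carrier_vec n" unfolding z_def by (rule mult_mat_vec_carrier[OF V' w(1)])
      have wz: "w = V *\<^sub>v z"
        unfolding z_def using assoc_mult_mat_vec[OF V(1) V' w(1)] V(3) w(1) by simp
      have bz: "z $ j = 0 \<or> b j = 0" if j: "j < n" for j
      proof -
        have "(Db *\<^sub>v z) = V\<^sup>\<dagger> *\<^sub>v (B *\<^sub>v w)"
        proof -
          have "V\<^sup>\<dagger> *\<^sub>v (B *\<^sub>v w) = (V\<^sup>\<dagger> * B) *\<^sub>v w"
            by (rule assoc_mult_mat_vec[OF V' V(5) w(1), symmetric])
          also have "V\<^sup>\<dagger> * B = Db * V\<^sup>\<dagger>" unfolding V(4) by (simp add: sq cancel)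
          also have "(Db * V\<^sup>\<dagger>) *\<^sub>v w = Db *\<^sub>v z"
            unfolding z_def by (rule assoc_mult_mat_vec[OF mat_diag_dim V' w(1)])
          finally show ?thesis ..
        qed
        also have "\<dots> = 0\<^sub>v n" unfolding w(2) using carrier_matD[OF V(1)] by (auto intro!: eq_vecI simp: scalar_prod_def)
        finally have "(Db *\<^sub>v z) $ j = 0" using j by simp
        moreover have "(Db *\<^sub>v z) $ j = of_real (b j) * z $ j"
        proof -
          have "(Db *\<^sub>v z) $ j = (\<Sum>k<n. (if j = k then of_real (b k) else 0) * z $ k)"
            using j z by (simp add: scalar_prod_def atLeast0LessThan)
          also have "\<dots> = (\<Sum>k<n. if j = k then of_real (b k) * z $ k else 0)"
            by (intro sum.cong refl) auto
          finally show ?thesis using j by simp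
        qed
        ultimately show ?thesis using j by auto
      qed
      have "A *\<^sub>v w = (U * (Da * (U\<^sup>\<dagger> * V))) *\<^sub>v z"
      proof -
        have "A *\<^sub>v w = (A * V) *\<^sub>v z" unfolding wz by (rule assoc_mult_mat_vec[OF U(5) V(1) z, symmetric])
        also have "A * V = U * (Da * (U\<^sup>\<dagger> * V))" unfolding U(4) by (simp add: sq)
        finally show ?thesis .
      qed
      also have "\<dots> = U *\<^sub>v ((Da * (U\<^sup>\<dagger> * V)) *\<^sub>v z)"
        by (rule assoc_mult_mat_vec[OF U(1) _ z]) (simp add: sq)
      also have "(Da * (U\<^sup>\<dagger> * V)) *\<^sub>v z = 0\<^sub>v n"
      proof (rule eq_vecI)
        fix i assume "i < dim_vec (0\<^sub>v n :: complex vec)"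
        then have i: "i < n" by simp
        have C: "U\<^sup>\<dagger> * V \<in> carrier_mat n n" by (simp add: sq)
        have "((Da * (U\<^sup>\<dagger> * V)) *\<^sub>v z) $ i = (\<Sum>j<n. of_real (a i) * c i j * z $ j)"
          unfolding mat_diag_mult_left[OF C] using i z by (simp add: c_def scalar_prod_def atLeast0LessThan del: index_mult_mat(1))
        also have "\<dots> = 0"
        proof (intro sum.neutral ballI)
          fix j assume "j \<in> {..<n}"
          then have j: "j < n" by simp
          show "of_real (a i) * c i j * z $ j = 0"
            using c0[rule_format, OF i j] bz[OF j] a0[OF i] by (cases "a i = 0") auto
        qed
        finally show "((Da * (U\<^sup>\<dagger> * V)) *\<^sub>v z) $ i = 0\<^sub>v n $ i" using i by simp
      qed (use U(1) V(1) in auto)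
      also have "U *\<^sub>v 0\<^sub>v n = 0\<^sub>v n" using carrier_matD[OF U(1)] by (auto intro!: eq_vecI simp: scalar_prod_def)
      finally show "w \<in> mat_kernel A" using w(1) by (simp add: kerA)
    qed
    then show "supp A \<subseteq> supp B" unfolding supp_def dims by auto
  }
qed

lemma S_Q_divergence:
  "enn2ereal (divergence n A B) = S_Q A B + ereal (Re (mat_trace B) - Re (mat_trace A))"
proof (cases "supp A \<subseteq> supp B")
  case True
  then have *: "c i j = 0" if "i < n" "j < n" "0 < a i" "b j = 0" for i j
    using that unfolding supp_subset_iff by blast
  have fin: "divergence n A B = ennreal (rel_ent - Re (mat_trace A) + Re (mat_trace B))"
    "0 \<le> rel_ent - Re (mat_trace A) + Re (mat_trace B)"
    by (rule divergence_finite, rule *, assumption+)+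
  have "S_Q A B = ereal rel_ent" using True by (simp add: S_Q_def trace_relative_entropy)
  then show ?thesis unfolding fin(1) enn2ereal_ennreal[OF fin(2)] by simp
next
  case False
  then obtain i j where "i < n" "j < n" "0 < a i" "b j = 0" "c i j \<noteq> 0"
    unfolding supp_subset_iff by blast
  then have "divergence n A B = \<infinity>" by (intro divergence_infinite)
  then show ?thesis using False by (simp add: S_Q_def)
qed

text \<open>Positive factors leave the eigenbases alone and shift the logarithms by
  \<open>ln t - ln u\<close>; the remaining correction comes from the traces. It can be negative,
  which is why the identity lives in \<open>ereal\<close>.\<close>

lemma scale:
  assumes "0 < t" "0 < u"
  shows "enn2ereal (divergence n (complex_of_real t \<cdot>\<^sub>m A) (complex_of_real u \<cdot>\<^sub>m B)) =
    ereal t * enn2ereal (divergence n A B) +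
    ereal ((u - t) * Re (mat_trace B) + t * (ln t - ln u) * Re (mat_trace A))"
proof -
  have scale_diag: "diagonalises n U (\<lambda>i. x * l i) (complex_of_real x \<cdot>\<^sub>m M)" if d: "diagonalises n U l M" for x U l M
  proof -
    note U = diagonalisesD[OF d]
    have U': "U\<^sup>\<dagger> \<in> carrier_mat n n" using U(1) by simp
    have UD: "U * mat_diag n (\<lambda>i. complex_of_real (l i)) \<in> carrier_mat n n" by (rule mult_carrier_mat[OF U(1) mat_diag_dim])
    have "mat_diag n (\<lambda>i. complex_of_real (x * l i)) = complex_of_real x \<cdot>\<^sub>m mat_diag n (\<lambda>i. complex_of_real (l i))"
      by (rule eq_matI) auto
    then have "U * mat_diag n (\<lambda>i. complex_of_real (x * l i)) * U\<^sup>\<dagger> = complex_of_real x \<cdot>\<^sub>m M"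
      unfolding U(4) using mult_smult_distrib[OF U(1) mat_diag_dim] mult_smult_assoc_mat[OF UD U'] by simp
    then show ?thesis using U(1,2) by (simp add: diagonalises_def)
  qed
  interpret s: spectral_pair n "complex_of_real t \<cdot>\<^sub>m A" "complex_of_real u \<cdot>\<^sub>m B" U V "\<lambda>i. t * a i" "\<lambda>i. u * b i"
    by unfold_locales (use assms a0 b0 scale_diag[OF dA] scale_diag[OF dB] in auto)
  have tr: "mat_trace (complex_of_real t \<cdot>\<^sub>m A) = of_real t * mat_trace A"
    "mat_trace (complex_of_real u \<cdot>\<^sub>m B) = of_real u * mat_trace B"
    by (rule trace_smult[OF U(5)], rule trace_smult[OF V(5)])
  show ?thesis
  proof (cases "\<forall>i<n. \<forall>j<n. 0 < a i \<longrightarrow> b j = 0 \<longrightarrow> c i j = 0")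
    case True
    then have *: "c i j = 0" if "i < n" "j < n" "0 < a i" "b j = 0" for i j using that by blast
    then have **: "s.c i j = 0" if "i < n" "j < n" "0 < t * a i" "u * b j = 0" for i j
      using that assms by (auto simp: zero_less_mult_iff)
    have "s.rel_ent = (\<Sum>i<n. \<Sum>j<n. t * ((cmod (c i j))\<^sup>2 * (a i * (lg (a i) - lg (b j)))) +
        t * (ln t - ln u) * ((cmod (c i j))\<^sup>2 * a i))"
      unfolding s.rel_ent_def
    proof (intro sum.cong refl)
      fix i j assume "i \<in> {..<n}" "j \<in> {..<n}"
      then have ij: "i < n" "j < n" by auto
      consider "a i = 0" | "c i j = 0" | "0 < a i" "0 < b j"
        using *[OF ij] a0[OF ij(1)] b0[OF ij(2)] by fastforce
      then show "(cmod (c i j))\<^sup>2 * (t * a i * (lg (t * a i) - lg (u * b j))) =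
          t * ((cmod (c i j))\<^sup>2 * (a i * (lg (a i) - lg (b j)))) + t * (ln t - ln u) * ((cmod (c i j))\<^sup>2 * a i)"
        using assms by cases (simp_all add: lg_def ln_mult algebra_simps)
    qed
    also have "\<dots> = t * rel_ent + t * (ln t - ln u) * Re (mat_trace A)"
      unfolding rel_ent_def by (simp add: sum.distrib weighted_sums trace_eigenvalues flip: sum_distrib_left)
    finally have S: "s.rel_ent = t * rel_ent + t * (ln t - ln u) * Re (mat_trace A)" .
    have fin: "divergence n A B = ennreal (rel_ent - Re (mat_trace A) + Re (mat_trace B))"
      "0 \<le> rel_ent - Re (mat_trace A) + Re (mat_trace B)"
      by (rule divergence_finite, rule *, assumption+)+
    have s_fin: "divergence n (complex_of_real t \<cdot>\<^sub>m A) (complex_of_real u \<cdot>\<^sub>m B) =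
        ennreal (s.rel_ent - Re (mat_trace (complex_of_real t \<cdot>\<^sub>m A)) + Re (mat_trace (complex_of_real u \<cdot>\<^sub>m B)))"
      "0 \<le> s.rel_ent - Re (mat_trace (complex_of_real t \<cdot>\<^sub>m A)) + Re (mat_trace (complex_of_real u \<cdot>\<^sub>m B))"
      by (rule s.divergence_finite, rule **, assumption+)+
    have "enn2ereal (divergence n A B) = ereal (rel_ent - Re (mat_trace A) + Re (mat_trace B))"
      unfolding fin(1) by (rule enn2ereal_ennreal[OF fin(2)])
    moreover have "enn2ereal (divergence n (complex_of_real t \<cdot>\<^sub>m A) (complex_of_real u \<cdot>\<^sub>m B)) =
        ereal (s.rel_ent - t * Re (mat_trace A) + u * Re (mat_trace B))"
      using enn2ereal_ennreal[OF s_fin(2)] unfolding s_fin(1) unfolding tr by simp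
    ultimately show ?thesis unfolding S by (simp add: algebra_simps)
  next
    case False
    then obtain i j where ij: "i < n" "j < n" "0 < a i" "b j = 0" "c i j \<noteq> 0" by blast
    have "divergence n A B = \<infinity>" by (rule divergence_infinite) (use ij in auto)
    moreover have "divergence n (complex_of_real t \<cdot>\<^sub>m A) (complex_of_real u \<cdot>\<^sub>m B) = \<infinity>"
      by (rule s.divergence_infinite[of i j]) (use ij assms in auto)
    ultimately show ?thesis using assms by simp
  qed
qed

end

lemma S_Q_eq_divergence:
  assumes "psd n A" "psd n B"
  shows "enn2ereal (divergence n A B) = S_Q A B + ereal (Re (mat_trace B) - Re (mat_trace A))"
proof -
  obtain U V a b where "spectral_pair n A B U V a b" by (rule exists_spectral_pair[OF assms])
  then show ?thesis by (rule spectral_pair.S_Q_divergence)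
qed

lemma divergence_scale:
  assumes "psd n A" "psd n B" "0 < t" "0 < u"
  shows "enn2ereal (divergence n (complex_of_real t \<cdot>\<^sub>m A) (complex_of_real u \<cdot>\<^sub>m B)) =
    ereal t * enn2ereal (divergence n A B) +
    ereal ((u - t) * Re (mat_trace B) + t * (ln t - ln u) * Re (mat_trace A))"
proof -
  obtain U V a b where "spectral_pair n A B U V a b" by (rule exists_spectral_pair[OF assms(1,2)])
  then show ?thesis by (rule spectral_pair.scale) (use assms in auto)
qed

text \<open>Eigenbases adapted to the blocks have zero overlap across different blocks. Since 0
  times \<open>\<infinity>\<close> is 0 in \<open>ennreal\<close>, the mixed terms disappear even
  where \<open>phi\<close> is infinite.\<close>

lemma divergence_block_diag:
  assumes A: "\<And>k. k < r \<Longrightarrow> psd d (A k)" and B: "\<And>k. k < r \<Longrightarrow> psd d (B k)"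
  shows "divergence (r * d) (block_diag d r A) (block_diag d r B) = (\<Sum>k<r. divergence d (A k) (B k))"
proof -
  have "\<forall>k. \<exists>U V a b. k < r \<longrightarrow> spectral_pair d (A k) (B k) U V a b"
  proof
    fix k
    show "\<exists>U V a b. k < r \<longrightarrow> spectral_pair d (A k) (B k) U V a b"
    proof (cases "k < r")
      case True
      obtain U V a b where "spectral_pair d (A k) (B k) U V a b"
        by (rule exists_spectral_pair[OF A[OF True] B[OF True]])
      then show ?thesis by blast
    qed simp
  qed
  then obtain U V a b where "\<forall>k. k < r \<longrightarrow> spectral_pair d (A k) (B k) (U k) (V k) (a k) (b k)"
    unfolding choice_iff by blast
  then have s: "spectral_pair d (A k) (B k) (U k) (V k) (a k) (b k)" if "k < r" for k
    using that by blast
  have dA: "diagonalises d (U k) (a k) (A k)" and dB: "diagonalises d (V k) (b k) (B k)"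
    and ab0: "\<And>i. i < d \<Longrightarrow> 0 \<le> a k i" "\<And>i. i < d \<Longrightarrow> 0 \<le> b k i" if "k < r" for k
    using s[OF that] by (auto simp: spectral_pair_def)
  interpret P: spectral_pair "r * d" "block_diag d r A" "block_diag d r B" "block_diag d r U" "block_diag d r V"
    "\<lambda>i. a (i div d) (i mod d)" "\<lambda>i. b (i div d) (i mod d)"
    by unfold_locales (auto intro!: diagonalises_block_diag dA dB ab0 block_index_bounds)
  have Uc: "U k \<in> carrier_mat d d" "(U k)\<^sup>\<dagger> \<in> carrier_mat d d" "V k \<in> carrier_mat d d" if "k < r" for k
    using diagonalisesD(1)[OF dA[OF that]] diagonalisesD(1)[OF dB[OF that]] by auto
  have C: "P.c i j = (if i div d = j div d then ((U (i div d))\<^sup>\<dagger> * V (i div d)) $$ (i mod d, j mod d) else 0)"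
    if "i < r * d" "j < r * d" for i j
    unfolding P.c_def using that Uc
    by (simp add: adjoint_block_diag block_diag_mult block_diag_index del: index_mult_mat(1))
  have cl: "k * d + i < r * d" if "i < d" "k < r" for i k
  proof -
    have "k * d + i < Suc k * d" using that by simp
    also have "\<dots> \<le> r * d" using that by (intro mult_right_mono) auto
    finally show ?thesis .
  qed
  have "divergence (r * d) (block_diag d r A) (block_diag d r B) =
      (\<Sum>k<r. \<Sum>i<d. \<Sum>k'<r. \<Sum>j<d. if k' = k then
        ennreal ((cmod (((U k)\<^sup>\<dagger> * V k) $$ (i, j)))\<^sup>2) * phi (a k i) (b k j) else 0)"
    unfolding P.divergence_spectral sum_blocks
    by (intro sum.cong refl) (auto simp: C cl simp del: index_mult_mat(1))
  also have "\<dots> = (\<Sum>k<r. \<Sum>i<d. \<Sum>k'<r. if k' = k then (\<Sum>j<d.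
        ennreal ((cmod (((U k)\<^sup>\<dagger> * V k) $$ (i, j)))\<^sup>2) * phi (a k i) (b k j)) else 0)"
    by (intro sum.cong refl) auto
  also have "\<dots> = (\<Sum>k<r. \<Sum>i<d. \<Sum>j<d.
        ennreal ((cmod (((U k)\<^sup>\<dagger> * V k) $$ (i, j)))\<^sup>2) * phi (a k i) (b k j))"
    by (rule sum.cong[OF refl], rule sum.cong[OF refl]) (simp del: index_mult_mat(1))
  also have "\<dots> = (\<Sum>k<r. divergence d (A k) (B k))"
    by (intro sum.cong refl)
       (simp add: spectral_pair.divergence_spectral[OF s] spectral_pair.c_def[OF s] del: index_mult_mat(1))
  finally show ?thesis .
qed

text \<open>Only the trace correction survives. This value accounts for the outcomes of probability
  0 that the definition of \<open>S_A_value\<close> omits.\<close>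

lemma divergence_zero_left:
  assumes A: "psd n A" and B: "psd n B" and 0: "Re (mat_trace A) = 0"
  shows "divergence n A B = ennreal (Re (mat_trace B))"
proof -
  obtain U V a b where "spectral_pair n A B U V a b" by (rule exists_spectral_pair[OF A B])
  then interpret spectral_pair n A B U V a b .
  have "(\<Sum>i<n. a i) = 0" using 0 trace_eigenvalues(1) by simp
  then have a: "a i = 0" if "i < n" for i
    using that a0 by (subst (asm) sum_nonneg_eq_0_iff) auto
  have "rel_ent = 0" unfolding rel_ent_def by (intro sum.neutral ballI) (simp add: a)
  moreover have "divergence n A B = ennreal (rel_ent - Re (mat_trace A) + Re (mat_trace B))"
    by (rule divergence_finite) (use a in auto)
  ultimately show ?thesis using 0 by simp
qed

lemma divergence_zero_right:
  assumes A: "psd n A" and B: "psd n B" and pos: "0 < Re (mat_trace A)" and 0: "Re (mat_trace B) = 0"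
  shows "divergence n A B = \<infinity>"
proof -
  obtain U V a b where "spectral_pair n A B U V a b" by (rule exists_spectral_pair[OF A B])
  then interpret spectral_pair n A B U V a b .
  have "(\<Sum>i<n. b i) = 0" using 0 trace_eigenvalues(2) by simp
  then have b: "b i = 0" if "i < n" for i
    using that b0 by (subst (asm) sum_nonneg_eq_0_iff) auto
  have "(\<Sum>i<n. a i) \<noteq> 0" using pos trace_eigenvalues(1) by simp
  then obtain i where "i \<in> {..<n}" "a i \<noteq> 0" by (rule sum.not_neutral_contains_not_neutral)
  then have i: "i < n" "0 < a i" using a0[of i] by auto
  \<comment> \<open>An eigenvector with positive eigenvalue has total squared overlap 1 with the
    other basis, so some overlap is nonzero.\<close>
  have "(\<Sum>j<n. (cmod (c i j))\<^sup>2) \<noteq> 0" using row_col_sums(1)[OF i(1)] by simp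
  then obtain j where "j \<in> {..<n}" "(cmod (c i j))\<^sup>2 \<noteq> 0" by (rule sum.not_neutral_contains_not_neutral)
  then have "j < n" "c i j \<noteq> 0" by auto
  then show ?thesis using divergence_infinite i b by blast
qed

section \<open>The assemblage relative entropy in terms of the divergence\<close>

text \<open>The bracket of \<open>S_A\<close> after its collapse, without any normalisation. The
  output dimension \<open>m\<close> is free so that Kraus operators into another space can be used
  as measurement operators.\<close>

definition asm_value :: "nat \<Rightarrow> nat \<Rightarrow> nat \<Rightarrow> nat \<Rightarrow> (nat \<Rightarrow> complex mat) \<Rightarrow>
    (nat \<Rightarrow> nat \<Rightarrow> real) \<Rightarrow> assemblage \<Rightarrow> assemblage \<Rightarrow> ennreal" where
  "asm_value m r s g E P \<rho> \<sigma> = (\<Sum>\<gamma><g. \<Sum>x<s. \<Sum>a<r. ennreal (P x \<gamma>) *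
     divergence m (E \<gamma> * \<rho> a x * (E \<gamma>)\<^sup>\<dagger>) (E \<gamma> * \<sigma> a x * (E \<gamma>)\<^sup>\<dagger>))"

definition is_measurement :: "nat \<Rightarrow> nat \<Rightarrow> nat \<Rightarrow> nat \<Rightarrow> (nat \<Rightarrow> complex mat) \<Rightarrow> (nat \<Rightarrow> nat \<Rightarrow> real) \<Rightarrow> bool" where
  "is_measurement m d s g E P \<longleftrightarrow> (\<forall>\<gamma><g. E \<gamma> \<in> carrier_mat m d) \<and>
     mat_sum d d {..<g} (\<lambda>\<gamma>. (E \<gamma>)\<^sup>\<dagger> * E \<gamma>) = 1\<^sub>m d \<and> (\<forall>\<gamma><g. prob_dist s (\<lambda>x. P x \<gamma>))"

lemma is_measurementD:
  assumes "is_measurement m d s g E P"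
  shows "\<gamma> < g \<Longrightarrow> E \<gamma> \<in> carrier_mat m d" "mat_sum d d {..<g} (\<lambda>\<gamma>. (E \<gamma>)\<^sup>\<dagger> * E \<gamma>) = 1\<^sub>m d"
    "\<gamma> < g \<Longrightarrow> x < s \<Longrightarrow> 0 \<le> P x \<gamma>" "\<gamma> < g \<Longrightarrow> (\<Sum>x<s. P x \<gamma>) = 1"
  using assms by (auto simp: is_measurement_def prob_dist_def)

lemma is_assemblageD:
  assumes "is_assemblage d r s \<rho>"
  shows "1 \<le> d" "1 \<le> r" "1 \<le> s" "a < r \<Longrightarrow> x < s \<Longrightarrow> psd d (\<rho> a x)"
    "\<not> (a < r \<and> x < s) \<Longrightarrow> \<rho> a x = 0\<^sub>m d d"
    "x < s \<Longrightarrow> mat_sum d d {..<r} (\<lambda>a. \<rho> a x) = rho_B d r \<rho>" "\<rho> a x \<in> carrier_mat d d"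
proof -
  show *: "1 \<le> d" "1 \<le> r" "1 \<le> s" "a < r \<Longrightarrow> x < s \<Longrightarrow> psd d (\<rho> a x)" "\<not> (a < r \<and> x < s) \<Longrightarrow> \<rho> a x = 0\<^sub>m d d" for a x
    using assms by (auto simp: is_assemblage_def)
  show "mat_sum d d {..<r} (\<lambda>a. \<rho> a x) = rho_B d r \<rho>" if "x < s" for x
  proof -
    have "\<forall>x<s. \<forall>y<s. mat_sum d d {..<r} (\<lambda>a. \<rho> a x) = mat_sum d d {..<r} (\<lambda>a. \<rho> a y)"
      using assms unfolding is_assemblage_def by blast
    moreover have "0 < s" using *(3) by simp
    ultimately show ?thesis using that unfolding rho_B_def by blast
  qed
  show "\<rho> a x \<in> carrier_mat d d"
    using *(4)[of a x] *(5)[of a x] psdD(1) by (cases "a < r \<and> x < s") auto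
qed

lemma normalisedD:
  assumes "\<rho> \<in> normalised_assemblages d r s"
  shows "is_assemblage d r s \<rho>" "Re (mat_trace (rho_B d r \<rho>)) = 1"
  using assms by (auto simp: normalised_assemblages_def asm_trace_def)

lemma trace_kraus:
  assumes E: "\<And>\<gamma>. \<gamma> < g \<Longrightarrow> E \<gamma> \<in> carrier_mat m d" and sum: "mat_sum d d {..<g} (\<lambda>\<gamma>. (E \<gamma>)\<^sup>\<dagger> * E \<gamma>) = 1\<^sub>m d"
    and R: "R \<in> carrier_mat d d"
  shows "(\<Sum>\<gamma><g. mat_trace (E \<gamma> * R * (E \<gamma>)\<^sup>\<dagger>)) = mat_trace R"
proof -
  have EE: "(E \<gamma>)\<^sup>\<dagger> * E \<gamma> \<in> carrier_mat d d" if "\<gamma> < g" for \<gamma>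
    by (rule mult_carrier_mat[OF adjoint_carrier[OF E[OF that]] E[OF that]])
  have "(\<Sum>\<gamma><g. mat_trace (E \<gamma> * R * (E \<gamma>)\<^sup>\<dagger>)) = (\<Sum>\<gamma><g. mat_trace ((E \<gamma>)\<^sup>\<dagger> * E \<gamma> * R))"
  proof (rule sum.cong[OF refl])
    fix \<gamma> assume "\<gamma> \<in> {..<g}"
    then have e: "E \<gamma> \<in> carrier_mat m d" "(E \<gamma>)\<^sup>\<dagger> \<in> carrier_mat d m" using E[of \<gamma>] by auto
    show "mat_trace (E \<gamma> * R * (E \<gamma>)\<^sup>\<dagger>) = mat_trace ((E \<gamma>)\<^sup>\<dagger> * E \<gamma> * R)"
      using trace_comm[OF mult_carrier_mat[OF e(1) R] e(2)] assoc_mult_mat[OF e(2,1) R] by simp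
  qed
  also have "\<dots> = mat_trace (mat_sum d d {..<g} (\<lambda>\<gamma>. (E \<gamma>)\<^sup>\<dagger> * E \<gamma> * R))"
    by (rule trace_mat_sum[symmetric]) (use mult_carrier_mat[OF EE R] in auto)
  also have "mat_sum d d {..<g} (\<lambda>\<gamma>. (E \<gamma>)\<^sup>\<dagger> * E \<gamma> * R) = mat_sum d d {..<g} (\<lambda>\<gamma>. (E \<gamma>)\<^sup>\<dagger> * E \<gamma>) * R"
    by (rule mat_sum_mult[OF R, symmetric]) (use EE in auto)
  also have "\<dots> = R" unfolding sum using R by simp
  finally show ?thesis .
qed

text \<open>By no-signaling the marginal may be computed at whichever input \<open>x\<close> occurs
  in the term under consideration.\<close>

lemma P_Gamma_eq:
  assumes \<rho>: "is_assemblage d r s \<rho>" and x: "x < s" and E: "E \<gamma> \<in> carrier_mat m d"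
  shows "P_Gamma d r E \<rho> \<gamma> = (\<Sum>a<r. Re (mat_trace (E \<gamma> * \<rho> a x * (E \<gamma>)\<^sup>\<dagger>)))"
proof -
  have E': "(E \<gamma>)\<^sup>\<dagger> \<in> carrier_mat d m" using E by simp
  have "E \<gamma> * rho_B d r \<rho> * (E \<gamma>)\<^sup>\<dagger> = mat_sum m m {..<r} (\<lambda>a. E \<gamma> * \<rho> a x * (E \<gamma>)\<^sup>\<dagger>)"
    unfolding is_assemblageD(6)[OF \<rho> x, symmetric]
    by (rule congruence_mat_sum[OF E is_assemblageD(7)[OF \<rho>]])
  moreover have "E \<gamma> * \<rho> a x * (E \<gamma>)\<^sup>\<dagger> \<in> carrier_mat m m" for a
    by (rule mult_carrier_mat[OF mult_carrier_mat[OF E is_assemblageD(7)[OF \<rho>]] E'])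
  ultimately show ?thesis unfolding P_Gamma_def by (simp add: trace_mat_sum)
qed

lemma sum_P_Gamma:
  assumes \<rho>: "\<rho> \<in> normalised_assemblages d r s" and E: "is_measurement m d s g E P"
  shows "(\<Sum>\<gamma><g. P_Gamma d r E \<rho> \<gamma>) = 1"
proof -
  have "rho_B d r \<rho> \<in> carrier_mat d d" by (simp add: rho_B_def)
  from trace_kraus[OF is_measurementD(1,2)[OF E] this]
  have "(\<Sum>\<gamma><g. mat_trace (E \<gamma> * rho_B d r \<rho> * (E \<gamma>)\<^sup>\<dagger>)) = mat_trace (rho_B d r \<rho>)" by simp
  then show ?thesis unfolding P_Gamma_def using normalisedD(2)[OF \<rho>] by (metis Re_sum)
qed

lemma post_meas_block_diag:
  assumes \<rho>: "is_assemblage d r s \<rho>" and E: "E \<gamma> \<in> carrier_mat d d"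
  shows "post_meas d r E \<rho> \<gamma> x = complex_of_real (1 / P_Gamma d r E \<rho> \<gamma>) \<cdot>\<^sub>m
    block_diag d r (\<lambda>a. E \<gamma> * \<rho> a x * (E \<gamma>)\<^sup>\<dagger>)"
proof -
  note car = is_assemblageD(7)[OF \<rho>]
  have E': "(E \<gamma>)\<^sup>\<dagger> \<in> carrier_mat d d" using E by simp
  have E\<rho>: "E \<gamma> * \<rho> a x \<in> carrier_mat d d" for a by (rule mult_carrier_mat[OF E car])
  have "quantum_rep d r \<rho> x = block_diag d r (\<lambda>a. \<rho> a x)" by (rule quantum_rep_block_diag) (rule car)
  moreover have "block_diag d r (\<lambda>_. E \<gamma>) * block_diag d r (\<lambda>a. \<rho> a x) = block_diag d r (\<lambda>a. E \<gamma> * \<rho> a x)"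
    by (rule block_diag_mult) (use E car in auto)
  moreover have "block_diag d r (\<lambda>a. E \<gamma> * \<rho> a x) * block_diag d r (\<lambda>_. (E \<gamma>)\<^sup>\<dagger>) =
      block_diag d r (\<lambda>a. E \<gamma> * \<rho> a x * (E \<gamma>)\<^sup>\<dagger>)"
    by (rule block_diag_mult) (use E' E\<rho> in auto)
  ultimately show ?thesis unfolding post_meas_def kron_one[OF E] kron_one[OF E'] by simp
qed

text \<open>A chain rule. Removing the normalisations \<open>p\<close> and \<open>q\<close> of the
  post-measurement states from the quantum relative entropy produces \<open>p (ln p - ln q)\<close>,
  the contribution of this outcome to \<open>S_C\<close>, together with the trace defect
  \<open>q - p\<close>.\<close>

lemma S_A_value_term:
  assumes \<rho>: "is_assemblage d r s \<rho>" and \<sigma>: "is_assemblage d r s \<sigma>" and x: "x < s" and E: "E \<gamma> \<in> carrier_mat d d"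
    and ac: "P_Gamma d r E \<rho> \<gamma> = 0 \<or> P_Gamma d r E \<sigma> \<gamma> \<noteq> 0"
  shows "enn2ereal (\<Sum>a<r. divergence d (E \<gamma> * \<rho> a x * (E \<gamma>)\<^sup>\<dagger>) (E \<gamma> * \<sigma> a x * (E \<gamma>)\<^sup>\<dagger>)) =
    (if P_Gamma d r E \<rho> \<gamma> = 0 then 0 else
      ereal (P_Gamma d r E \<rho> \<gamma>) * S_Q (post_meas d r E \<rho> \<gamma> x) (post_meas d r E \<sigma> \<gamma> x)) +
    ereal (P_Gamma d r E \<sigma> \<gamma> - P_Gamma d r E \<rho> \<gamma> + (if P_Gamma d r E \<rho> \<gamma> = 0 then 0 else
      P_Gamma d r E \<rho> \<gamma> * (ln (P_Gamma d r E \<rho> \<gamma>) - ln (P_Gamma d r E \<sigma> \<gamma>))))"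
proof -
  define p q where "p = P_Gamma d r E \<rho> \<gamma>" and "q = P_Gamma d r E \<sigma> \<gamma>"
  let ?A = "\<lambda>a. E \<gamma> * \<rho> a x * (E \<gamma>)\<^sup>\<dagger>" and ?B = "\<lambda>a. E \<gamma> * \<sigma> a x * (E \<gamma>)\<^sup>\<dagger>"
  define A where "A = block_diag d r ?A"
  define B where "B = block_diag d r ?B"
  have pA: "psd d (?A a)" and pB: "psd d (?B a)" if "a < r" for a
    using psd_congruence[OF is_assemblageD(4)[OF \<rho> that x] E] psd_congruence[OF is_assemblageD(4)[OF \<sigma> that x] E] .
  have block_psd: "psd (r * d) (block_diag d r C)" if C: "\<And>a. a < r \<Longrightarrow> psd d (C a)" for C
  proof -
    have "\<forall>a. \<exists>X. a < r \<longrightarrow> X \<in> carrier_mat d d \<and> C a = X * X\<^sup>\<dagger>"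
      using psd_factor[OF C] by metis
    then obtain X where X: "\<forall>a. a < r \<longrightarrow> X a \<in> carrier_mat d d \<and> C a = X a * (X a)\<^sup>\<dagger>"
      unfolding choice_iff by blast
    have "block_diag d r C = block_diag d r (\<lambda>a. X a * (X a)\<^sup>\<dagger>)"
      by (rule block_diag_cong) (use X in auto)
    also have "\<dots> = block_diag d r X * block_diag d r (\<lambda>a. (X a)\<^sup>\<dagger>)"
      by (rule block_diag_mult[symmetric]) (use X in auto)
    also have "block_diag d r (\<lambda>a. (X a)\<^sup>\<dagger>) = (block_diag d r X)\<^sup>\<dagger>"
      by (rule adjoint_block_diag[symmetric]) (use X in auto)
    finally show ?thesis using psd_gram[OF block_diag_carrier] by simp
  qed
  have AB: "psd (r * d) A" "psd (r * d) B" unfolding A_def B_def by (intro block_psd pA pB; assumption)+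
  have tr: "Re (mat_trace A) = p" "Re (mat_trace B) = q"
    unfolding A_def B_def p_def q_def P_Gamma_eq[where E = E and \<gamma> = \<gamma>, OF \<rho> x E] P_Gamma_eq[where E = E and \<gamma> = \<gamma>, OF \<sigma> x E]
    by (subst trace_block_diag; use psdD(1)[OF pA] psdD(1)[OF pB] in simp)+
  have pq0: "0 \<le> p" "0 \<le> q" using psd_trace(2)[OF AB(1)] psd_trace(2)[OF AB(2)] tr by auto
  have D: "(\<Sum>a<r. divergence d (?A a) (?B a)) = divergence (r * d) A B"
    unfolding A_def B_def by (rule divergence_block_diag[symmetric]) (use pA pB in auto)
  show ?thesis
  proof (cases "p = 0")
    case True
    then show ?thesis
      using divergence_zero_left[OF AB] tr pq0 unfolding D p_def[symmetric] q_def[symmetric] by simp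
  next
    case False
    then have pq: "0 < p" "0 < q" using ac pq0 unfolding p_def[symmetric] q_def[symmetric] by auto
    define A' B' where "A' = post_meas d r E \<rho> \<gamma> x" and "B' = post_meas d r E \<sigma> \<gamma> x"
    have A': "A' = complex_of_real (1 / p) \<cdot>\<^sub>m A" and B': "B' = complex_of_real (1 / q) \<cdot>\<^sub>m B"
      unfolding A'_def B'_def A_def B_def p_def q_def
      by (rule post_meas_block_diag[where E = E and \<gamma> = \<gamma>, OF \<rho> E], rule post_meas_block_diag[where E = E and \<gamma> = \<gamma>, OF \<sigma> E])
    have psd': "psd (r * d) A'" "psd (r * d) B'"
      unfolding A' B' by (rule psd_smult[OF AB(1)], use pq in simp, rule psd_smult[OF AB(2)], use pq in simp)
    have tr': "Re (mat_trace A') = 1" "Re (mat_trace B') = 1"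
      unfolding A' B' using trace_smult[OF psdD(1)[OF AB(1)]] trace_smult[OF psdD(1)[OF AB(2)]] tr pq by simp_all
    have sc: "A = complex_of_real p \<cdot>\<^sub>m A'" "B = complex_of_real q \<cdot>\<^sub>m B'"
      unfolding A' B' using pq by (auto intro!: eq_matI)
    have "enn2ereal (divergence (r * d) A B) =
        ereal p * enn2ereal (divergence (r * d) A' B') + ereal ((q - p) * 1 + p * (ln p - ln q) * 1)"
      unfolding sc using divergence_scale[OF psd' pq] unfolding tr' .
    moreover have "enn2ereal (divergence (r * d) A' B') = S_Q A' B'"
      using S_Q_eq_divergence[OF psd'] unfolding tr' by (simp flip: zero_ereal_def)
    ultimately show ?thesis
      unfolding D p_def[symmetric] q_def[symmetric] A'_def[symmetric] B'_def[symmetric] using False by simp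
  qed
qed

text \<open>The surplus in the chain rule does not depend on \<open>x\<close>, so the input weights
  sum out. Summed over outcomes the trace defects cancel, as both assemblages are normalised, and
  \<open>S_C\<close> remains. If \<open>S_C\<close> is infinite, some single divergence is infinite
  as well.\<close>

lemma S_A_value_eq:
  assumes \<rho>: "\<rho> \<in> normalised_assemblages d r s" and \<sigma>: "\<sigma> \<in> normalised_assemblages d r s"
    and E: "is_measurement d d s g E P"
  shows "S_A_value d r s g E P \<rho> \<sigma> = enn2ereal (asm_value d r s g E P \<rho> \<sigma>)"
proof -
  note ra = normalisedD(1)[OF \<rho>] and sa = normalisedD(1)[OF \<sigma>]
  note Ec = is_measurementD(1)[OF E] and P0 = is_measurementD(3)[OF E] and P1 = is_measurementD(4)[OF E]
  define p q where "p = P_Gamma d r E \<rho>" and "q = P_Gamma d r E \<sigma>"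
  define D where "D = (\<lambda>\<gamma> x. \<Sum>a<r. divergence d (E \<gamma> * \<rho> a x * (E \<gamma>)\<^sup>\<dagger>) (E \<gamma> * \<sigma> a x * (E \<gamma>)\<^sup>\<dagger>))"
  define T where "T = (\<lambda>\<gamma> x. if p \<gamma> = 0 then 0
        else ereal (P x \<gamma> * p \<gamma>) * S_Q (post_meas d r E \<rho> \<gamma> x) (post_meas d r E \<sigma> \<gamma> x))"
  have s0: "0 < s" using is_assemblageD(3)[OF ra] by simp
  have psdA: "psd d (E \<gamma> * \<rho> a x * (E \<gamma>)\<^sup>\<dagger>)" "psd d (E \<gamma> * \<sigma> a x * (E \<gamma>)\<^sup>\<dagger>)"
    if "\<gamma> < g" "a < r" "x < s" for \<gamma> a x
    by (rule psd_congruence[OF is_assemblageD(4)[OF ra that(2,3)] Ec[OF that(1)]],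
        rule psd_congruence[OF is_assemblageD(4)[OF sa that(2,3)] Ec[OF that(1)]])
  have p_eq: "p \<gamma> = (\<Sum>a<r. Re (mat_trace (E \<gamma> * \<rho> a x * (E \<gamma>)\<^sup>\<dagger>)))"
    and q_eq: "q \<gamma> = (\<Sum>a<r. Re (mat_trace (E \<gamma> * \<sigma> a x * (E \<gamma>)\<^sup>\<dagger>)))" if "\<gamma> < g" "x < s" for \<gamma> x
    unfolding p_def q_def by (rule P_Gamma_eq[where E = E and \<gamma> = \<gamma>, OF ra that(2) Ec[OF that(1)]], rule P_Gamma_eq[where E = E and \<gamma> = \<gamma>, OF sa that(2) Ec[OF that(1)]])
  have p0: "0 \<le> p \<gamma>" and q0: "0 \<le> q \<gamma>" if "\<gamma> < g" for \<gamma>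
    unfolding p_eq[OF that s0] q_eq[OF that s0] by (auto intro!: sum_nonneg psd_trace(2) psdA that s0)
  have V: "asm_value d r s g E P \<rho> \<sigma> = (\<Sum>\<gamma><g. \<Sum>x<s. ennreal (P x \<gamma>) * D \<gamma> x)"
    unfolding asm_value_def D_def by (simp add: sum_distrib_left)
  have S: "S_A_value d r s g E P \<rho> \<sigma> = S_C g p q + (\<Sum>\<gamma><g. \<Sum>x<s. T \<gamma> x)"
    unfolding S_A_value_def T_def p_def q_def ..
  show ?thesis
  proof (cases "\<exists>\<gamma><g. q \<gamma> = 0 \<and> 0 < p \<gamma>")
    case True
    then obtain \<gamma> where \<gamma>: "\<gamma> < g" "q \<gamma> = 0" "0 < p \<gamma>" by blast
    have "S_C g p q = \<infinity>" using True by (simp add: S_C_def)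
    then have "S_A_value d r s g E P \<rho> \<sigma> = \<infinity>" unfolding S by simp
    moreover have "asm_value d r s g E P \<rho> \<sigma> = \<infinity>"
    proof -
      \<comment> \<open>An infinite divergence counts only with positive weight, so an input of
        positive probability and then an output of positive trace are selected.\<close>
      have "(\<Sum>x<s. P x \<gamma>) \<noteq> 0" using P1[OF \<gamma>(1)] by simp
      then obtain x where "x \<in> {..<s}" "P x \<gamma> \<noteq> 0" by (rule sum.not_neutral_contains_not_neutral)
      then have x: "x < s" "0 < P x \<gamma>" using P0[OF \<gamma>(1), of x] by auto
      have "(\<Sum>a<r. Re (mat_trace (E \<gamma> * \<rho> a x * (E \<gamma>)\<^sup>\<dagger>))) \<noteq> 0" using p_eq[OF \<gamma>(1) x(1)] \<gamma>(3) by simp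
      then obtain a where "a \<in> {..<r}" "Re (mat_trace (E \<gamma> * \<rho> a x * (E \<gamma>)\<^sup>\<dagger>)) \<noteq> 0" by (rule sum.not_neutral_contains_not_neutral)
      then have a: "a < r" "0 < Re (mat_trace (E \<gamma> * \<rho> a x * (E \<gamma>)\<^sup>\<dagger>))"
        using psd_trace(2)[OF psdA(1)[OF \<gamma>(1) _ x(1)], of a] by auto
      have "Re (mat_trace (E \<gamma> * \<sigma> a x * (E \<gamma>)\<^sup>\<dagger>)) = 0"
        using q_eq[OF \<gamma>(1) x(1)] \<gamma>(2) a(1) psd_trace(2)[OF psdA(2)[OF \<gamma>(1) _ x(1)]]
        by (metis (no_types, lifting) finite_lessThan lessThan_iff sum_nonneg_eq_0_iff)
      then have "divergence d (E \<gamma> * \<rho> a x * (E \<gamma>)\<^sup>\<dagger>) (E \<gamma> * \<sigma> a x * (E \<gamma>)\<^sup>\<dagger>) = \<infinity>"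
        by (intro divergence_zero_right psdA \<gamma> a x)
      moreover have "divergence d (E \<gamma> * \<rho> a x * (E \<gamma>)\<^sup>\<dagger>) (E \<gamma> * \<sigma> a x * (E \<gamma>)\<^sup>\<dagger>) \<le> D \<gamma> x"
        unfolding D_def
        by (rule member_le_sum[of a _ "\<lambda>a. divergence d (E \<gamma> * \<rho> a x * (E \<gamma>)\<^sup>\<dagger>) (E \<gamma> * \<sigma> a x * (E \<gamma>)\<^sup>\<dagger>)"]) (use a in auto)
      ultimately have "D \<gamma> x = \<infinity>" by (simp add: top_unique)
      then have "\<infinity> = ennreal (P x \<gamma>) * D \<gamma> x" using x by (simp add: ennreal_mult_top)
      also have "\<dots> \<le> (\<Sum>x<s. ennreal (P x \<gamma>) * D \<gamma> x)" by (rule member_le_sum) (use x in auto)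
      also have "\<dots> \<le> asm_value d r s g E P \<rho> \<sigma>"
        unfolding V by (rule member_le_sum[of \<gamma> _ "\<lambda>\<gamma>. \<Sum>x<s. ennreal (P x \<gamma>) * D \<gamma> x"]) (use \<gamma> in auto)
      finally show ?thesis by (simp add: top_unique)
    qed
    ultimately show ?thesis by simp
  next
    case False
    \<comment> \<open>The part of the chain rule that is always finite: the trace defect and the
      term of \<open>S_C\<close> for this outcome.\<close>
    define k where "k = (\<lambda>\<gamma>. q \<gamma> - p \<gamma> + (if p \<gamma> = 0 then 0 else p \<gamma> * (ln (p \<gamma>) - ln (q \<gamma>))))"
    have "enn2ereal (ennreal (P x \<gamma>) * D \<gamma> x) = T \<gamma> x + ereal (P x \<gamma> * k \<gamma>)" if \<gamma>: "\<gamma> < g" and x: "x < s" for \<gamma> x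
    proof -
      have "p \<gamma> = 0 \<or> q \<gamma> \<noteq> 0" using False \<gamma> p0[OF \<gamma>] by fastforce
      then have "enn2ereal (D \<gamma> x) = (if p \<gamma> = 0 then 0 else ereal (p \<gamma>) * S_Q (post_meas d r E \<rho> \<gamma> x) (post_meas d r E \<sigma> \<gamma> x))
          + ereal (k \<gamma>)"
        unfolding D_def k_def p_def q_def by (rule S_A_value_term[where E = E and \<gamma> = \<gamma>, OF ra sa x Ec[OF \<gamma>]])
      then have "enn2ereal (ennreal (P x \<gamma>) * D \<gamma> x) = ereal (P x \<gamma>) * ((if p \<gamma> = 0 then 0 else
          ereal (p \<gamma>) * S_Q (post_meas d r E \<rho> \<gamma> x) (post_meas d r E \<sigma> \<gamma> x)) + ereal (k \<gamma>))"
        using P0[OF \<gamma> x] by (simp add: times_ennreal.rep_eq enn2ereal_ennreal)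
      also have "\<dots> = T \<gamma> x + ereal (P x \<gamma> * k \<gamma>)"
        using P0[OF \<gamma> x] p0[OF \<gamma>] unfolding T_def
        by (cases "S_Q (post_meas d r E \<rho> \<gamma> x) (post_meas d r E \<sigma> \<gamma> x)"; cases "P x \<gamma> = 0")
           (auto simp: algebra_simps)
      finally show ?thesis .
    qed
    then have "enn2ereal (asm_value d r s g E P \<rho> \<sigma>) = (\<Sum>\<gamma><g. \<Sum>x<s. T \<gamma> x + ereal (P x \<gamma> * k \<gamma>))"
      unfolding V by (simp flip: sum_enn2ereal)
    also have "\<dots> = (\<Sum>\<gamma><g. \<Sum>x<s. T \<gamma> x) + ereal (\<Sum>\<gamma><g. \<Sum>x<s. P x \<gamma> * k \<gamma>)"
      by (simp add: sum.distrib)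
    also have "(\<Sum>\<gamma><g. \<Sum>x<s. P x \<gamma> * k \<gamma>) = (\<Sum>\<gamma><g. k \<gamma>)"
      by (intro sum.cong refl) (simp add: P1 flip: sum_distrib_right)
    also have "\<dots> = (\<Sum>\<gamma><g. q \<gamma>) - (\<Sum>\<gamma><g. p \<gamma>) + (\<Sum>\<gamma><g. if p \<gamma> = 0 then 0 else p \<gamma> * (ln (p \<gamma>) - ln (q \<gamma>)))"
      unfolding k_def by (simp add: sum.distrib sum_subtractf)
    also have "\<dots> = (\<Sum>\<gamma><g. if p \<gamma> = 0 then 0 else p \<gamma> * (ln (p \<gamma>) - ln (q \<gamma>)))"
      unfolding p_def q_def sum_P_Gamma[OF \<rho> E] sum_P_Gamma[OF \<sigma> E] by simp
    also have "ereal \<dots> = S_C g p q" using False by (simp add: S_C_def)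
    finally show ?thesis unfolding S by (simp add: add.commute)
  qed
qed

lemma S_A_upper:
  assumes "\<rho> \<in> normalised_assemblages d r s" "\<sigma> \<in> normalised_assemblages d r s" "is_measurement d d s g E P"
  shows "enn2ereal (asm_value d r s g E P \<rho> \<sigma>) \<le> S_A d r s \<rho> \<sigma>"
  unfolding S_A_def S_A_value_eq[OF assms, symmetric]
  using assms(3) unfolding is_measurement_def by (intro Sup_upper) blast

lemma S_A_least:
  assumes "\<rho> \<in> normalised_assemblages d r s" "\<sigma> \<in> normalised_assemblages d r s"
    and "\<And>g E P. is_measurement d d s g E P \<Longrightarrow> enn2ereal (asm_value d r s g E P \<rho> \<sigma>) \<le> c"
  shows "S_A d r s \<rho> \<sigma> \<le> c"
  unfolding S_A_def
proof (rule Sup_least)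
  fix v assume "v \<in> {S_A_value d r s g E P \<rho> \<sigma> | g E P. (\<forall>\<gamma><g. E \<gamma> \<in> carrier_mat d d) \<and>
     mat_sum d d {..<g} (\<lambda>\<gamma>. (E \<gamma>)\<^sup>\<dagger> * E \<gamma>) = 1\<^sub>m d \<and> (\<forall>\<gamma><g. prob_dist s (\<lambda>x. P x \<gamma>))}"
  then obtain g E P where v: "v = S_A_value d r s g E P \<rho> \<sigma>" and m: "is_measurement d d s g E P"
    unfolding is_measurement_def by blast
  show "v \<le> c" unfolding v S_A_value_eq[OF assms(1,2) m] by (rule assms(3)[OF m])
qed

lemma S_A_less_witness:
  assumes "\<rho> \<in> normalised_assemblages d r s" "\<sigma> \<in> normalised_assemblages d r s" "c < S_A d r s \<rho> \<sigma>"
  obtains g E P where "is_measurement d d s g E P" "c < enn2ereal (asm_value d r s g E P \<rho> \<sigma>)"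
  using S_A_least[OF assms(1,2), of c] assms(3) by (meson leD not_le_imp_less)

lemma trivial_measurement:
  assumes "1 \<le> s"
  shows "is_measurement d d s 1 (\<lambda>_. 1\<^sub>m d) (\<lambda>x _. if x = 0 then 1 else 0)"
proof -
  have "mat_sum d d {..<1} (\<lambda>\<gamma>::nat. (1\<^sub>m d :: complex mat)\<^sup>\<dagger> * 1\<^sub>m d) = 1\<^sub>m d"
    by (rule eq_matI) (auto simp: left_mult_one_mat[OF one_carrier_mat])
  then show ?thesis using assms by (auto simp: is_measurement_def prob_dist_def)
qed

lemma S_A_nonneg:
  assumes "\<rho> \<in> normalised_assemblages d r s" "\<sigma> \<in> normalised_assemblages d r s"
  shows "0 \<le> S_A d r s \<rho> \<sigma>"
proof -
  have "1 \<le> s" using is_assemblageD(3)[OF normalisedD(1)[OF assms(1)]] .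
  from order_trans[OF enn2ereal_nonneg S_A_upper[OF assms trivial_measurement[OF this]]] show ?thesis .
qed

section \<open>Rectangular measurement operators and arbitrary finite index sets\<close>

lemma mat_sum_reindex:
  assumes "bij_betw h J I"
  shows "mat_sum m n J (\<lambda>k. A (h k)) = mat_sum m n I A"
proof (rule eq_matI)
  fix i j assume "i < dim_row (mat_sum m n I A)" "j < dim_col (mat_sum m n I A)"
  then show "mat_sum m n J (\<lambda>k. A (h k)) $$ (i, j) = mat_sum m n I A $$ (i, j)"
    using sum.reindex_bij_betw[OF assms, of "\<lambda>k. A k $$ (i, j)"] by simp
qed simp_all

text \<open>The square polar factors satisfy the same completeness relation as the given operators,
  hence are admissible in \<open>S_A\<close>. Passing to them cannot lower the value, because the
  given operators differ from them by partial isometries. The free index set accommodates pairs of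
  outcomes.\<close>

lemma asm_value_le_S_A:
  assumes \<rho>: "\<rho> \<in> normalised_assemblages d r s" and \<sigma>: "\<sigma> \<in> normalised_assemblages d r s"
    and I: "finite I" and E: "\<And>i. i \<in> I \<Longrightarrow> E i \<in> carrier_mat m d"
    and sum: "mat_sum d d I (\<lambda>i. (E i)\<^sup>\<dagger> * E i) = 1\<^sub>m d" and P: "\<And>i. i \<in> I \<Longrightarrow> prob_dist s (P i)"
  shows "enn2ereal (\<Sum>i\<in>I. \<Sum>x<s. \<Sum>a<r. ennreal (P i x) *
      divergence m (E i * \<rho> a x * (E i)\<^sup>\<dagger>) (E i * \<sigma> a x * (E i)\<^sup>\<dagger>)) \<le> S_A d r s \<rho> \<sigma>"
proof -
  note ra = normalisedD(1)[OF \<rho>] and sa = normalisedD(1)[OF \<sigma>]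
  obtain h where h: "bij_betw h {..<card I} I" using ex_bij_betw_nat_finite[OF I] by (auto simp: atLeast0LessThan)
  have hI: "h \<gamma> \<in> I" if "\<gamma> < card I" for \<gamma> using h that by (auto simp: bij_betw_def)
  have "\<forall>i. \<exists>V F. i \<in> I \<longrightarrow> V \<in> carrier_mat m d \<and> V * V\<^sup>\<dagger> * V = V \<and> F \<in> carrier_mat d d \<and> E i = V * F \<and>
      F\<^sup>\<dagger> * F = (E i)\<^sup>\<dagger> * E i"
  proof
    fix i
    show "\<exists>V F. i \<in> I \<longrightarrow> V \<in> carrier_mat m d \<and> V * V\<^sup>\<dagger> * V = V \<and> F \<in> carrier_mat d d \<and> E i = V * F \<and>
      F\<^sup>\<dagger> * F = (E i)\<^sup>\<dagger> * E i"
    proof (cases "i \<in> I")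
      case True
      obtain V F where "V \<in> carrier_mat m d" "V * V\<^sup>\<dagger> * V = V" "F \<in> carrier_mat d d" "E i = V * F"
        "F\<^sup>\<dagger> * F = (E i)\<^sup>\<dagger> * E i" by (rule polar_decomposition[OF E[OF True]])
      then show ?thesis by blast
    qed simp
  qed
  then obtain V F where VF: "\<forall>i. i \<in> I \<longrightarrow> V i \<in> carrier_mat m d \<and> V i * (V i)\<^sup>\<dagger> * V i = V i \<and> F i \<in> carrier_mat d d \<and>
      E i = V i * F i \<and> (F i)\<^sup>\<dagger> * F i = (E i)\<^sup>\<dagger> * E i"
    unfolding choice_iff by blast
  let ?F = "\<lambda>\<gamma>. F (h \<gamma>)" and ?P = "\<lambda>x \<gamma>. P (h \<gamma>) x"
  have meas: "is_measurement d d s (card I) ?F ?P"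
    unfolding is_measurement_def
  proof (intro conjI allI impI)
    have "mat_sum d d {..<card I} (\<lambda>\<gamma>. (?F \<gamma>)\<^sup>\<dagger> * ?F \<gamma>) = mat_sum d d {..<card I} (\<lambda>\<gamma>. (E (h \<gamma>))\<^sup>\<dagger> * E (h \<gamma>))"
      by (rule mat_sum_cong[OF refl]) (use VF hI in auto)
    also have "\<dots> = mat_sum d d I (\<lambda>i. (E i)\<^sup>\<dagger> * E i)"
      by (rule mat_sum_reindex[OF h])
    finally show "mat_sum d d {..<card I} (\<lambda>\<gamma>. (?F \<gamma>)\<^sup>\<dagger> * ?F \<gamma>) = 1\<^sub>m d" unfolding sum .
  qed (use VF P hI in auto)
  have "(\<Sum>i\<in>I. \<Sum>x<s. \<Sum>a<r. ennreal (P i x) * divergence m (E i * \<rho> a x * (E i)\<^sup>\<dagger>) (E i * \<sigma> a x * (E i)\<^sup>\<dagger>))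
      \<le> (\<Sum>i\<in>I. \<Sum>x<s. \<Sum>a<r. ennreal (P i x) * divergence d (F i * \<rho> a x * (F i)\<^sup>\<dagger>) (F i * \<sigma> a x * (F i)\<^sup>\<dagger>))"
  proof (intro sum_mono mult_left_mono)
    fix i x a assume i: "i \<in> I" and "x \<in> {..<s}" "a \<in> {..<r}"
    then have ax: "a < r" "x < s" by auto
    have V: "V i \<in> carrier_mat m d" "V i * (V i)\<^sup>\<dagger> * V i = V i" and F: "F i \<in> carrier_mat d d" and EVF: "E i = V i * F i"
      using VF i by auto
    show "divergence m (E i * \<rho> a x * (E i)\<^sup>\<dagger>) (E i * \<sigma> a x * (E i)\<^sup>\<dagger>)
        \<le> divergence d (F i * \<rho> a x * (F i)\<^sup>\<dagger>) (F i * \<sigma> a x * (F i)\<^sup>\<dagger>)"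
      unfolding EVF congruence_mult[OF V(1) F is_assemblageD(7)[OF ra]] congruence_mult[OF V(1) F is_assemblageD(7)[OF sa]]
      by (intro divergence_partial_isometry_le V psd_congruence[OF is_assemblageD(4)[OF ra ax] F]
          psd_congruence[OF is_assemblageD(4)[OF sa ax] F])
  qed simp
  also have "\<dots> = asm_value d r s (card I) ?F ?P \<rho> \<sigma>"
    unfolding asm_value_def by (rule sum.reindex_bij_betw[OF h, symmetric])
  finally show ?thesis
    using order_trans[OF _ S_A_upper[OF \<rho> \<sigma> meas]] unfolding less_eq_ennreal.rep_eq by blast
qed

text \<open>Fatou's lemma for a finite counting measure.\<close>

lemma sum_liminf_le:
  fixes f :: "'i \<Rightarrow> nat \<Rightarrow> ennreal"
  assumes "finite A"
  shows "(\<Sum>i\<in>A. liminf (f i)) \<le> liminf (\<lambda>N. \<Sum>i\<in>A. f i N)"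
  using nn_integral_liminf[of "\<lambda>N i. f i N" "count_space A"] assms
  by (simp add: nn_integral_count_space_finite)

lemma tendsto_congruence:
  fixes E :: "complex mat"
  assumes E: "E \<in> carrier_mat m n" and A: "\<And>N. A N \<in> carrier_mat n n" and B: "B \<in> carrier_mat n n"
    and lim: "\<And>i j. i < n \<Longrightarrow> j < n \<Longrightarrow> (\<lambda>N. A N $$ (i, j)) \<longlonglongrightarrow> B $$ (i, j)" and ij: "i < m" "j < m"
  shows "(\<lambda>N. (E * A N * E\<^sup>\<dagger>) $$ (i, j)) \<longlonglongrightarrow> (E * B * E\<^sup>\<dagger>) $$ (i, j)"
proof -
  have eq: "(E * C * E\<^sup>\<dagger>) $$ (i, j) = (\<Sum>l<n. (\<Sum>k<n. E $$ (i, k) * C $$ (k, l)) * E\<^sup>\<dagger> $$ (l, j))"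
    if C: "C \<in> carrier_mat n n" for C
    unfolding mult_index[OF mult_carrier_mat[OF E C] adjoint_carrier[OF E] ij]
    by (intro sum.cong refl) (simp only: mult_index[OF E C ij(1)] lessThan_iff)
  show ?thesis
    unfolding eq[OF A] eq[OF B] by (intro tendsto_sum tendsto_mult tendsto_const lim) auto
qed

text \<open>For each measurement the value is lower semicontinuous in the second assemblage, and
  this survives the supremum over measurements. Convergence of the values to \<open>L\<close> is
  what a minimising sequence provides.\<close>

lemma S_A_lower_semicontinuous:
  assumes \<rho>: "\<rho> \<in> normalised_assemblages d r s" and \<sigma>N: "\<And>N. \<sigma>N N \<in> normalised_assemblages d r s"
    and \<sigma>: "\<sigma> \<in> normalised_assemblages d r s"
    and lim: "\<And>a x i j. a < r \<Longrightarrow> x < s \<Longrightarrow> i < d \<Longrightarrow> j < d \<Longrightarrow> (\<lambda>N. \<sigma>N N a x $$ (i, j)) \<longlonglongrightarrow> \<sigma> a x $$ (i, j)"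
    and L: "(\<lambda>N. S_A d r s \<rho> (\<sigma>N N)) \<longlonglongrightarrow> L"
  shows "S_A d r s \<rho> \<sigma> \<le> L"
proof (rule S_A_least[OF \<rho> \<sigma>])
  note ra = normalisedD(1)[OF \<rho>] and sa = normalisedD(1)[OF \<sigma>] and na = normalisedD(1)[OF \<sigma>N]
  fix g E P assume m: "is_measurement d d s g E P"
  define T where "T = (\<lambda>\<tau> (\<gamma>, x, a). ennreal (P x \<gamma>) *
     divergence d (E \<gamma> * \<rho> a x * (E \<gamma>)\<^sup>\<dagger>) (E \<gamma> * \<tau> a x * (E \<gamma>)\<^sup>\<dagger>))"
  let ?I = "{..<g} \<times> {..<s} \<times> {..<r}"
  have V: "asm_value d r s g E P \<rho> \<tau> = (\<Sum>i\<in>?I. T \<tau> i)" for \<tau>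
    unfolding asm_value_def T_def by (simp add: sum.cartesian_product)
  have term_le: "T \<sigma> i \<le> liminf (\<lambda>N. T (\<sigma>N N) i)" if iI: "i \<in> ?I" for i
  proof -
    obtain \<gamma> x a where i: "i = (\<gamma>, x, a)" "\<gamma> < g" "x < s" "a < r" using iI by auto
    note e = is_measurementD(1)[OF m i(2)]
    have "divergence d (E \<gamma> * \<rho> a x * (E \<gamma>)\<^sup>\<dagger>) (E \<gamma> * \<sigma> a x * (E \<gamma>)\<^sup>\<dagger>)
        \<le> liminf (\<lambda>N. divergence d (E \<gamma> * \<rho> a x * (E \<gamma>)\<^sup>\<dagger>) (E \<gamma> * \<sigma>N N a x * (E \<gamma>)\<^sup>\<dagger>))"
    proof (rule divergence_lower_semicontinuous)
      show "psd d (E \<gamma> * \<rho> a x * (E \<gamma>)\<^sup>\<dagger>)" by (rule psd_congruence[OF is_assemblageD(4)[OF ra i(4,3)] e])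
      show "psd d (E \<gamma> * \<sigma>N N a x * (E \<gamma>)\<^sup>\<dagger>)" for N by (rule psd_congruence[OF is_assemblageD(4)[OF na i(4,3)] e])
      show "E \<gamma> * \<sigma> a x * (E \<gamma>)\<^sup>\<dagger> \<in> carrier_mat d d"
        by (rule psdD(1)[OF psd_congruence[OF is_assemblageD(4)[OF sa i(4,3)] e]])
      show "(\<lambda>N. (E \<gamma> * \<sigma>N N a x * (E \<gamma>)\<^sup>\<dagger>) $$ (k, l)) \<longlonglongrightarrow> (E \<gamma> * \<sigma> a x * (E \<gamma>)\<^sup>\<dagger>) $$ (k, l)"
        if "k < d" "l < d" for k l
        by (rule tendsto_congruence[OF e is_assemblageD(7)[OF na] is_assemblageD(7)[OF sa] lim[OF i(4,3)] that])
    qed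
    then have "T \<sigma> i \<le> ennreal (P x \<gamma>) * liminf (\<lambda>N. divergence d (E \<gamma> * \<rho> a x * (E \<gamma>)\<^sup>\<dagger>) (E \<gamma> * \<sigma>N N a x * (E \<gamma>)\<^sup>\<dagger>))"
      unfolding T_def i by (simp add: mult_left_mono)
    also have "\<dots> = liminf (\<lambda>N. T (\<sigma>N N) i)"
      unfolding T_def i prod.case
      by (rule Liminf_compose_continuous_mono[symmetric, where f = "\<lambda>y. ennreal (P x \<gamma>) * y"])
         (auto intro!: monoI mult_left_mono ennreal_continuous_on_cmult)
    finally show ?thesis .
  qed
  \<comment> \<open>Nonnegativity of \<open>L\<close> makes the passage from \<open>ereal\<close> to
    \<open>ennreal\<close> and back faithful.\<close>
  have L0: "0 \<le> L" by (rule LIMSEQ_le_const[OF L]) (use S_A_nonneg[OF \<rho> \<sigma>N] in auto)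
  have "asm_value d r s g E P \<rho> \<sigma> \<le> (\<Sum>i\<in>?I. liminf (\<lambda>N. T (\<sigma>N N) i))"
    unfolding V by (rule sum_mono[OF term_le])
  also have "\<dots> \<le> liminf (\<lambda>N. asm_value d r s g E P \<rho> (\<sigma>N N))"
    unfolding V by (rule sum_liminf_le) simp
  also have "\<dots> \<le> liminf (\<lambda>N. e2ennreal (S_A d r s \<rho> (\<sigma>N N)))"
  proof (intro Liminf_mono always_eventually allI)
    fix N
    show "asm_value d r s g E P \<rho> (\<sigma>N N) \<le> e2ennreal (S_A d r s \<rho> (\<sigma>N N))"
      using e2ennreal_mono[OF S_A_upper[OF \<rho> \<sigma>N m]] by simp
  qed
  also have "\<dots> = e2ennreal L" by (intro lim_imp_Liminf tendsto_e2ennrealI L) simp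
  finally show "enn2ereal (asm_value d r s g E P \<rho> \<sigma>) \<le> L"
    using L0 by (metis enn2ereal_e2ennreal less_eq_ennreal.rep_eq)
qed

text \<open>The input weights sum to 1 for each outcome, and the outcome probabilities sum to 1 by
  the completeness relation. All trace corrections are evaluated with this identity.\<close>

lemma total_trace:
  assumes \<rho>: "\<rho> \<in> normalised_assemblages d r s" and m: "is_measurement k d s g E P"
  shows "(\<Sum>\<gamma><g. \<Sum>x<s. \<Sum>a<r. P x \<gamma> * Re (mat_trace (E \<gamma> * \<rho> a x * (E \<gamma>)\<^sup>\<dagger>))) = 1"
proof -
  have "(\<Sum>\<gamma><g. \<Sum>x<s. \<Sum>a<r. P x \<gamma> * Re (mat_trace (E \<gamma> * \<rho> a x * (E \<gamma>)\<^sup>\<dagger>))) =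
      (\<Sum>\<gamma><g. \<Sum>x<s. P x \<gamma> * P_Gamma d r E \<rho> \<gamma>)"
    by (intro sum.cong refl)
       (simp add: P_Gamma_eq[where E = E, OF normalisedD(1)[OF \<rho>] _ is_measurementD(1)[OF m]] sum_distrib_left)
  also have "\<dots> = (\<Sum>\<gamma><g. P_Gamma d r E \<rho> \<gamma>)"
    by (intro sum.cong refl) (simp add: is_measurementD(4)[OF m] flip: sum_distrib_right)
  also have "\<dots> = 1" by (rule sum_P_Gamma[OF \<rho> m])
  finally show ?thesis .
qed

text \<open>The defect \<open>u - t + t ln (t / u)\<close> between the two sides is the nonnegative scalar divergence of
  the traces, so that passing to normalised assemblages can only decrease the value.\<close>

lemma asm_value_scale:
  assumes \<rho>: "\<rho> \<in> normalised_assemblages d r s" and \<sigma>: "\<sigma> \<in> normalised_assemblages d r s"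
    and m: "is_measurement k d s g E P" and t: "0 < t" "0 < u"
  shows "ennreal t * asm_value k r s g E P \<rho> \<sigma> \<le> asm_value k r s g E P (asm_scale t \<rho>) (asm_scale u \<sigma>)"
proof -
  note ra = normalisedD(1)[OF \<rho>] and sa = normalisedD(1)[OF \<sigma>]
  define A B where "A = (\<lambda>\<gamma> x a. E \<gamma> * \<rho> a x * (E \<gamma>)\<^sup>\<dagger>)" and "B = (\<lambda>\<gamma> x a. E \<gamma> * \<sigma> a x * (E \<gamma>)\<^sup>\<dagger>)"
  have psdAB: "psd k (A \<gamma> x a)" "psd k (B \<gamma> x a)" if "\<gamma> < g" "x < s" "a < r" for \<gamma> x a
    unfolding A_def B_def
    by (rule psd_congruence[OF is_assemblageD(4)[OF ra that(3,2)] is_measurementD(1)[OF m that(1)]],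
        rule psd_congruence[OF is_assemblageD(4)[OF sa that(3,2)] is_measurementD(1)[OF m that(1)]])
  define K where "K = (\<lambda>\<gamma> x a. (u - t) * Re (mat_trace (B \<gamma> x a)) + t * (ln t - ln u) * Re (mat_trace (A \<gamma> x a)))"
  have sc: "E \<gamma> * asm_scale t \<rho> a x * (E \<gamma>)\<^sup>\<dagger> = complex_of_real t \<cdot>\<^sub>m A \<gamma> x a"
    "E \<gamma> * asm_scale u \<sigma> a x * (E \<gamma>)\<^sup>\<dagger> = complex_of_real u \<cdot>\<^sub>m B \<gamma> x a" if "\<gamma> < g" for \<gamma> x a
    unfolding A_def B_def asm_scale_def
    by (rule congruence_smult[OF is_measurementD(1)[OF m that] is_assemblageD(7)[OF ra]],
        rule congruence_smult[OF is_measurementD(1)[OF m that] is_assemblageD(7)[OF sa]])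
  have "enn2ereal (asm_value k r s g E P (asm_scale t \<rho>) (asm_scale u \<sigma>)) =
      (\<Sum>\<gamma><g. \<Sum>x<s. \<Sum>a<r. enn2ereal (ennreal (P x \<gamma>) * divergence k (complex_of_real t \<cdot>\<^sub>m A \<gamma> x a) (complex_of_real u \<cdot>\<^sub>m B \<gamma> x a)))"
    unfolding asm_value_def by (simp add: sc flip: sum_enn2ereal)
  also have "\<dots> = (\<Sum>\<gamma><g. \<Sum>x<s. \<Sum>a<r. ereal t * enn2ereal (ennreal (P x \<gamma>) * divergence k (A \<gamma> x a) (B \<gamma> x a)) + ereal (P x \<gamma> * K \<gamma> x a))"
  proof (intro sum.cong refl)
    fix \<gamma> x a assume "\<gamma> \<in> {..<g}" "x \<in> {..<s}" "a \<in> {..<r}"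
    then have *: "\<gamma> < g" "x < s" "a < r" by auto
    have P0: "0 \<le> P x \<gamma>" by (rule is_measurementD(3)[OF m *(1,2)])
    have "enn2ereal (divergence k (complex_of_real t \<cdot>\<^sub>m A \<gamma> x a) (complex_of_real u \<cdot>\<^sub>m B \<gamma> x a)) =
        ereal t * enn2ereal (divergence k (A \<gamma> x a) (B \<gamma> x a)) + ereal (K \<gamma> x a)"
      unfolding K_def by (rule divergence_scale[OF psdAB[OF *] t])
    then show "enn2ereal (ennreal (P x \<gamma>) * divergence k (complex_of_real t \<cdot>\<^sub>m A \<gamma> x a) (complex_of_real u \<cdot>\<^sub>m B \<gamma> x a)) =
        ereal t * enn2ereal (ennreal (P x \<gamma>) * divergence k (A \<gamma> x a) (B \<gamma> x a)) + ereal (P x \<gamma> * K \<gamma> x a)"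
      using P0 t by (cases "divergence k (A \<gamma> x a) (B \<gamma> x a)"; cases "P x \<gamma> = 0")
        (auto simp: times_ennreal.rep_eq zero_ennreal.rep_eq algebra_simps)
  qed
  also have "\<dots> = ereal t * enn2ereal (asm_value k r s g E P \<rho> \<sigma>) + ereal (\<Sum>\<gamma><g. \<Sum>x<s. \<Sum>a<r. P x \<gamma> * K \<gamma> x a)"
  proof -
    have "(\<Sum>\<gamma><g. \<Sum>x<s. \<Sum>a<r. ereal t * enn2ereal (ennreal (P x \<gamma>) * divergence k (A \<gamma> x a) (B \<gamma> x a))) =
        ereal t * enn2ereal (asm_value k r s g E P \<rho> \<sigma>)"
      unfolding asm_value_def A_def B_def
      by (simp add: sum_ereal_right_distrib[symmetric] sum_nonneg)
    then show ?thesis by (simp add: sum.distrib)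
  qed
  also have "(\<Sum>\<gamma><g. \<Sum>x<s. \<Sum>a<r. P x \<gamma> * K \<gamma> x a) = (u - t) * 1 + t * (ln t - ln u) * 1"
  proof -
    have "(\<Sum>\<gamma><g. \<Sum>x<s. \<Sum>a<r. P x \<gamma> * K \<gamma> x a) =
        (u - t) * (\<Sum>\<gamma><g. \<Sum>x<s. \<Sum>a<r. P x \<gamma> * Re (mat_trace (B \<gamma> x a))) +
        t * (ln t - ln u) * (\<Sum>\<gamma><g. \<Sum>x<s. \<Sum>a<r. P x \<gamma> * Re (mat_trace (A \<gamma> x a)))"
      unfolding K_def sum_distrib_left sum.distrib[symmetric] by (simp add: algebra_simps)
    then show ?thesis unfolding A_def B_def total_trace[OF \<rho> m] total_trace[OF \<sigma> m] .
  qed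
  finally have eq: "enn2ereal (asm_value k r s g E P (asm_scale t \<rho>) (asm_scale u \<sigma>)) =
    ereal t * enn2ereal (asm_value k r s g E P \<rho> \<sigma>) + ereal (u - t + t * (ln t - ln u))" by simp
  have "0 \<le> u - t + t * (ln t - ln u)"
    using phi_real_nonneg[of t u] t by (simp add: lg_def)
  then have "ereal t * enn2ereal (asm_value k r s g E P \<rho> \<sigma>) \<le> enn2ereal (asm_value k r s g E P (asm_scale t \<rho>) (asm_scale u \<sigma>))"
    unfolding eq by (cases "ereal t * enn2ereal (asm_value k r s g E P \<rho> \<sigma>)") auto
  then show ?thesis using t by (simp add: less_eq_ennreal.rep_eq times_ennreal.rep_eq)
qed

section \<open>Unsteerable assemblages\<close>

text \<open>Summing over outputs removes the response function, so the marginal is the sum of the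
  hidden states, whatever the input; this is no-signaling for local hidden state models.\<close>

lemma response_marginal:
  assumes \<xi>: "\<And>i. i \<in> I \<Longrightarrow> \<xi> i \<in> carrier_mat d d" and P: "\<And>i. i \<in> I \<Longrightarrow> (\<Sum>a<r. P a i) = 1"
    and \<sigma>: "\<And>a. a < r \<Longrightarrow> \<sigma> a = mat_sum d d I (\<lambda>i. complex_of_real (P a i) \<cdot>\<^sub>m \<xi> i)"
  shows "mat_sum d d {..<r} \<sigma> = mat_sum d d I \<xi>"
proof (rule eq_matI)
  fix k l assume "k < dim_row (mat_sum d d I \<xi>)" "l < dim_col (mat_sum d d I \<xi>)"
  then have kl: "k < d" "l < d" by auto
  have "(\<Sum>a<r. \<sigma> a $$ (k, l)) = (\<Sum>a<r. \<Sum>i\<in>I. complex_of_real (P a i) * \<xi> i $$ (k, l))"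
    using \<sigma> carrier_matD[OF \<xi>] kl by (intro sum.cong refl) simp
  also have "\<dots> = (\<Sum>i\<in>I. complex_of_real (\<Sum>a<r. P a i) * \<xi> i $$ (k, l))"
    by (subst sum.swap) (simp add: sum_distrib_right)
  also have "\<dots> = (\<Sum>i\<in>I. \<xi> i $$ (k, l))" by (intro sum.cong refl) (simp only: P of_real_1 mult_1)
  finally show "mat_sum d d {..<r} \<sigma> $$ (k, l) = mat_sum d d I \<xi> $$ (k, l)" using kl by simp
qed simp_all

text \<open>Introduction rule with unnormalised hidden states over an arbitrary finite index set.
  The probabilities of the hidden variable are the traces, and dividing by them gives density
  operators. This form is stable under mixtures, limits and Kraus operators.\<close>

lemma LHS_I:
  assumes pos: "1 \<le> d" "1 \<le> r" "1 \<le> s" and I: "finite I"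
    and \<xi>: "\<And>i. i \<in> I \<Longrightarrow> psd d (\<xi> i)"
    and P0: "\<And>a x i. a < r \<Longrightarrow> x < s \<Longrightarrow> i \<in> I \<Longrightarrow> 0 \<le> P a x i"
    and P1: "\<And>x i. x < s \<Longrightarrow> i \<in> I \<Longrightarrow> (\<Sum>a<r. P a x i) = 1"
    and \<sigma>: "\<And>a x. a < r \<Longrightarrow> x < s \<Longrightarrow> \<sigma> a x = mat_sum d d I (\<lambda>i. complex_of_real (P a x i) \<cdot>\<^sub>m \<xi> i)"
    and \<sigma>0: "\<And>a x. \<not> (a < r \<and> x < s) \<Longrightarrow> \<sigma> a x = 0\<^sub>m d d"
    and tr: "(\<Sum>i\<in>I. Re (mat_trace (\<xi> i))) = 1"
  shows "\<sigma> \<in> LHS d r s"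
proof -
  note car = psdD(1)[OF \<xi>]
  have marginal: "mat_sum d d {..<r} (\<lambda>a. \<sigma> a x) = mat_sum d d I \<xi>" if x: "x < s" for x
    by (rule response_marginal[where P = "\<lambda>a i. P a x i"]) (use car P1 \<sigma> x in auto)
  have asm: "is_assemblage d r s \<sigma>"
    unfolding is_assemblage_def
  proof (intro conjI allI impI pos \<sigma>0)
    show "psd d (\<sigma> a x)" if "a < r" "x < s" for a x
      unfolding \<sigma>[OF that] by (intro psd_mat_sum psd_smult \<xi> P0 that)
    show "mat_sum d d {..<r} (\<lambda>a. \<sigma> a x) = mat_sum d d {..<r} (\<lambda>a. \<sigma> a y)" if "x < s" "y < s" for x y
      unfolding marginal[OF that(1)] marginal[OF that(2)] ..
  qed
  have "mat_trace (mat_sum d d I \<xi>) = (\<Sum>i\<in>I. mat_trace (\<xi> i))" by (rule trace_mat_sum) (rule car)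
  then have "asm_trace d r \<sigma> = 1"
    unfolding asm_trace_def rho_B_def using marginal[of 0] pos(3) tr by simp
  then have norm: "\<sigma> \<in> normalised_assemblages d r s" using asm by (simp add: normalised_assemblages_def)
  obtain h where h: "bij_betw h {..<card I} I" using ex_bij_betw_nat_finite[OF I] by (auto simp: atLeast0LessThan)
  have hI: "h l \<in> I" if "l < card I" for l using h that by (auto simp: bij_betw_def)
  define t where "t = (\<lambda>i. Re (mat_trace (\<xi> i)))"
  have t0: "0 \<le> t i" if "i \<in> I" for i unfolding t_def by (rule psd_trace(2)[OF \<xi>[OF that]])
  have "(\<Sum>i\<in>I. t i) \<noteq> 0" using tr by (simp add: t_def)
  then obtain i0 where "i0 \<in> I" "t i0 \<noteq> 0" by (rule sum.not_neutral_contains_not_neutral)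
  then have i0: "i0 \<in> I" "0 < t i0" using t0[of i0] by auto
  define nrm where "nrm = (\<lambda>i. complex_of_real (1 / t i) \<cdot>\<^sub>m \<xi> i)"
  have density: "density_op d (nrm i)" if "i \<in> I" "0 < t i" for i
  proof -
    have "mat_trace (nrm i) = complex_of_real (1 / t i) * complex_of_real (t i)"
      unfolding nrm_def trace_smult[OF car[OF that(1)]] t_def using psd_trace(1)[OF \<xi>[OF that(1)]] by simp
    then show ?thesis using psd_smult[OF \<xi>[OF that(1)], of "1 / t i"] that
      by (simp add: density_op_def nrm_def)
  qed
  \<comment> \<open>A hidden state of trace 0 is the zero matrix and cannot be normalised. Its
    probability is 0, so an arbitrary density operator, here the one at \<open>i0\<close>, can take
    its place.\<close>
  define \<eta> where "\<eta> = (\<lambda>l. if 0 < t (h l) then nrm (h l) else nrm i0)"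
  have \<eta>: "complex_of_real (t (h l) * c) \<cdot>\<^sub>m \<eta> l = complex_of_real c \<cdot>\<^sub>m \<xi> (h l)" if "l < card I" for l c
  proof (cases "0 < t (h l)")
    case True
    then show ?thesis by (auto simp: \<eta>_def nrm_def intro!: eq_matI)
  next
    case False
    then have "t (h l) = 0" using t0[OF hI[OF that]] by simp
    then have "\<xi> (h l) = 0\<^sub>m d d" using psd_trace(3)[OF \<xi>[OF hI[OF that]]] by (simp add: t_def)
    moreover have "nrm i0 \<in> carrier_mat d d" using car[OF i0(1)] by (simp add: nrm_def)
    ultimately show ?thesis using \<open>t (h l) = 0\<close> by (auto simp: \<eta>_def intro!: eq_matI)
  qed
  show ?thesis
    unfolding LHS_def
  proof (intro CollectI conjI norm exI)
    show "prob_dist (card I) (\<lambda>l. t (h l))"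
      unfolding prob_dist_def using t0 hI tr sum.reindex_bij_betw[OF h, of t] by (auto simp: t_def)
    show "\<forall>x<s. \<forall>l<card I. prob_dist r (\<lambda>a. P a x (h l))"
      unfolding prob_dist_def using P0 P1 hI by auto
    show "\<forall>l<card I. density_op d (\<eta> l)"
      unfolding \<eta>_def using density hI i0 by auto
    show "\<forall>a<r. \<forall>x<s. \<sigma> a x = mat_sum d d {..<card I} (\<lambda>l. complex_of_real (t (h l) * P a x (h l)) \<cdot>\<^sub>m \<eta> l)"
    proof (intro allI impI)
      fix a x assume ax: "a < r" "x < s"
      have "mat_sum d d {..<card I} (\<lambda>l. complex_of_real (t (h l) * P a x (h l)) \<cdot>\<^sub>m \<eta> l) =
          mat_sum d d {..<card I} (\<lambda>l. complex_of_real (P a x (h l)) \<cdot>\<^sub>m \<xi> (h l))"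
        by (rule mat_sum_cong[OF refl], rule \<eta>) simp
      also have "\<dots> = mat_sum d d I (\<lambda>i. complex_of_real (P a x i) \<cdot>\<^sub>m \<xi> i)" by (rule mat_sum_reindex[OF h])
      finally show "\<sigma> a x = mat_sum d d {..<card I} (\<lambda>l. complex_of_real (t (h l) * P a x (h l)) \<cdot>\<^sub>m \<eta> l)"
        unfolding \<sigma>[OF ax] ..
    qed
  qed
qed

lemma LHS_normalised: "\<sigma> \<in> LHS d r s \<Longrightarrow> \<sigma> \<in> normalised_assemblages d r s"
  by (simp add: LHS_def)

lemma LHS_E:
  assumes "\<sigma> \<in> LHS d r s"
  obtains m :: nat and P \<xi> where "\<forall>l<m. psd d (\<xi> l)"
    "\<forall>a<r. \<forall>x<s. \<forall>l<m. 0 \<le> P a x l" "\<forall>x<s. \<forall>l<m. (\<Sum>a<r. P a x l) = 1"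
    "\<forall>a<r. \<forall>x<s. \<sigma> a x = mat_sum d d {..<m} (\<lambda>l. complex_of_real (P a x l) \<cdot>\<^sub>m \<xi> l)"
    "(\<Sum>l<m. Re (mat_trace (\<xi> l))) = 1"
proof -
  obtain m p P \<eta> where p: "prob_dist m p" and P: "\<forall>x<s. \<forall>l<m. prob_dist r (\<lambda>a. P a x l)"
    and \<eta>: "\<forall>l<m. density_op d (\<eta> l)"
    and \<sigma>: "\<forall>a<r. \<forall>x<s. \<sigma> a x = mat_sum d d {..<m} (\<lambda>l. complex_of_real (p l * P a x l) \<cdot>\<^sub>m \<eta> l)"
    using assms unfolding LHS_def by blast
  define \<xi> where "\<xi> = (\<lambda>l. complex_of_real (p l) \<cdot>\<^sub>m \<eta> l)"
  show ?thesis
  proof (rule that[of m \<xi> P])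
    have psd: "psd d (\<eta> l)" if "l < m" for l using \<eta> that by (simp add: density_op_def)
    show "\<forall>l<m. psd d (\<xi> l)"
      unfolding \<xi>_def using p by (intro allI impI psd_smult psd) (auto simp: prob_dist_def)
    show "\<forall>a<r. \<forall>x<s. \<sigma> a x = mat_sum d d {..<m} (\<lambda>l. complex_of_real (P a x l) \<cdot>\<^sub>m \<xi> l)"
    proof -
      have "complex_of_real (p l * P a x l) \<cdot>\<^sub>m \<eta> l = complex_of_real (P a x l) \<cdot>\<^sub>m \<xi> l" for a x l
        unfolding \<xi>_def by (rule eq_matI) auto
      then show ?thesis using \<sigma> by (simp only:)
    qed
    have "Re (mat_trace (\<xi> l)) = p l" if "l < m" for l
      unfolding \<xi>_def trace_smult[OF psdD(1)[OF psd[OF that]]] using \<eta> that by (simp add: density_op_def)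
    then show "(\<Sum>l<m. Re (mat_trace (\<xi> l))) = 1" using p by (simp add: prob_dist_def)
  qed (use P in \<open>auto simp: prob_dist_def\<close>)
qed

section \<open>Compactness of the set of unsteerable assemblages\<close>

definition strategies :: "nat \<Rightarrow> nat \<Rightarrow> (nat \<Rightarrow> nat) set" where
  "strategies r s = (\<Pi>\<^sub>E x\<in>{..<s}. {..<r})"

lemma finite_strategies [simp]: "finite (strategies r s)"
  by (simp add: strategies_def finite_PiE)

text \<open>Deterministic response functions bound the range of the hidden variable, and this is what makes the
  set of unsteerable assemblages compact.\<close>

lemma LHS_deterministic:
  assumes "\<sigma> \<in> LHS d r s"
  obtains \<xi> where "\<And>f. f \<in> strategies r s \<Longrightarrow> psd d (\<xi> f)"
    "\<And>a x. a < r \<Longrightarrow> x < s \<Longrightarrow> \<sigma> a x = mat_sum d d (strategies r s) (\<lambda>f. complex_of_real (if f x = a then 1 else 0) \<cdot>\<^sub>m \<xi> f)"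
    "(\<Sum>f\<in>strategies r s. Re (mat_trace (\<xi> f))) = 1"
proof -
  obtain m :: nat and P \<eta> where *: "\<forall>l<m. psd d (\<eta> l)"
    "\<forall>a<r. \<forall>x<s. \<forall>l<m. 0 \<le> P a x l" "\<forall>x<s. \<forall>l<m. (\<Sum>a<r. P a x l) = 1"
    "\<forall>a<r. \<forall>x<s. \<sigma> a x = mat_sum d d {..<m} (\<lambda>l. complex_of_real (P a x l) \<cdot>\<^sub>m \<eta> l)"
    "(\<Sum>l<m. Re (mat_trace (\<eta> l))) = 1"
    by (rule LHS_E[OF assms])
  note \<eta> = *(1)[rule_format] and P0 = *(2)[rule_format] and P1 = *(3)[rule_format]
    and \<sigma> = *(4)[rule_format] and tr = *(5)
  note car = psdD(1)[OF \<eta>]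
  let ?F = "strategies r s"
  \<comment> \<open>The probability of the whole table \<open>f\<close> of outputs when the outputs
    for the different inputs are drawn independently, given the hidden value
    \<open>l\<close>.\<close>
  define w where "w = (\<lambda>f l. \<Prod>x<s. P (f x) x l)"
  have w0: "0 \<le> w f l" if "f \<in> ?F" "l < m" for f l
    unfolding w_def by (intro prod_nonneg ballI P0) (use that in \<open>auto simp: strategies_def\<close>)
  have w1: "(\<Sum>f\<in>?F. w f l) = 1" if l: "l < m" for l
  proof -
    have "(\<Sum>f\<in>?F. w f l) = (\<Prod>x<s. \<Sum>a<r. P a x l)"
      unfolding w_def strategies_def by (rule prod_sum_PiE[symmetric]) auto
    also have "\<dots> = 1" by (intro prod.neutral ballI) (simp add: P1 l)
    finally show ?thesis .
  qed
  have wa: "(\<Sum>f\<in>?F. if f x = a then w f l else 0) = P a x l" if ax: "a < r" "x < s" and l: "l < m" for a x l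
  proof -
    \<comment> \<open>Factor \<open>x\<close> is restricted to the output \<open>a\<close>, so the
      sum over strategies with \<open>f x = a\<close> again factorises and every factor other than
      \<open>x\<close> sums to 1.\<close>
    define v where "v = (\<lambda>y b. if y = x \<and> b \<noteq> a then 0 else P b y l)"
    have "(if f x = a then w f l else 0) = (\<Prod>y<s. v y (f y))" for f
    proof (cases "f x = a")
      case True
      then show ?thesis unfolding w_def v_def by (auto intro!: prod.cong)
    next
      case False
      then have "v x (f x) = 0" by (simp add: v_def)
      then have "(\<Prod>y<s. v y (f y)) = 0" using ax(2) by (intro prod_zero) auto
      then show ?thesis using False by simp
    qed
    then have "(\<Sum>f\<in>?F. if f x = a then w f l else 0) = (\<Prod>y<s. \<Sum>b<r. v y b)"
      unfolding strategies_def by (simp add: prod_sum_PiE)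
    also have "\<dots> = (\<Prod>y<s. if y = x then P a x l else 1)"
    proof (rule prod.cong[OF refl])
      fix y assume y: "y \<in> {..<s}"
      show "(\<Sum>b<r. v y b) = (if y = x then P a x l else 1)"
      proof (cases "y = x")
        case True
        then have "(\<Sum>b<r. v y b) = (\<Sum>b<r. if b = a then P a x l else 0)"
          unfolding v_def by (intro sum.cong) auto
        then show ?thesis using True ax by simp
      next
        case False
        then show ?thesis using y P1[OF _ l] by (simp add: v_def)
      qed
    qed
    also have "\<dots> = P a x l" using ax by simp
    finally show ?thesis .
  qed
  define \<xi> where "\<xi> = (\<lambda>f. mat_sum d d {..<m} (\<lambda>l. complex_of_real (w f l) \<cdot>\<^sub>m \<eta> l))"
  show ?thesis
  proof (rule that[of \<xi>])
    show "psd d (\<xi> f)" if "f \<in> ?F" for f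
      unfolding \<xi>_def by (intro psd_mat_sum psd_smult \<eta> w0 that) auto
    show "\<sigma> a x = mat_sum d d ?F (\<lambda>f. complex_of_real (if f x = a then 1 else 0) \<cdot>\<^sub>m \<xi> f)" if ax: "a < r" "x < s" for a x
      unfolding \<sigma>[OF ax]
    proof (rule eq_matI)
      fix i j assume "i < dim_row (mat_sum d d ?F (\<lambda>f. complex_of_real (if f x = a then 1 else 0) \<cdot>\<^sub>m \<xi> f))"
        "j < dim_col (mat_sum d d ?F (\<lambda>f. complex_of_real (if f x = a then 1 else 0) \<cdot>\<^sub>m \<xi> f))"
      then have ij: "i < d" "j < d" by auto
      have ent: "(complex_of_real c \<cdot>\<^sub>m \<eta> l) $$ (i, j) = complex_of_real c * \<eta> l $$ (i, j)" if "l < m" for c l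
        using car[OF that] ij by simp
      have "mat_sum d d ?F (\<lambda>f. complex_of_real (if f x = a then 1 else 0) \<cdot>\<^sub>m \<xi> f) $$ (i, j) =
          (\<Sum>f\<in>?F. \<Sum>l<m. complex_of_real (if f x = a then w f l else 0) * \<eta> l $$ (i, j))"
        using ij by (auto simp: \<xi>_def ent intro!: sum.cong)
      also have "\<dots> = (\<Sum>l<m. complex_of_real (\<Sum>f\<in>?F. if f x = a then w f l else 0) * \<eta> l $$ (i, j))"
        by (subst sum.swap) (simp only: of_real_sum sum_distrib_right)
      also have "\<dots> = (\<Sum>l<m. complex_of_real (P a x l) * \<eta> l $$ (i, j))"
        by (intro sum.cong refl) (simp only: wa[OF ax] lessThan_iff)
      also have "\<dots> = mat_sum d d {..<m} (\<lambda>l. complex_of_real (P a x l) \<cdot>\<^sub>m \<eta> l) $$ (i, j)"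
        using ij by (simp add: ent)
      finally show "mat_sum d d {..<m} (\<lambda>l. complex_of_real (P a x l) \<cdot>\<^sub>m \<eta> l) $$ (i, j) =
          mat_sum d d ?F (\<lambda>f. complex_of_real (if f x = a then 1 else 0) \<cdot>\<^sub>m \<xi> f) $$ (i, j)" ..
    qed simp_all
    have "mat_trace (\<xi> f) = (\<Sum>l<m. complex_of_real (w f l) * mat_trace (\<eta> l))" for f
    proof -
      have "mat_trace (\<xi> f) = (\<Sum>l<m. mat_trace (complex_of_real (w f l) \<cdot>\<^sub>m \<eta> l))"
        unfolding \<xi>_def by (rule trace_mat_sum) (use car in auto)
      then show ?thesis by (simp add: trace_smult[OF car])
    qed
    then have "(\<Sum>f\<in>?F. Re (mat_trace (\<xi> f))) = (\<Sum>f\<in>?F. \<Sum>l<m. w f l * Re (mat_trace (\<eta> l)))" by simp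
    also have "\<dots> = (\<Sum>l<m. (\<Sum>f\<in>?F. w f l) * Re (mat_trace (\<eta> l)))"
      by (subst sum.swap) (simp only: sum_distrib_right)
    also have "\<dots> = 1" using w1 tr by simp
    finally show "(\<Sum>f\<in>?F. Re (mat_trace (\<xi> f))) = 1" .
  qed
qed

text \<open>Bolzano-Weierstrass once for each member: a further subsequence keeps the limits already
  obtained.\<close>

lemma finite_family_convergent_subseq:
  fixes f :: "'i \<Rightarrow> nat \<Rightarrow> 'a::heine_borel"
  assumes "finite I" "\<And>i. i \<in> I \<Longrightarrow> bounded (range (f i))"
  shows "\<exists>\<phi>::nat \<Rightarrow> nat. strict_mono \<phi> \<and> (\<forall>i\<in>I. convergent (f i \<circ> \<phi>))"
  using assms
proof (induction I rule: finite_induct)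
  case empty
  show ?case by (rule exI[of _ id]) (simp add: strict_mono_def)
next
  case (insert k I)
  have "\<exists>\<phi>::nat \<Rightarrow> nat. strict_mono \<phi> \<and> (\<forall>i\<in>I. convergent (f i \<circ> \<phi>))"
    by (rule insert.IH) (use insert.prems in blast)
  then obtain \<phi> :: "nat \<Rightarrow> nat" where \<phi>: "strict_mono \<phi>" "\<forall>i\<in>I. convergent (f i \<circ> \<phi>)" by blast
  have "bounded (range (f k \<circ> \<phi>))"
    by (rule bounded_subset[of "range (f k)"]) (use insert.prems in auto)
  then obtain l \<psi> where \<psi>: "strict_mono (\<psi> :: nat \<Rightarrow> nat)" "((f k \<circ> \<phi>) \<circ> \<psi>) \<longlonglongrightarrow> l"
    using bounded_imp_convergent_subsequence by blast
  have "convergent (f i \<circ> (\<phi> \<circ> \<psi>))" if "i \<in> insert k I" for i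
  proof (cases "i = k")
    case True
    then show ?thesis using \<psi>(2) by (auto simp: convergent_def o_assoc)
  next
    case False
    then have "convergent (f i \<circ> \<phi>)" using \<phi>(2) that by auto
    then show ?thesis using convergent_subseq_convergent[OF _ \<psi>(1)] by (simp add: o_assoc)
  qed
  moreover have "strict_mono (\<phi> \<circ> \<psi>)" using \<phi>(1) \<psi>(1) by (rule strict_mono_o)
  ultimately show ?case by blast
qed

text \<open>Deterministic strategies give all members of the sequence the same finite index set of
  hidden states. Their entries are bounded by the total trace 1, a subsequence converges entrywise,
  and the limits are again positive of total trace 1.\<close>

lemma LHS_sequentially_compact:
  assumes \<sigma>N: "\<And>N. \<sigma>N N \<in> LHS d r s"
  obtains \<phi> \<sigma> where "strict_mono (\<phi> :: nat \<Rightarrow> nat)" "\<sigma> \<in> LHS d r s"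
    "\<And>a x i j. a < r \<Longrightarrow> x < s \<Longrightarrow> i < d \<Longrightarrow> j < d \<Longrightarrow> (\<lambda>N. \<sigma>N (\<phi> N) a x $$ (i, j)) \<longlonglongrightarrow> \<sigma> a x $$ (i, j)"
proof -
  let ?F = "strategies r s"
  have pos: "1 \<le> d" "1 \<le> r" "1 \<le> s"
    using is_assemblageD(1,2,3)[OF normalisedD(1)[OF LHS_normalised[OF \<sigma>N[of 0]]]] by auto
  have "\<forall>N. \<exists>\<xi>. (\<forall>f\<in>?F. psd d (\<xi> f)) \<and>
      (\<forall>a<r. \<forall>x<s. \<sigma>N N a x = mat_sum d d ?F (\<lambda>f. complex_of_real (if f x = a then 1 else 0) \<cdot>\<^sub>m \<xi> f)) \<and>
      (\<Sum>f\<in>?F. Re (mat_trace (\<xi> f))) = 1"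
  proof
    fix N
    obtain \<xi> where "\<And>f. f \<in> ?F \<Longrightarrow> psd d (\<xi> f)"
      "\<And>a x. a < r \<Longrightarrow> x < s \<Longrightarrow> \<sigma>N N a x = mat_sum d d ?F (\<lambda>f. complex_of_real (if f x = a then 1 else 0) \<cdot>\<^sub>m \<xi> f)"
      "(\<Sum>f\<in>?F. Re (mat_trace (\<xi> f))) = 1"
      by (rule LHS_deterministic[OF \<sigma>N[of N]]) blast
    then show "\<exists>\<xi>. (\<forall>f\<in>?F. psd d (\<xi> f)) \<and>
      (\<forall>a<r. \<forall>x<s. \<sigma>N N a x = mat_sum d d ?F (\<lambda>f. complex_of_real (if f x = a then 1 else 0) \<cdot>\<^sub>m \<xi> f)) \<and>
      (\<Sum>f\<in>?F. Re (mat_trace (\<xi> f))) = 1" by blast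
  qed
  then obtain \<xi> where all: "\<forall>N. (\<forall>f\<in>?F. psd d (\<xi> N f)) \<and>
      (\<forall>a<r. \<forall>x<s. \<sigma>N N a x = mat_sum d d ?F (\<lambda>f. complex_of_real (if f x = a then 1 else 0) \<cdot>\<^sub>m \<xi> N f)) \<and>
      (\<Sum>f\<in>?F. Re (mat_trace (\<xi> N f))) = 1"
    unfolding choice_iff by blast
  have \<xi>: "psd d (\<xi> N f)" if "f \<in> ?F" for N f using all that by blast
  have \<sigma>N_eq: "\<sigma>N N a x = mat_sum d d ?F (\<lambda>f. complex_of_real (if f x = a then 1 else 0) \<cdot>\<^sub>m \<xi> N f)" if "a < r" "x < s" for N a x
    using all that by blast
  have tr: "(\<Sum>f\<in>?F. Re (mat_trace (\<xi> N f))) = 1" for N using all by blast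
  let ?I = "?F \<times> {..<d} \<times> {..<d}"
  define entry where "entry = (\<lambda>(f, i, j) N. \<xi> N f $$ (i, j))"
  have "bounded (range (entry k))" if k: "k \<in> ?I" for k
  proof -
    obtain f i j where k': "k = (f, i, j)" "f \<in> ?F" "i < d" "j < d" using k by auto
    have "cmod (entry k N) \<le> 1" for N
    proof -
      have "cmod (entry k N) \<le> Re (mat_trace (\<xi> N f))"
        unfolding entry_def k' by (simp add: psd_trace(4)[OF \<xi>[OF k'(2)] k'(3,4)])
      also have "\<dots> \<le> (\<Sum>f\<in>?F. Re (mat_trace (\<xi> N f)))"
        by (rule member_le_sum) (use k' psd_trace(2)[OF \<xi>] in auto)
      finally show ?thesis unfolding tr .
    qed
    then show ?thesis by (auto simp: bounded_iff)
  qed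
  then obtain \<phi> :: "nat \<Rightarrow> nat" where \<phi>: "strict_mono \<phi>" "\<forall>k\<in>?I. convergent (entry k \<circ> \<phi>)"
    using finite_family_convergent_subseq[of ?I entry] by auto
  define \<zeta> where "\<zeta> = (\<lambda>f. mat d d (\<lambda>(i, j). lim (entry (f, i, j) \<circ> \<phi>)))"
  have lim: "(\<lambda>N. \<xi> (\<phi> N) f $$ (i, j)) \<longlonglongrightarrow> \<zeta> f $$ (i, j)" if "f \<in> ?F" "i < d" "j < d" for f i j
  proof -
    have "convergent (entry (f, i, j) \<circ> \<phi>)" using \<phi>(2) that by auto
    then have "(entry (f, i, j) \<circ> \<phi>) \<longlonglongrightarrow> lim (entry (f, i, j) \<circ> \<phi>)" by (simp add: convergent_LIMSEQ_iff)
    moreover have "entry (f, i, j) \<circ> \<phi> = (\<lambda>N. \<xi> (\<phi> N) f $$ (i, j))" by (auto simp: entry_def)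
    ultimately show ?thesis using that by (simp add: \<zeta>_def)
  qed
  have \<zeta>: "psd d (\<zeta> f)" if "f \<in> ?F" for f
    by (rule psd_limit[where A = "\<lambda>N. \<xi> (\<phi> N) f"]) (use \<xi> lim that in \<open>auto simp: \<zeta>_def\<close>)
  define \<sigma> where "\<sigma> = (\<lambda>a x. if a < r \<and> x < s then mat_sum d d ?F (\<lambda>f. complex_of_real (if f x = a then 1 else 0) \<cdot>\<^sub>m \<zeta> f) else 0\<^sub>m d d)"
  show ?thesis
  proof (rule that[OF \<phi>(1), of \<sigma>])
    show "\<sigma> \<in> LHS d r s"
    proof (rule LHS_I[OF pos finite_strategies, where \<xi> = \<zeta> and P = "\<lambda>a x f. if f x = a then 1 else 0"])
      show "(\<Sum>a<r. if f x = a then 1 else 0 :: real) = 1" if "x < s" "f \<in> ?F" for x f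
        using that by (auto simp: strategies_def dest: PiE_mem)
      have "(\<lambda>N. \<Sum>f\<in>?F. Re (mat_trace (\<xi> (\<phi> N) f))) \<longlonglongrightarrow> (\<Sum>f\<in>?F. Re (mat_trace (\<zeta> f)))"
      proof (intro tendsto_sum tendsto_Re)
        fix f assume f: "f \<in> ?F"
        have tr_eq: "mat_trace C = (\<Sum>i<d. C $$ (i, i))" if "psd d C" for C
          using psdD(1)[OF that] by (simp add: mat_trace_def)
        show "(\<lambda>N. mat_trace (\<xi> (\<phi> N) f)) \<longlonglongrightarrow> mat_trace (\<zeta> f)"
          unfolding tr_eq[OF \<xi>[OF f]] tr_eq[OF \<zeta>[OF f]] by (intro tendsto_sum lim f) auto
      qed
      then show "(\<Sum>f\<in>?F. Re (mat_trace (\<zeta> f))) = 1" unfolding tr by (simp add: LIMSEQ_const_iff)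
    qed (use \<zeta> in \<open>auto simp: \<sigma>_def\<close>)
    show "(\<lambda>N. \<sigma>N (\<phi> N) a x $$ (i, j)) \<longlonglongrightarrow> \<sigma> a x $$ (i, j)"
      if ax: "a < r" "x < s" and ij: "i < d" "j < d" for a x i j
    proof -
      have "mat_sum d d ?F (\<lambda>f. complex_of_real (if f x = a then 1 else 0) \<cdot>\<^sub>m \<eta> f) $$ (i, j) =
          (\<Sum>f\<in>?F. complex_of_real (if f x = a then 1 else 0) * \<eta> f $$ (i, j))"
        if "\<And>f. f \<in> ?F \<Longrightarrow> psd d (\<eta> f)" for \<eta>
        using ij carrier_matD[OF psdD(1)[OF that]] by (auto intro!: sum.cong)
      note * = this[of "\<xi> _", OF \<xi>] this[of \<zeta>, OF \<zeta>]
      show ?thesis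
        unfolding \<sigma>N_eq[OF ax] \<sigma>_def using ax by (simp only: simp_thms if_True * if_P) (intro tendsto_sum tendsto_mult tendsto_const lim ij)
    qed
  qed
qed

section \<open>Existence and finiteness of the minimum\<close>

text \<open>The linear part of \<open>ell\<close> vanishes and minus a positive quadratic form
  remains.\<close>

lemma divergence_self: "psd n A \<Longrightarrow> divergence n A A = 0"
proof -
  assume A: "psd n A"
  have "quad_div n t A A = 0" if t: "0 < t" "t < 1" for t
  proof -
    have "ennreal (ell t A A X) \<le> 0" if X: "X \<in> carrier_mat n n" for X
    proof -
      have "0 \<le> t * Re (mat_trace (X * A * X\<^sup>\<dagger>))" "0 \<le> (1 - t) * Re (mat_trace (X\<^sup>\<dagger> * A * X))"
        using t trace_psd_conj_nonneg[OF A X] trace_psd_conj_nonneg[OF A adjoint_carrier[OF X]] by simp_all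
      then have "ell t A A X \<le> 0" unfolding ell_expand[OF psdD(1)[OF A] psdD(1)[OF A] X] by simp
      then show ?thesis by (simp add: ennreal_neg)
    qed
    then have "quad_div n t A A \<le> 0" unfolding quad_div_def by (intro SUP_least) auto
    then show ?thesis by simp
  qed
  then have "divergence n A A = (\<integral>\<^sup>+t. 0 \<partial>(lborel :: real measure))"
    unfolding divergence_def by (intro nn_integral_cong) (auto split: split_indicator)
  then show ?thesis by simp
qed

lemma S_A_self:
  assumes "\<rho> \<in> normalised_assemblages d r s"
  shows "S_A d r s \<rho> \<rho> = 0"
proof (rule antisym[OF S_A_least[OF assms assms] S_A_nonneg[OF assms assms]])
  fix g E P assume m: "is_measurement d d s g E P"
  have "asm_value d r s g E P \<rho> \<rho> = 0"
    unfolding asm_value_def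
    by (intro sum.neutral ballI)
       (simp add: divergence_self psd_congruence[OF is_assemblageD(4)[OF normalisedD(1)[OF assms]] is_measurementD(1)[OF m]])
  then show "enn2ereal (asm_value d r s g E P \<rho> \<rho>) \<le> 0" by (simp add: zero_ennreal.rep_eq)
qed

lemma unsteerable_dominating:
  assumes \<rho>: "\<rho> \<in> normalised_assemblages d r s"
  obtains \<sigma> where "\<sigma> \<in> LHS d r s"
    "\<And>a x. a < r \<Longrightarrow> x < s \<Longrightarrow> psd d (complex_of_real (real r) \<cdot>\<^sub>m \<sigma> a x - \<rho> a x)"
proof -
  note ra = normalisedD(1)[OF \<rho>]
  note pos = is_assemblageD(1,2,3)[OF ra]
  let ?R = "rho_B d r \<rho>"
  have R: "?R \<in> carrier_mat d d" by (simp add: rho_B_def)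
  have psdR: "psd d ?R" unfolding rho_B_def by (intro psd_mat_sum is_assemblageD(4)[OF ra]) (use pos in auto)
  \<comment> \<open>One hidden state, the marginal of \<open>\<rho>\<close>, with a uniformly random
    output. Then \<open>r\<close> times a component exceeds the corresponding component of
    \<open>\<rho>\<close> by the sum of the components for the other outputs.\<close>
  define \<sigma> where "\<sigma> = (\<lambda>a x. if a < r \<and> x < s then complex_of_real (1 / real r) \<cdot>\<^sub>m ?R else 0\<^sub>m d d)"
  have "\<sigma> \<in> LHS d r s"
  proof (rule LHS_I[OF pos, where I = "{()}" and \<xi> = "\<lambda>_. ?R" and P = "\<lambda>_ _ _. 1 / real r"])
    show "\<sigma> a x = mat_sum d d {()} (\<lambda>_. complex_of_real (1 / real r) \<cdot>\<^sub>m ?R)" if "a < r" "x < s" for a x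
      using that R by (intro eq_matI) (auto simp: \<sigma>_def)
  qed (use pos psdR normalisedD(2)[OF \<rho>] in \<open>auto simp: \<sigma>_def\<close>)
  moreover have "psd d (complex_of_real (real r) \<cdot>\<^sub>m \<sigma> a x - \<rho> a x)" if ax: "a < r" "x < s" for a x
  proof -
    have "complex_of_real (real r) \<cdot>\<^sub>m \<sigma> a x - \<rho> a x = mat_sum d d ({..<r} - {a}) (\<lambda>b. \<rho> b x)"
    proof (rule eq_matI)
      fix i j assume "i < dim_row (mat_sum d d ({..<r} - {a}) (\<lambda>b. \<rho> b x))" "j < dim_col (mat_sum d d ({..<r} - {a}) (\<lambda>b. \<rho> b x))"
      then have ij: "i < d" "j < d" by auto
      have "?R $$ (i, j) = (\<Sum>b<r. \<rho> b x $$ (i, j))"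
        unfolding is_assemblageD(6)[OF ra ax(2), symmetric] using ij by simp
      then show "(complex_of_real (real r) \<cdot>\<^sub>m \<sigma> a x - \<rho> a x) $$ (i, j) = mat_sum d d ({..<r} - {a}) (\<lambda>b. \<rho> b x) $$ (i, j)"
        using ij ax pos R carrier_matD[OF is_assemblageD(7)[OF ra, of a x]]
        by (simp add: \<sigma>_def sum_diff1)
    qed (use is_assemblageD(7)[OF ra, of a x] in auto)
    then show ?thesis using psd_mat_sum[of "{..<r} - {a}" d "\<lambda>b. \<rho> b x"] is_assemblageD(4)[OF ra _ ax(2)] by simp
  qed
  ultimately show ?thesis by (rule that)
qed

text \<open>Domination survives every measurement operator, so \<open>divergence_dominated\<close>
  applies to each term. Each of the two traces in its bound totals 1, which explains the factor
  2.\<close>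

lemma S_A_dominated:
  assumes \<rho>: "\<rho> \<in> normalised_assemblages d r s" and \<sigma>: "\<sigma> \<in> normalised_assemblages d r s"
    and k: "0 \<le> k" "\<And>a x. a < r \<Longrightarrow> x < s \<Longrightarrow> psd d (complex_of_real k \<cdot>\<^sub>m \<sigma> a x - \<rho> a x)"
  shows "S_A d r s \<rho> \<sigma> \<le> ereal (2 * (1 + k))"
proof (rule S_A_least[OF \<rho> \<sigma>])
  note ra = normalisedD(1)[OF \<rho>] and sa = normalisedD(1)[OF \<sigma>]
  fix g E P assume m: "is_measurement d d s g E P"
  define T where "T = (\<lambda>\<gamma> x a. Re (mat_trace (E \<gamma> * \<rho> a x * (E \<gamma>)\<^sup>\<dagger>)) + Re (mat_trace (E \<gamma> * \<sigma> a x * (E \<gamma>)\<^sup>\<dagger>)))"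
  have T0: "0 \<le> T \<gamma> x a" and D: "divergence d (E \<gamma> * \<rho> a x * (E \<gamma>)\<^sup>\<dagger>) (E \<gamma> * \<sigma> a x * (E \<gamma>)\<^sup>\<dagger>) \<le> ennreal ((1 + k) * T \<gamma> x a)"
    if *: "\<gamma> < g" "x < s" "a < r" for \<gamma> x a
  proof -
    note E = is_measurementD(1)[OF m *(1)]
    have E': "(E \<gamma>)\<^sup>\<dagger> \<in> carrier_mat d d" using E by simp
    note \<rho>c = is_assemblageD(7)[OF ra, of a x] and \<sigma>c = is_assemblageD(7)[OF sa, of a x]
    have psd\<rho>: "psd d (E \<gamma> * \<rho> a x * (E \<gamma>)\<^sup>\<dagger>)" by (rule psd_congruence[OF is_assemblageD(4)[OF ra *(3,2)] E])
    have psd\<sigma>: "psd d (E \<gamma> * \<sigma> a x * (E \<gamma>)\<^sup>\<dagger>)" by (rule psd_congruence[OF is_assemblageD(4)[OF sa *(3,2)] E])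
    show "0 \<le> T \<gamma> x a" unfolding T_def using psd_trace(2)[OF psd\<rho>] psd_trace(2)[OF psd\<sigma>] by simp
    have k\<sigma>: "complex_of_real k \<cdot>\<^sub>m \<sigma> a x \<in> carrier_mat d d" using \<sigma>c by simp
    have "E \<gamma> * (complex_of_real k \<cdot>\<^sub>m \<sigma> a x - \<rho> a x) * (E \<gamma>)\<^sup>\<dagger> =
        complex_of_real k \<cdot>\<^sub>m (E \<gamma> * \<sigma> a x * (E \<gamma>)\<^sup>\<dagger>) - E \<gamma> * \<rho> a x * (E \<gamma>)\<^sup>\<dagger>"
      unfolding mult_minus_distrib_mat[OF E k\<sigma> \<rho>c] congruence_smult[OF E \<sigma>c, symmetric]
      by (rule minus_mult_distrib_mat[OF mult_carrier_mat[OF E k\<sigma>] mult_carrier_mat[OF E \<rho>c] E'])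
    then have "psd d (complex_of_real k \<cdot>\<^sub>m (E \<gamma> * \<sigma> a x * (E \<gamma>)\<^sup>\<dagger>) - E \<gamma> * \<rho> a x * (E \<gamma>)\<^sup>\<dagger>)"
      using psd_congruence[OF k(2)[OF *(3,2)] E] by simp
    from divergence_dominated[OF psd\<rho> psd\<sigma> this k(1)]
    show "divergence d (E \<gamma> * \<rho> a x * (E \<gamma>)\<^sup>\<dagger>) (E \<gamma> * \<sigma> a x * (E \<gamma>)\<^sup>\<dagger>) \<le> ennreal ((1 + k) * T \<gamma> x a)"
      unfolding T_def .
  qed
  have "asm_value d r s g E P \<rho> \<sigma> \<le> (\<Sum>\<gamma><g. \<Sum>x<s. \<Sum>a<r. ennreal (P x \<gamma>) * ennreal ((1 + k) * T \<gamma> x a))"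
    unfolding asm_value_def by (intro sum_mono mult_left_mono D) auto
  also have "\<dots> = (\<Sum>\<gamma><g. \<Sum>x<s. \<Sum>a<r. ennreal (P x \<gamma> * ((1 + k) * T \<gamma> x a)))"
    by (intro sum.cong refl ennreal_mult'[symmetric] is_measurementD(3)[OF m]) auto
  also have "\<dots> = (\<Sum>\<gamma><g. ennreal (\<Sum>x<s. \<Sum>a<r. P x \<gamma> * ((1 + k) * T \<gamma> x a)))"
    by (intro sum.cong refl sum_sum_ennreal mult_nonneg_nonneg is_measurementD(3)[OF m] T0) (use k in auto)
  also have "\<dots> = ennreal (\<Sum>\<gamma><g. \<Sum>x<s. \<Sum>a<r. P x \<gamma> * ((1 + k) * T \<gamma> x a))"
    by (intro sum_ennreal sum_nonneg mult_nonneg_nonneg is_measurementD(3)[OF m] T0) (use k in auto)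
  also have "(\<Sum>\<gamma><g. \<Sum>x<s. \<Sum>a<r. P x \<gamma> * ((1 + k) * T \<gamma> x a)) = (1 + k) * 2"
  proof -
    have "(\<Sum>\<gamma><g. \<Sum>x<s. \<Sum>a<r. P x \<gamma> * ((1 + k) * T \<gamma> x a)) =
        (1 + k) * ((\<Sum>\<gamma><g. \<Sum>x<s. \<Sum>a<r. P x \<gamma> * Re (mat_trace (E \<gamma> * \<rho> a x * (E \<gamma>)\<^sup>\<dagger>))) +
          (\<Sum>\<gamma><g. \<Sum>x<s. \<Sum>a<r. P x \<gamma> * Re (mat_trace (E \<gamma> * \<sigma> a x * (E \<gamma>)\<^sup>\<dagger>))))"
      unfolding T_def sum.distrib[symmetric] sum_distrib_left by (simp add: algebra_simps)
    then show ?thesis unfolding total_trace[OF \<rho> m] total_trace[OF \<sigma> m] by simp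
  qed
  finally have "enn2ereal (asm_value d r s g E P \<rho> \<sigma>) \<le> enn2ereal (ennreal ((1 + k) * 2))"
    unfolding less_eq_ennreal.rep_eq .
  also have "\<dots> = ereal (2 * (1 + k))" using k(1) by (subst enn2ereal_ennreal) auto
  finally show "enn2ereal (asm_value d r s g E P \<rho> \<sigma>) \<le> ereal (2 * (1 + k))" .
qed

lemma S_R_finite:
  assumes \<rho>: "\<rho> \<in> normalised_assemblages d r s"
  obtains y where "S_R d r s \<rho> = ereal y" "0 \<le> y"
proof -
  obtain \<sigma> where \<sigma>: "\<sigma> \<in> LHS d r s" "\<And>a x. a < r \<Longrightarrow> x < s \<Longrightarrow> psd d (complex_of_real (real r) \<cdot>\<^sub>m \<sigma> a x - \<rho> a x)"
    by (rule unsteerable_dominating[OF \<rho>]) blast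
  have "S_R d r s \<rho> \<le> S_A d r s \<rho> \<sigma>" unfolding S_R_def by (rule INF_lower[OF \<sigma>(1)])
  also have "\<dots> \<le> ereal (2 * (1 + real r))"
    by (rule S_A_dominated[OF \<rho> LHS_normalised[OF \<sigma>(1)]]) (use \<sigma>(2) in auto)
  finally have "S_R d r s \<rho> \<le> ereal (2 * (1 + real r))" .
  moreover have "0 \<le> S_R d r s \<rho>"
    unfolding S_R_def by (intro INF_greatest S_A_nonneg[OF \<rho>] LHS_normalised)
  ultimately show ?thesis using that by (cases "S_R d r s \<rho>") auto
qed

text \<open>The direct method: a minimising sequence has an entrywise convergent subsequence with
  unsteerable limit, and lower semicontinuity bounds the value at the limit by the infimum.\<close>

lemma S_R_attained:
  assumes \<rho>: "\<rho> \<in> normalised_assemblages d r s"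
  obtains \<sigma> where "\<sigma> \<in> LHS d r s" "S_R d r s \<rho> = S_A d r s \<rho> \<sigma>"
proof -
  have ne: "S_A d r s \<rho> ` LHS d r s \<noteq> {}" by (rule unsteerable_dominating[OF \<rho>]) blast
  obtain u where u: "\<And>N. u N \<in> S_A d r s \<rho> ` LHS d r s" "u \<longlonglongrightarrow> S_R d r s \<rho>"
    using Inf_as_limit[OF ne] unfolding S_R_def by blast
  have "\<forall>N. \<exists>\<sigma>. \<sigma> \<in> LHS d r s \<and> u N = S_A d r s \<rho> \<sigma>" using u(1) by blast
  then obtain \<sigma>N where "\<forall>N. \<sigma>N N \<in> LHS d r s \<and> u N = S_A d r s \<rho> (\<sigma>N N)" unfolding choice_iff by blast
  then have \<sigma>N: "\<sigma>N N \<in> LHS d r s" "u N = S_A d r s \<rho> (\<sigma>N N)" for N by auto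
  obtain \<phi> \<sigma> where \<phi>: "strict_mono (\<phi> :: nat \<Rightarrow> nat)" and \<sigma>: "\<sigma> \<in> LHS d r s"
    and lim: "\<And>a x i j. a < r \<Longrightarrow> x < s \<Longrightarrow> i < d \<Longrightarrow> j < d \<Longrightarrow> (\<lambda>N. \<sigma>N (\<phi> N) a x $$ (i, j)) \<longlonglongrightarrow> \<sigma> a x $$ (i, j)"
    by (rule LHS_sequentially_compact[of \<sigma>N, OF \<sigma>N(1)]) blast
  have "(\<lambda>N. S_A d r s \<rho> (\<sigma>N (\<phi> N))) \<longlonglongrightarrow> S_R d r s \<rho>"
    using LIMSEQ_subseq_LIMSEQ[OF u(2) \<phi>] unfolding o_def \<sigma>N(2) .
  then have "S_A d r s \<rho> \<sigma> \<le> S_R d r s \<rho>"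
    by (intro S_A_lower_semicontinuous[where \<sigma>N = "\<lambda>N. \<sigma>N (\<phi> N)"] \<rho> LHS_normalised \<sigma> \<sigma>N(1) lim)
  moreover have "S_R d r s \<rho> \<le> S_A d r s \<rho> \<sigma>" unfolding S_R_def by (rule INF_lower[OF \<sigma>])
  ultimately show ?thesis using that[OF \<sigma>] by simp
qed

section \<open>Convexity\<close>

abbreviation mix :: "real \<Rightarrow> assemblage \<Rightarrow> assemblage \<Rightarrow> assemblage" where
  "mix \<mu> \<rho> \<rho>' \<equiv> asm_add (asm_scale \<mu> \<rho>) (asm_scale (1 - \<mu>) \<rho>')"

text \<open>A mixture as a weighted sum over two indices, so that joint convexity of the divergence
  applies to it.\<close>

lemma mix_eq_mat_sum:
  assumes "\<rho> a x \<in> carrier_mat d d" "\<rho>' a x \<in> carrier_mat d d"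
  shows "mix \<mu> \<rho> \<rho>' a x = mat_sum d d UNIV
    (\<lambda>b. complex_of_real (if b then \<mu> else 1 - \<mu>) \<cdot>\<^sub>m (if b then \<rho> a x else \<rho>' a x))"
  using assms by (intro eq_matI) (auto simp: asm_add_def asm_scale_def UNIV_bool)

lemma mix_normalised:
  assumes \<rho>: "\<rho> \<in> normalised_assemblages d r s" and \<rho>': "\<rho>' \<in> normalised_assemblages d r s"
    and \<mu>: "0 \<le> \<mu>" "\<mu> \<le> 1"
  shows "mix \<mu> \<rho> \<rho>' \<in> normalised_assemblages d r s"
proof -
  note ra = normalisedD(1)[OF \<rho>] and ra' = normalisedD(1)[OF \<rho>']
  note pos = is_assemblageD(1,2,3)[OF ra]
  note car = is_assemblageD(7)[OF ra] and car' = is_assemblageD(7)[OF ra']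
  let ?R = "complex_of_real \<mu> \<cdot>\<^sub>m rho_B d r \<rho> + complex_of_real (1 - \<mu>) \<cdot>\<^sub>m rho_B d r \<rho>'"
  have R: "rho_B d r \<tau> \<in> carrier_mat d d" for \<tau> by (simp add: rho_B_def)
  have marginal: "mat_sum d d {..<r} (\<lambda>a. mix \<mu> \<rho> \<rho>' a x) = ?R" if x: "x < s" for x
    unfolding is_assemblageD(6)[OF ra x, symmetric] is_assemblageD(6)[OF ra' x, symmetric]
    using carrier_matD[OF car] carrier_matD[OF car']
    by (intro eq_matI) (auto simp: asm_add_def asm_scale_def sum.distrib sum_distrib_left)
  have "is_assemblage d r s (mix \<mu> \<rho> \<rho>')"
    unfolding is_assemblage_def
  proof (intro conjI allI impI pos)
    show "psd d (mix \<mu> \<rho> \<rho>' a x)" if "a < r" "x < s" for a x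
      unfolding mix_eq_mat_sum[where \<rho> = \<rho> and \<rho>' = \<rho>' and a = a and x = x, OF car car']
      by (intro psd_mat_sum psd_smult) (use is_assemblageD(4)[OF ra that] is_assemblageD(4)[OF ra' that] \<mu> in auto)
    show "mix \<mu> \<rho> \<rho>' a x = 0\<^sub>m d d" if "\<not> (a < r \<and> x < s)" for a x
      using is_assemblageD(5)[OF ra that] is_assemblageD(5)[OF ra' that]
      by (auto simp: asm_add_def asm_scale_def intro!: eq_matI)
  qed (simp add: marginal)
  moreover have "asm_trace d r (mix \<mu> \<rho> \<rho>') = 1"
  proof -
    have "rho_B d r (mix \<mu> \<rho> \<rho>') = ?R" unfolding rho_B_def[of d r "mix \<mu> \<rho> \<rho>'"] using marginal[of 0] pos by simp
    then show ?thesis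
      unfolding asm_trace_def using R normalisedD(2)[OF \<rho>] normalisedD(2)[OF \<rho>']
      by (simp add: trace_add[of _ d] trace_smult[of _ d])
  qed
  ultimately show ?thesis by (simp add: normalised_assemblages_def)
qed

lemma mix_LHS:
  assumes \<sigma>: "\<sigma> \<in> LHS d r s" and \<sigma>': "\<sigma>' \<in> LHS d r s" and \<mu>: "0 \<le> \<mu>" "\<mu> \<le> 1"
  shows "mix \<mu> \<sigma> \<sigma>' \<in> LHS d r s"
proof -
  note sa = normalisedD(1)[OF LHS_normalised[OF \<sigma>]] and sa' = normalisedD(1)[OF LHS_normalised[OF \<sigma>']]
  obtain m :: nat and P \<xi> where 1: "\<forall>l<m. psd d (\<xi> l)"
    "\<forall>a<r. \<forall>x<s. \<forall>l<m. 0 \<le> P a x l" "\<forall>x<s. \<forall>l<m. (\<Sum>a<r. P a x l) = 1"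
    "\<forall>a<r. \<forall>x<s. \<sigma> a x = mat_sum d d {..<m} (\<lambda>l. complex_of_real (P a x l) \<cdot>\<^sub>m \<xi> l)"
    "(\<Sum>l<m. Re (mat_trace (\<xi> l))) = 1"
    by (rule LHS_E[OF \<sigma>])
  note 1 = 1[rule_format]
  obtain m' :: nat and P' \<xi>' where 2: "\<forall>l<m'. psd d (\<xi>' l)"
    "\<forall>a<r. \<forall>x<s. \<forall>l<m'. 0 \<le> P' a x l" "\<forall>x<s. \<forall>l<m'. (\<Sum>a<r. P' a x l) = 1"
    "\<forall>a<r. \<forall>x<s. \<sigma>' a x = mat_sum d d {..<m'} (\<lambda>l. complex_of_real (P' a x l) \<cdot>\<^sub>m \<xi>' l)"
    "(\<Sum>l<m'. Re (mat_trace (\<xi>' l))) = 1"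
    by (rule LHS_E[OF \<sigma>'])
  note 2 = 2[rule_format]
  \<comment> \<open>The hidden variable of the mixture also records which of the two models is in
    use; \<open>Inl\<close> carries weight \<open>\<mu>\<close> and \<open>Inr\<close> the
    complement.\<close>
  let ?I = "{..<m} <+> {..<m'}"
  define \<zeta> where "\<zeta> = (\<lambda>i. case i of Inl l \<Rightarrow> complex_of_real \<mu> \<cdot>\<^sub>m \<xi> l | Inr l \<Rightarrow> complex_of_real (1 - \<mu>) \<cdot>\<^sub>m \<xi>' l)"
  define W where "W = (\<lambda>a x i. case i of Inl l \<Rightarrow> P a x l | Inr l \<Rightarrow> P' a x l)"
  show ?thesis
  proof (rule LHS_I[OF is_assemblageD(1,2,3)[OF sa], where I = ?I and \<xi> = \<zeta> and P = W])
    show "psd d (\<zeta> i)" if "i \<in> ?I" for i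
    proof (cases i)
      case (Inl l)
      then show ?thesis using psd_smult[OF 1(1)[of l] \<mu>(1)] that by (auto simp: \<zeta>_def)
    next
      case (Inr l)
      then show ?thesis using psd_smult[OF 2(1)[of l], of "1 - \<mu>"] that \<mu> by (auto simp: \<zeta>_def)
    qed
    show "0 \<le> W a x i" if "a < r" "x < s" "i \<in> ?I" for a x i
      using that 1(2) 2(2) unfolding W_def by auto
    show "(\<Sum>a<r. W a x i) = 1" if "x < s" "i \<in> ?I" for x i
      using that 1(3) 2(3) unfolding W_def by auto
    show "mix \<mu> \<sigma> \<sigma>' a x = mat_sum d d ?I (\<lambda>i. complex_of_real (W a x i) \<cdot>\<^sub>m \<zeta> i)" if ax: "a < r" "x < s" for a x
      unfolding asm_add_def asm_scale_def 1(4)[OF ax] 2(4)[OF ax]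
      using carrier_matD[OF psdD(1)[OF 1(1)]] carrier_matD[OF psdD(1)[OF 2(1)]]
      by (intro eq_matI) (auto simp: sum.Plus W_def \<zeta>_def sum_distrib_left mult_ac intro!: arg_cong2[of _ _ _ _ "(+)"] sum.cong)
    show "mix \<mu> \<sigma> \<sigma>' a x = 0\<^sub>m d d" if "\<not> (a < r \<and> x < s)" for a x
      using is_assemblageD(5)[OF sa that] is_assemblageD(5)[OF sa' that]
      by (auto simp: asm_add_def asm_scale_def intro!: eq_matI)
    have "(\<Sum>i\<in>?I. Re (mat_trace (\<zeta> i))) = \<mu> * (\<Sum>l<m. Re (mat_trace (\<xi> l))) + (1 - \<mu>) * (\<Sum>l<m'. Re (mat_trace (\<xi>' l)))"
      by (simp add: sum.Plus \<zeta>_def trace_smult[OF psdD(1)[OF 1(1)]] trace_smult[OF psdD(1)[OF 2(1)]] sum_distrib_left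
          del: of_real_diff)
    then show "(\<Sum>i\<in>?I. Re (mat_trace (\<zeta> i))) = 1" using 1(5) 2(5) by simp
  qed simp
qed

lemma asm_value_mix_le:
  assumes \<rho>: "\<rho> \<in> normalised_assemblages d r s" and \<rho>': "\<rho>' \<in> normalised_assemblages d r s"
    and \<sigma>: "\<sigma> \<in> normalised_assemblages d r s" and \<sigma>': "\<sigma>' \<in> normalised_assemblages d r s"
    and m: "is_measurement d d s g E P" and \<mu>: "0 \<le> \<mu>" "\<mu> \<le> 1"
  shows "asm_value d r s g E P (mix \<mu> \<rho> \<rho>') (mix \<mu> \<sigma> \<sigma>') \<le>
    ennreal \<mu> * asm_value d r s g E P \<rho> \<sigma> + ennreal (1 - \<mu>) * asm_value d r s g E P \<rho>' \<sigma>'"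
proof -
  note ra = normalisedD(1)[OF \<rho>] and ra' = normalisedD(1)[OF \<rho>'] and sa = normalisedD(1)[OF \<sigma>] and sa' = normalisedD(1)[OF \<sigma>']
  define D where "D = (\<lambda>(\<rho> :: assemblage) (\<sigma> :: assemblage) \<gamma> x a. divergence d (E \<gamma> * \<rho> a x * (E \<gamma>)\<^sup>\<dagger>) (E \<gamma> * \<sigma> a x * (E \<gamma>)\<^sup>\<dagger>))"
  have cong: "E \<gamma> * mix \<mu> \<tau> \<tau>' a x * (E \<gamma>)\<^sup>\<dagger> = mat_sum d d UNIV (\<lambda>b. complex_of_real (if b then \<mu> else 1 - \<mu>) \<cdot>\<^sub>m
      (E \<gamma> * (if b then \<tau> a x else \<tau>' a x) * (E \<gamma>)\<^sup>\<dagger>))"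
    if "is_assemblage d r s \<tau>" "is_assemblage d r s \<tau>'" "\<gamma> < g" for \<tau> \<tau>' \<gamma> a x
  proof -
    note c = is_assemblageD(7)[OF that(1), of a x] is_assemblageD(7)[OF that(2), of a x] and E = is_measurementD(1)[OF m that(3)]
    have cb: "(if b then \<tau> a x else \<tau>' a x) \<in> carrier_mat d d" for b using c by auto
    then have "complex_of_real (if b then \<mu> else 1 - \<mu>) \<cdot>\<^sub>m (if b then \<tau> a x else \<tau>' a x) \<in> carrier_mat d d" for b by simp
    then show ?thesis
      unfolding mix_eq_mat_sum[where \<rho> = \<tau> and \<rho>' = \<tau>' and a = a and x = x, OF c] congruence_smult[OF E cb, symmetric] by (rule congruence_mat_sum[OF E])
  qed
  have step: "D (mix \<mu> \<rho> \<rho>') (mix \<mu> \<sigma> \<sigma>') \<gamma> x a \<le> ennreal \<mu> * D \<rho> \<sigma> \<gamma> x a + ennreal (1 - \<mu>) * D \<rho>' \<sigma>' \<gamma> x a"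
    if *: "\<gamma> < g" "x < s" "a < r" for \<gamma> x a
  proof -
    note E = is_measurementD(1)[OF m *(1)]
    have psd: "psd d (E \<gamma> * (if b then \<rho> a x else \<rho>' a x) * (E \<gamma>)\<^sup>\<dagger>)" "psd d (E \<gamma> * (if b then \<sigma> a x else \<sigma>' a x) * (E \<gamma>)\<^sup>\<dagger>)" for b
      using psd_congruence[OF is_assemblageD(4)[OF ra *(3,2)] E] psd_congruence[OF is_assemblageD(4)[OF ra' *(3,2)] E]
        psd_congruence[OF is_assemblageD(4)[OF sa *(3,2)] E] psd_congruence[OF is_assemblageD(4)[OF sa' *(3,2)] E] by auto
    have "D (mix \<mu> \<rho> \<rho>') (mix \<mu> \<sigma> \<sigma>') \<gamma> x a \<le> (\<Sum>b\<in>UNIV. ennreal (if b then \<mu> else 1 - \<mu>) *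
        divergence d (E \<gamma> * (if b then \<rho> a x else \<rho>' a x) * (E \<gamma>)\<^sup>\<dagger>) (E \<gamma> * (if b then \<sigma> a x else \<sigma>' a x) * (E \<gamma>)\<^sup>\<dagger>))"
      unfolding D_def cong[OF ra ra' *(1)] cong[OF sa sa' *(1)]
      by (rule divergence_weighted_sum_le) (use psd \<mu> in auto)
    then show ?thesis by (simp add: UNIV_bool D_def add.commute)
  qed
  have "asm_value d r s g E P (mix \<mu> \<rho> \<rho>') (mix \<mu> \<sigma> \<sigma>') \<le>
      (\<Sum>\<gamma><g. \<Sum>x<s. \<Sum>a<r. ennreal (P x \<gamma>) * (ennreal \<mu> * D \<rho> \<sigma> \<gamma> x a + ennreal (1 - \<mu>) * D \<rho>' \<sigma>' \<gamma> x a))"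
    unfolding asm_value_def D_def by (intro sum_mono mult_left_mono step[unfolded D_def]) auto
  also have "\<dots> = ennreal \<mu> * asm_value d r s g E P \<rho> \<sigma> + ennreal (1 - \<mu>) * asm_value d r s g E P \<rho>' \<sigma>'"
    unfolding asm_value_def D_def by (simp add: distrib_left sum.distrib sum_distrib_left mult_ac)
  finally show ?thesis .
qed

text \<open>The mixture of two optimal unsteerable assemblages competes in the minimum for the
  mixture. For each measurement joint convexity bounds its value by the weighted two minima, and the
  bound passes to the supremum.\<close>

lemma S_R_convex:
  assumes \<rho>: "\<rho> \<in> normalised_assemblages d r s" and \<rho>': "\<rho>' \<in> normalised_assemblages d r s"
    and \<mu>: "0 \<le> \<mu>" "\<mu> \<le> 1"
  shows "real_of_ereal (S_R d r s (mix \<mu> \<rho> \<rho>')) \<le> \<mu> * real_of_ereal (S_R d r s \<rho>) + (1 - \<mu>) * real_of_ereal (S_R d r s \<rho>')"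
proof -
  note nm = mix_normalised[OF \<rho> \<rho>' \<mu>]
  obtain \<sigma> where \<sigma>: "\<sigma> \<in> LHS d r s" "S_R d r s \<rho> = S_A d r s \<rho> \<sigma>" by (rule S_R_attained[OF \<rho>])
  obtain \<sigma>' where \<sigma>': "\<sigma>' \<in> LHS d r s" "S_R d r s \<rho>' = S_A d r s \<rho>' \<sigma>'" by (rule S_R_attained[OF \<rho>'])
  obtain y where y: "S_R d r s \<rho> = ereal y" by (rule S_R_finite[OF \<rho>])
  obtain y' where y': "S_R d r s \<rho>' = ereal y'" by (rule S_R_finite[OF \<rho>'])
  obtain z where z: "S_R d r s (mix \<mu> \<rho> \<rho>') = ereal z" by (rule S_R_finite[OF nm])
  note n = LHS_normalised[OF \<sigma>(1)] LHS_normalised[OF \<sigma>'(1)]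
  have "ereal z \<le> S_A d r s (mix \<mu> \<rho> \<rho>') (mix \<mu> \<sigma> \<sigma>')"
    unfolding z[symmetric] S_R_def by (rule INF_lower[OF mix_LHS[OF \<sigma>(1) \<sigma>'(1) \<mu>]])
  also have "\<dots> \<le> ereal (\<mu> * y + (1 - \<mu>) * y')"
  proof (rule S_A_least[OF nm mix_normalised[OF n \<mu>]])
    fix g E P assume m: "is_measurement d d s g E P"
    have 1: "enn2ereal (asm_value d r s g E P \<rho> \<sigma>) \<le> ereal y"
      using S_A_upper[OF \<rho> n(1) m] \<sigma>(2) y by simp
    have 2: "enn2ereal (asm_value d r s g E P \<rho>' \<sigma>') \<le> ereal y'"
      using S_A_upper[OF \<rho>' n(2) m] \<sigma>'(2) y' by simp
    have "enn2ereal (asm_value d r s g E P (mix \<mu> \<rho> \<rho>') (mix \<mu> \<sigma> \<sigma>')) \<le>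
        ereal \<mu> * enn2ereal (asm_value d r s g E P \<rho> \<sigma>) + ereal (1 - \<mu>) * enn2ereal (asm_value d r s g E P \<rho>' \<sigma>')"
      using asm_value_mix_le[OF \<rho> \<rho>' n m \<mu>] \<mu>
      by (simp add: less_eq_ennreal.rep_eq plus_ennreal.rep_eq times_ennreal.rep_eq)
    also have "\<dots> \<le> ereal \<mu> * ereal y + ereal (1 - \<mu>) * ereal y'"
      using \<mu> by (intro add_mono ereal_mult_left_mono 1 2) auto
    finally show "enn2ereal (asm_value d r s g E P (mix \<mu> \<rho> \<rho>') (mix \<mu> \<sigma> \<sigma>')) \<le> ereal (\<mu> * y + (1 - \<mu>) * y')" by simp
  qed
  finally show ?thesis unfolding y y' z by simp
qed

section \<open>Monotonicity under one-way LOCCs\<close>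

locale one_way_locc =
  fixes d r s d\<^sub>f r\<^sub>f s\<^sub>f n :: nat and K :: "nat \<Rightarrow> complex mat"
    and P :: "nat \<Rightarrow> nat \<Rightarrow> nat \<Rightarrow> real" and Q :: "nat \<Rightarrow> nat \<Rightarrow> nat \<Rightarrow> nat \<Rightarrow> nat \<Rightarrow> real"
  assumes locc: "is_locc d r s d\<^sub>f r\<^sub>f s\<^sub>f n K P Q"
begin

lemma dims: "1 \<le> d" "1 \<le> r" "1 \<le> s" "1 \<le> d\<^sub>f" "1 \<le> r\<^sub>f" "1 \<le> s\<^sub>f"
  using locc by (auto simp: is_locc_def)

lemma K: "\<omega> < n \<Longrightarrow> K \<omega> \<in> carrier_mat d\<^sub>f d"
  and K_sum: "mat_sum d d {..<n} (\<lambda>\<omega>. (K \<omega>)\<^sup>\<dagger> * K \<omega>) = 1\<^sub>m d"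
  using locc by (auto simp: is_locc_def)

lemma P: "\<omega> < n \<Longrightarrow> x\<^sub>f < s\<^sub>f \<Longrightarrow> x < s \<Longrightarrow> 0 \<le> P x x\<^sub>f \<omega>" "\<omega> < n \<Longrightarrow> x\<^sub>f < s\<^sub>f \<Longrightarrow> (\<Sum>x<s. P x x\<^sub>f \<omega>) = 1"
  using locc by (auto simp: is_locc_def prob_dist_def)

lemma Q: "\<omega> < n \<Longrightarrow> x\<^sub>f < s\<^sub>f \<Longrightarrow> a < r \<Longrightarrow> x < s \<Longrightarrow> a\<^sub>f < r\<^sub>f \<Longrightarrow> 0 \<le> Q a\<^sub>f a x \<omega> x\<^sub>f"
  "\<omega> < n \<Longrightarrow> x\<^sub>f < s\<^sub>f \<Longrightarrow> a < r \<Longrightarrow> x < s \<Longrightarrow> (\<Sum>a\<^sub>f<r\<^sub>f. Q a\<^sub>f a x \<omega> x\<^sub>f) = 1"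
  using locc by (auto simp: is_locc_def prob_dist_def)

abbreviation branch :: "nat \<Rightarrow> assemblage \<Rightarrow> assemblage" where
  "branch \<equiv> locc_branch r s d\<^sub>f r\<^sub>f s\<^sub>f K P Q"

lemma branch_eq:
  assumes "a\<^sub>f < r\<^sub>f" "x\<^sub>f < s\<^sub>f"
  shows "branch \<omega> \<rho> a\<^sub>f x\<^sub>f = mat_sum d\<^sub>f d\<^sub>f ({..<r} \<times> {..<s})
    (\<lambda>k. complex_of_real (P (snd k) x\<^sub>f \<omega> * Q a\<^sub>f (fst k) (snd k) \<omega> x\<^sub>f) \<cdot>\<^sub>m
      (K \<omega> * \<rho> (fst k) (snd k) * (K \<omega>)\<^sup>\<dagger>))"
  using assms by (simp add: locc_branch_def case_prod_unfold)

lemma K_rho_carrier: "is_assemblage d r s \<rho> \<Longrightarrow> \<omega> < n \<Longrightarrow> K \<omega> * \<rho> a x * (K \<omega>)\<^sup>\<dagger> \<in> carrier_mat d\<^sub>f d\<^sub>f"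
  using mult_carrier_mat[OF mult_carrier_mat[OF K is_assemblageD(7)] adjoint_carrier[OF K]] by blast

text \<open>Summing over the final output removes \<open>Q\<close>. No-signaling of
  \<open>\<rho>\<close> then makes the sum over \<open>a\<close> independent of \<open>x\<close>, so
  the input weights \<open>P\<close> sum to 1 as well.\<close>

lemma branch_marginal:
  assumes \<rho>: "is_assemblage d r s \<rho>" and \<omega>: "\<omega> < n" and xf: "x\<^sub>f < s\<^sub>f"
  shows "mat_sum d\<^sub>f d\<^sub>f {..<r\<^sub>f} (\<lambda>a\<^sub>f. branch \<omega> \<rho> a\<^sub>f x\<^sub>f) = K \<omega> * rho_B d r \<rho> * (K \<omega>)\<^sup>\<dagger>"
proof (rule eq_matI)
  note c = K_rho_carrier[OF \<rho> \<omega>]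
  fix i j assume "i < dim_row (K \<omega> * rho_B d r \<rho> * (K \<omega>)\<^sup>\<dagger>)" "j < dim_col (K \<omega> * rho_B d r \<rho> * (K \<omega>)\<^sup>\<dagger>)"
  then have ij: "i < d\<^sub>f" "j < d\<^sub>f" using K[OF \<omega>] by auto
  have R: "(\<Sum>a<r. (K \<omega> * \<rho> a x * (K \<omega>)\<^sup>\<dagger>) $$ (i, j)) = (K \<omega> * rho_B d r \<rho> * (K \<omega>)\<^sup>\<dagger>) $$ (i, j)" if x: "x < s" for x
    unfolding is_assemblageD(6)[OF \<rho> x, symmetric] congruence_mat_sum[OF K[OF \<omega>] is_assemblageD(7)[OF \<rho>]]
    using ij by simp
  have "mat_sum d\<^sub>f d\<^sub>f {..<r\<^sub>f} (\<lambda>a\<^sub>f. branch \<omega> \<rho> a\<^sub>f x\<^sub>f) $$ (i, j) = (\<Sum>a\<^sub>f<r\<^sub>f. branch \<omega> \<rho> a\<^sub>f x\<^sub>f $$ (i, j))"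
    using ij by simp
  also have "\<dots> = (\<Sum>a\<^sub>f<r\<^sub>f. \<Sum>k\<in>{..<r} \<times> {..<s}. complex_of_real (P (snd k) x\<^sub>f \<omega>) *
      (K \<omega> * \<rho> (fst k) (snd k) * (K \<omega>)\<^sup>\<dagger>) $$ (i, j) * complex_of_real (Q a\<^sub>f (fst k) (snd k) \<omega> x\<^sub>f))"
  proof (rule sum.cong[OF refl])
    fix a\<^sub>f assume "a\<^sub>f \<in> {..<r\<^sub>f}"
    then have af: "a\<^sub>f < r\<^sub>f" by simp
    show "branch \<omega> \<rho> a\<^sub>f x\<^sub>f $$ (i, j) = (\<Sum>k\<in>{..<r} \<times> {..<s}. complex_of_real (P (snd k) x\<^sub>f \<omega>) *
      (K \<omega> * \<rho> (fst k) (snd k) * (K \<omega>)\<^sup>\<dagger>) $$ (i, j) * complex_of_real (Q a\<^sub>f (fst k) (snd k) \<omega> x\<^sub>f))"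
      unfolding branch_eq[OF af xf] mat_sum_index[OF ij]
      using carrier_matD[OF c] ij by (intro sum.cong refl) (simp del: index_mult_mat(1))
  qed
  also have "\<dots> = (\<Sum>k\<in>{..<r} \<times> {..<s}. complex_of_real (P (snd k) x\<^sub>f \<omega>) *
      (K \<omega> * \<rho> (fst k) (snd k) * (K \<omega>)\<^sup>\<dagger>) $$ (i, j) * complex_of_real (\<Sum>a\<^sub>f<r\<^sub>f. Q a\<^sub>f (fst k) (snd k) \<omega> x\<^sub>f))"
    unfolding of_real_sum sum_distrib_left by (rule sum.swap)
  also have "\<dots> = (\<Sum>k\<in>{..<r} \<times> {..<s}. complex_of_real (P (snd k) x\<^sub>f \<omega>) *
      (K \<omega> * \<rho> (fst k) (snd k) * (K \<omega>)\<^sup>\<dagger>) $$ (i, j))"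
    by (intro sum.cong refl) (use Q(2)[OF \<omega> xf] in \<open>auto simp del: index_mult_mat(1) of_real_sum\<close>)
  also have "\<dots> = (\<Sum>a<r. \<Sum>x<s. complex_of_real (P x x\<^sub>f \<omega>) * (K \<omega> * \<rho> a x * (K \<omega>)\<^sup>\<dagger>) $$ (i, j))"
    unfolding sum.cartesian_product by (simp add: case_prod_beta del: index_mult_mat(1))
  also have "\<dots> = (\<Sum>x<s. complex_of_real (P x x\<^sub>f \<omega>) * (\<Sum>a<r. (K \<omega> * \<rho> a x * (K \<omega>)\<^sup>\<dagger>) $$ (i, j)))"
    by (subst sum.swap) (simp only: sum_distrib_left)
  also have "\<dots> = (\<Sum>x<s. complex_of_real (P x x\<^sub>f \<omega>) * (K \<omega> * rho_B d r \<rho> * (K \<omega>)\<^sup>\<dagger>) $$ (i, j))"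
    by (intro sum.cong refl) (simp only: R lessThan_iff)
  also have "\<dots> = complex_of_real (\<Sum>x<s. P x x\<^sub>f \<omega>) * (K \<omega> * rho_B d r \<rho> * (K \<omega>)\<^sup>\<dagger>) $$ (i, j)"
    by (simp only: of_real_sum sum_distrib_right)
  also have "\<dots> = (K \<omega> * rho_B d r \<rho> * (K \<omega>)\<^sup>\<dagger>) $$ (i, j)" by (simp only: P(2)[OF \<omega> xf] of_real_1 mult_1)
  finally show "mat_sum d\<^sub>f d\<^sub>f {..<r\<^sub>f} (\<lambda>a\<^sub>f. branch \<omega> \<rho> a\<^sub>f x\<^sub>f) $$ (i, j) = (K \<omega> * rho_B d r \<rho> * (K \<omega>)\<^sup>\<dagger>) $$ (i, j)" .
qed (use K[of \<omega>] \<omega> in auto)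

lemma branch_assemblage:
  assumes \<rho>: "is_assemblage d r s \<rho>" and \<omega>: "\<omega> < n"
  shows "is_assemblage d\<^sub>f r\<^sub>f s\<^sub>f (branch \<omega> \<rho>)"
  unfolding is_assemblage_def
proof (intro conjI allI impI dims)
  show "psd d\<^sub>f (branch \<omega> \<rho> a\<^sub>f x\<^sub>f)" if af: "a\<^sub>f < r\<^sub>f" and xf: "x\<^sub>f < s\<^sub>f" for a\<^sub>f x\<^sub>f
    unfolding branch_eq[OF af xf]
  proof (intro psd_mat_sum psd_smult)
    fix k assume "k \<in> {..<r} \<times> {..<s}"
    then have k: "fst k < r" "snd k < s" by auto
    show "psd d\<^sub>f (K \<omega> * \<rho> (fst k) (snd k) * (K \<omega>)\<^sup>\<dagger>)" by (rule psd_congruence[OF is_assemblageD(4)[OF \<rho> k] K[OF \<omega>]])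
    show "0 \<le> P (snd k) x\<^sub>f \<omega> * Q a\<^sub>f (fst k) (snd k) \<omega> x\<^sub>f" using P(1)[OF \<omega> xf k(2)] Q(1)[OF \<omega> xf k af] by simp
  qed
  show "branch \<omega> \<rho> a\<^sub>f x\<^sub>f = 0\<^sub>m d\<^sub>f d\<^sub>f" if "\<not> (a\<^sub>f < r\<^sub>f \<and> x\<^sub>f < s\<^sub>f)" for a\<^sub>f x\<^sub>f
    using that by (auto simp: locc_branch_def)
qed (simp add: branch_marginal[OF \<rho> \<omega>])

lemma branch_rho_B:
  assumes "is_assemblage d r s \<rho>" "\<omega> < n"
  shows "rho_B d\<^sub>f r\<^sub>f (branch \<omega> \<rho>) = K \<omega> * rho_B d r \<rho> * (K \<omega>)\<^sup>\<dagger>"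
  unfolding rho_B_def[of d\<^sub>f] by (rule branch_marginal[OF assms]) (use dims in auto)

abbreviation weight :: "assemblage \<Rightarrow> nat \<Rightarrow> real" where
  "weight \<rho> \<omega> \<equiv> asm_trace d\<^sub>f r\<^sub>f (branch \<omega> \<rho>)"

lemma weight_eq:
  assumes \<rho>: "is_assemblage d r s \<rho>" and \<omega>: "\<omega> < n"
  shows "weight \<rho> \<omega> = (\<Sum>a<r. Re (mat_trace (K \<omega> * \<rho> a 0 * (K \<omega>)\<^sup>\<dagger>)))" "0 \<le> weight \<rho> \<omega>"
proof -
  have 0: "0 < s" using dims by simp
  have "weight \<rho> \<omega> = P_Gamma d r K \<rho> \<omega>"
    unfolding asm_trace_def branch_rho_B[OF assms] P_Gamma_def ..
  also have "\<dots> = (\<Sum>a<r. Re (mat_trace (K \<omega> * \<rho> a 0 * (K \<omega>)\<^sup>\<dagger>)))"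
    by (rule P_Gamma_eq[where E = K and \<gamma> = \<omega>, OF \<rho> 0 K[OF \<omega>]])
  finally show *: "weight \<rho> \<omega> = (\<Sum>a<r. Re (mat_trace (K \<omega> * \<rho> a 0 * (K \<omega>)\<^sup>\<dagger>)))" .
  show "0 \<le> weight \<rho> \<omega>"
    unfolding * by (intro sum_nonneg psd_trace(2)[OF psd_congruence[OF is_assemblageD(4)[OF \<rho> _ 0] K[OF \<omega>]]]) simp
qed

lemma sum_weight:
  assumes \<rho>: "\<rho> \<in> normalised_assemblages d r s"
  shows "(\<Sum>\<omega><n. weight \<rho> \<omega>) = 1"
proof -
  have "(\<Sum>\<omega><n. weight \<rho> \<omega>) = (\<Sum>\<omega><n. Re (mat_trace (K \<omega> * rho_B d r \<rho> * (K \<omega>)\<^sup>\<dagger>)))"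
    by (intro sum.cong refl) (simp add: asm_trace_def branch_rho_B[OF normalisedD(1)[OF \<rho>]])
  also have "\<dots> = Re (mat_trace (rho_B d r \<rho>))"
    unfolding Re_sum[symmetric] by (subst trace_kraus[OF K K_sum]) (auto simp: rho_B_def)
  finally show ?thesis using normalisedD(2)[OF \<rho>] by simp
qed

lemma branch_normalised:
  assumes \<rho>: "is_assemblage d r s \<rho>" and \<omega>: "\<omega> < n" and p: "0 < weight \<rho> \<omega>"
  shows "asm_scale (1 / weight \<rho> \<omega>) (branch \<omega> \<rho>) \<in> normalised_assemblages d\<^sub>f r\<^sub>f s\<^sub>f"
proof -
  let ?c = "1 / weight \<rho> \<omega>" and ?M = "branch \<omega> \<rho>"
  note M = branch_assemblage[OF \<rho> \<omega>]
  have marg: "mat_sum d\<^sub>f d\<^sub>f {..<r\<^sub>f} (\<lambda>a. asm_scale ?c ?M a x) = complex_of_real ?c \<cdot>\<^sub>m rho_B d\<^sub>f r\<^sub>f ?M" if x: "x < s\<^sub>f" for x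
    unfolding is_assemblageD(6)[OF M x, symmetric] asm_scale_def
    using carrier_matD[OF is_assemblageD(7)[OF M]] by (intro eq_matI) (auto simp: sum_distrib_left)
  have "is_assemblage d\<^sub>f r\<^sub>f s\<^sub>f (asm_scale ?c ?M)"
    unfolding is_assemblage_def
  proof (intro conjI allI impI dims)
    show "psd d\<^sub>f (asm_scale ?c ?M a x)" if "a < r\<^sub>f" "x < s\<^sub>f" for a x
      unfolding asm_scale_def by (rule psd_smult[OF is_assemblageD(4)[OF M that]]) (use p in simp)
    show "asm_scale ?c ?M a x = 0\<^sub>m d\<^sub>f d\<^sub>f" if "\<not> (a < r\<^sub>f \<and> x < s\<^sub>f)" for a x
      unfolding asm_scale_def is_assemblageD(5)[OF M that] by auto
  qed (simp add: marg)
  moreover have "asm_trace d\<^sub>f r\<^sub>f (asm_scale ?c ?M) = 1"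
  proof -
    have c: "rho_B d\<^sub>f r\<^sub>f ?M \<in> carrier_mat d\<^sub>f d\<^sub>f" by (simp add: rho_B_def)
    have "rho_B d\<^sub>f r\<^sub>f (asm_scale ?c ?M) = complex_of_real ?c \<cdot>\<^sub>m rho_B d\<^sub>f r\<^sub>f ?M"
      unfolding rho_B_def[of d\<^sub>f r\<^sub>f "asm_scale ?c ?M"] by (rule marg) (use dims in simp)
    then have "asm_trace d\<^sub>f r\<^sub>f (asm_scale ?c ?M) = ?c * weight \<rho> \<omega>"
      unfolding asm_trace_def[of d\<^sub>f r\<^sub>f "asm_scale ?c ?M"] by (simp add: trace_smult[OF c] asm_trace_def)
    then show ?thesis using p by simp
  qed
  ultimately show ?thesis by (simp add: normalised_assemblages_def)
qed

text \<open>The hidden variable keeps its range. Its unnormalised states are conjugated by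
  \<open>K \<omega>\<close> and divided by the probability of \<open>\<omega>\<close>, and the
  classical wiring is absorbed into the response function.\<close>

lemma branch_LHS:
  assumes \<sigma>: "\<sigma> \<in> LHS d r s" and \<omega>: "\<omega> < n" and q: "0 < weight \<sigma> \<omega>"
  shows "asm_scale (1 / weight \<sigma> \<omega>) (branch \<omega> \<sigma>) \<in> LHS d\<^sub>f r\<^sub>f s\<^sub>f"
proof -
  note sa = normalisedD(1)[OF LHS_normalised[OF \<sigma>]]
  let ?q = "weight \<sigma> \<omega>"
  obtain m :: nat and R \<xi> where *: "\<forall>l<m. psd d (\<xi> l)"
    "\<forall>a<r. \<forall>x<s. \<forall>l<m. 0 \<le> R a x l" "\<forall>x<s. \<forall>l<m. (\<Sum>a<r. R a x l) = 1"
    "\<forall>a<r. \<forall>x<s. \<sigma> a x = mat_sum d d {..<m} (\<lambda>l. complex_of_real (R a x l) \<cdot>\<^sub>m \<xi> l)"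
    "(\<Sum>l<m. Re (mat_trace (\<xi> l))) = 1"
    by (rule LHS_E[OF \<sigma>])
  note \<xi> = *(1)[rule_format] and R0 = *(2)[rule_format] and R1 = *(3)[rule_format] and \<sigma>_eq = *(4)[rule_format]
  have K\<xi>: "psd d\<^sub>f (K \<omega> * \<xi> l * (K \<omega>)\<^sup>\<dagger>)" if "l < m" for l by (rule psd_congruence[OF \<xi>[OF that] K[OF \<omega>]])
  define \<zeta> where "\<zeta> = (\<lambda>l. complex_of_real (1 / ?q) \<cdot>\<^sub>m (K \<omega> * \<xi> l * (K \<omega>)\<^sup>\<dagger>))"
  \<comment> \<open>The response to the final input, given \<open>l\<close>: draw an input from
    \<open>P\<close>, answer by \<open>R\<close>, then process the answer by
    \<open>Q\<close>.\<close>
  define W where "W = (\<lambda>a\<^sub>f x\<^sub>f l. \<Sum>k\<in>{..<r} \<times> {..<s}.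
      P (snd k) x\<^sub>f \<omega> * Q a\<^sub>f (fst k) (snd k) \<omega> x\<^sub>f * R (fst k) (snd k) l)"
  have K\<sigma>: "K \<omega> * \<sigma> a x * (K \<omega>)\<^sup>\<dagger> = mat_sum d\<^sub>f d\<^sub>f {..<m} (\<lambda>l. complex_of_real (R a x l) \<cdot>\<^sub>m (K \<omega> * \<xi> l * (K \<omega>)\<^sup>\<dagger>))"
    if ax: "a < r" "x < s" for a x
  proof -
    have "K \<omega> * \<sigma> a x * (K \<omega>)\<^sup>\<dagger> = mat_sum d\<^sub>f d\<^sub>f {..<m} (\<lambda>l. K \<omega> * (complex_of_real (R a x l) \<cdot>\<^sub>m \<xi> l) * (K \<omega>)\<^sup>\<dagger>)"
      unfolding \<sigma>_eq[OF ax] by (rule congruence_mat_sum[OF K[OF \<omega>]]) (use psdD(1)[OF \<xi>] in auto)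
    also have "\<dots> = mat_sum d\<^sub>f d\<^sub>f {..<m} (\<lambda>l. complex_of_real (R a x l) \<cdot>\<^sub>m (K \<omega> * \<xi> l * (K \<omega>)\<^sup>\<dagger>))"
      by (rule mat_sum_cong[OF refl], rule congruence_smult[OF K[OF \<omega>] psdD(1)[OF \<xi>]]) simp
    finally show ?thesis .
  qed
  show ?thesis
  proof (rule LHS_I[OF dims(4-6), where I = "{..<m}" and \<xi> = \<zeta> and P = W])
    show "psd d\<^sub>f (\<zeta> l)" if "l \<in> {..<m}" for l
      unfolding \<zeta>_def by (rule psd_smult[OF K\<xi>]) (use that q in auto)
    show "0 \<le> W a\<^sub>f x\<^sub>f l" if "a\<^sub>f < r\<^sub>f" "x\<^sub>f < s\<^sub>f" "l \<in> {..<m}" for a\<^sub>f x\<^sub>f l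
      unfolding W_def using that P(1)[OF \<omega> that(2)] Q(1)[OF \<omega> that(2) _ _ that(1)] R0
      by (intro sum_nonneg mult_nonneg_nonneg) auto
    show "(\<Sum>a\<^sub>f<r\<^sub>f. W a\<^sub>f x\<^sub>f l) = 1" if xf: "x\<^sub>f < s\<^sub>f" and l: "l \<in> {..<m}" for x\<^sub>f l
    proof -
      have "(\<Sum>a\<^sub>f<r\<^sub>f. W a\<^sub>f x\<^sub>f l) = (\<Sum>k\<in>{..<r} \<times> {..<s}. P (snd k) x\<^sub>f \<omega> * R (fst k) (snd k) l * (\<Sum>a\<^sub>f<r\<^sub>f. Q a\<^sub>f (fst k) (snd k) \<omega> x\<^sub>f))"
        unfolding W_def by (subst sum.swap) (simp add: sum_distrib_left mult_ac)
      also have "\<dots> = (\<Sum>k\<in>{..<r} \<times> {..<s}. P (snd k) x\<^sub>f \<omega> * R (fst k) (snd k) l)"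
        by (intro sum.cong refl) (use Q(2)[OF \<omega> xf] in auto)
      also have "\<dots> = (\<Sum>a<r. \<Sum>x<s. P x x\<^sub>f \<omega> * R a x l)"
        unfolding sum.cartesian_product by (simp add: case_prod_beta)
      also have "\<dots> = (\<Sum>x<s. P x x\<^sub>f \<omega> * (\<Sum>a<r. R a x l))"
        by (subst sum.swap) (simp only: sum_distrib_left)
      also have "\<dots> = (\<Sum>x<s. P x x\<^sub>f \<omega>)" using l by (intro sum.cong refl) (simp add: R1)
      finally show ?thesis unfolding P(2)[OF \<omega> xf] .
    qed
    show "asm_scale (1 / ?q) (branch \<omega> \<sigma>) a\<^sub>f x\<^sub>f = mat_sum d\<^sub>f d\<^sub>f {..<m} (\<lambda>l. complex_of_real (W a\<^sub>f x\<^sub>f l) \<cdot>\<^sub>m \<zeta> l)"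
      if af: "a\<^sub>f < r\<^sub>f" and xf: "x\<^sub>f < s\<^sub>f" for a\<^sub>f x\<^sub>f
    proof (rule eq_matI)
      fix i j assume "i < dim_row (mat_sum d\<^sub>f d\<^sub>f {..<m} (\<lambda>l. complex_of_real (W a\<^sub>f x\<^sub>f l) \<cdot>\<^sub>m \<zeta> l))"
        "j < dim_col (mat_sum d\<^sub>f d\<^sub>f {..<m} (\<lambda>l. complex_of_real (W a\<^sub>f x\<^sub>f l) \<cdot>\<^sub>m \<zeta> l))"
      then have ij: "i < d\<^sub>f" "j < d\<^sub>f" by auto
      define z where "z = (\<lambda>l. (K \<omega> * \<xi> l * (K \<omega>)\<^sup>\<dagger>) $$ (i, j))"
      have zl: "(complex_of_real c \<cdot>\<^sub>m (K \<omega> * \<xi> l * (K \<omega>)\<^sup>\<dagger>)) $$ (i, j) = complex_of_real c * z l" if "l < m" for c l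
        using carrier_matD[OF psdD(1)[OF K\<xi>[OF that]]] ij by (simp add: z_def del: index_mult_mat(1))
      have zk: "(K \<omega> * \<sigma> a x * (K \<omega>)\<^sup>\<dagger>) $$ (i, j) = (\<Sum>l<m. complex_of_real (R a x l) * z l)" if "a < r" "x < s" for a x
        unfolding K\<sigma>[OF that] mat_sum_index[OF ij] by (intro sum.cong refl) (simp only: zl lessThan_iff)
      have \<zeta>l: "(complex_of_real c \<cdot>\<^sub>m \<zeta> l) $$ (i, j) = complex_of_real c * (complex_of_real (1 / ?q) * z l)" if "l < m" for c l
        unfolding \<zeta>_def using carrier_matD[OF psdD(1)[OF K\<xi>[OF that]]] ij zl[OF that]
        by (simp add: z_def del: index_mult_mat(1))
      have "asm_scale (1 / ?q) (branch \<omega> \<sigma>) a\<^sub>f x\<^sub>f $$ (i, j) = complex_of_real (1 / ?q) * branch \<omega> \<sigma> a\<^sub>f x\<^sub>f $$ (i, j)"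
        unfolding asm_scale_def using ij carrier_matD[OF is_assemblageD(7)[OF branch_assemblage[OF sa \<omega>]]] by simp
      also have "branch \<omega> \<sigma> a\<^sub>f x\<^sub>f $$ (i, j) = (\<Sum>k\<in>{..<r} \<times> {..<s}. \<Sum>l<m.
          complex_of_real (P (snd k) x\<^sub>f \<omega> * Q a\<^sub>f (fst k) (snd k) \<omega> x\<^sub>f * R (fst k) (snd k) l) * z l)"
        unfolding branch_eq[OF af xf] mat_sum_index[OF ij]
      proof (rule sum.cong[OF refl])
        fix k assume "k \<in> {..<r} \<times> {..<s}"
        then have k: "fst k < r" "snd k < s" by auto
        have sm: "(complex_of_real c \<cdot>\<^sub>m (K \<omega> * \<sigma> (fst k) (snd k) * (K \<omega>)\<^sup>\<dagger>)) $$ (i, j) =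
            complex_of_real c * (K \<omega> * \<sigma> (fst k) (snd k) * (K \<omega>)\<^sup>\<dagger>) $$ (i, j)" for c
          using carrier_matD[OF K_rho_carrier[OF sa \<omega>]] ij by (simp del: index_mult_mat(1))
        show "(complex_of_real (P (snd k) x\<^sub>f \<omega> * Q a\<^sub>f (fst k) (snd k) \<omega> x\<^sub>f) \<cdot>\<^sub>m
            (K \<omega> * \<sigma> (fst k) (snd k) * (K \<omega>)\<^sup>\<dagger>)) $$ (i, j) =
            (\<Sum>l<m. complex_of_real (P (snd k) x\<^sub>f \<omega> * Q a\<^sub>f (fst k) (snd k) \<omega> x\<^sub>f * R (fst k) (snd k) l) * z l)"
          unfolding sm zk[OF k] sum_distrib_left by (simp only: of_real_mult mult.assoc)
      qed
      also have "\<dots> = (\<Sum>l<m. complex_of_real (W a\<^sub>f x\<^sub>f l) * z l)"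
        unfolding W_def by (subst sum.swap) (simp only: of_real_sum sum_distrib_right)
      also have "complex_of_real (1 / ?q) * \<dots> = (\<Sum>l<m. complex_of_real (W a\<^sub>f x\<^sub>f l) * (complex_of_real (1 / ?q) * z l))"
        unfolding sum_distrib_left by (intro sum.cong refl) (simp only: mult.left_commute)
      also have "\<dots> = (\<Sum>l<m. (complex_of_real (W a\<^sub>f x\<^sub>f l) \<cdot>\<^sub>m \<zeta> l) $$ (i, j))"
        by (intro sum.cong refl) (simp only: \<zeta>l lessThan_iff)
      finally show "asm_scale (1 / ?q) (branch \<omega> \<sigma>) a\<^sub>f x\<^sub>f $$ (i, j) =
          mat_sum d\<^sub>f d\<^sub>f {..<m} (\<lambda>l. complex_of_real (W a\<^sub>f x\<^sub>f l) \<cdot>\<^sub>m \<zeta> l) $$ (i, j)"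
        unfolding mat_sum_index[OF ij] .
    qed (use carrier_matD[OF is_assemblageD(7)[OF branch_assemblage[OF sa \<omega>]]] in \<open>simp_all add: asm_scale_def\<close>)
    show "asm_scale (1 / ?q) (branch \<omega> \<sigma>) a\<^sub>f x\<^sub>f = 0\<^sub>m d\<^sub>f d\<^sub>f" if "\<not> (a\<^sub>f < r\<^sub>f \<and> x\<^sub>f < s\<^sub>f)" for a\<^sub>f x\<^sub>f
      unfolding asm_scale_def is_assemblageD(5)[OF branch_assemblage[OF sa \<omega>] that] by auto
    show "(\<Sum>l<m. Re (mat_trace (\<zeta> l))) = 1"
    proof -
      have "rho_B d r \<sigma> = mat_sum d d {..<m} \<xi>"
        unfolding rho_B_def
        by (rule response_marginal[where P = "\<lambda>a l. R a 0 l"]) (use psdD(1)[OF \<xi>] R1 \<sigma>_eq dims in auto)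
      moreover have "K \<omega> * mat_sum d d {..<m} \<xi> * (K \<omega>)\<^sup>\<dagger> = mat_sum d\<^sub>f d\<^sub>f {..<m} (\<lambda>l. K \<omega> * \<xi> l * (K \<omega>)\<^sup>\<dagger>)"
        by (rule congruence_mat_sum[OF K[OF \<omega>]]) (use psdD(1)[OF \<xi>] in auto)
      ultimately have "rho_B d\<^sub>f r\<^sub>f (branch \<omega> \<sigma>) = mat_sum d\<^sub>f d\<^sub>f {..<m} (\<lambda>l. K \<omega> * \<xi> l * (K \<omega>)\<^sup>\<dagger>)"
        unfolding branch_rho_B[OF sa \<omega>] by simp
      then have "?q = (\<Sum>l<m. Re (mat_trace (K \<omega> * \<xi> l * (K \<omega>)\<^sup>\<dagger>)))"
        unfolding asm_trace_def using trace_mat_sum[of "{..<m}" "\<lambda>l. K \<omega> * \<xi> l * (K \<omega>)\<^sup>\<dagger>" d\<^sub>f] psdD(1)[OF K\<xi>]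
        by simp
      moreover have "(\<Sum>l<m. Re (mat_trace (\<zeta> l))) = (\<Sum>l<m. 1 / ?q * Re (mat_trace (K \<omega> * \<xi> l * (K \<omega>)\<^sup>\<dagger>)))"
        unfolding \<zeta>_def by (intro sum.cong refl) (simp add: trace_smult[OF psdD(1)[OF K\<xi>]])
      ultimately show ?thesis using q by (simp flip: sum_distrib_left sum_divide_distrib)
    qed
  qed simp
qed

text \<open>A component of the branch is a weighted sum of conjugated components of the original
  assemblage, so joint convexity undoes the classical processing. The weights \<open>Q\<close> sum
  to 1 over the final outputs, and what remains is the distribution of the original input obtained
  by composing \<open>R\<close> with \<open>P\<close>.\<close>

lemma branch_asm_value_le:
  assumes \<rho>: "is_assemblage d r s \<rho>" and \<sigma>: "is_assemblage d r s \<sigma>" and \<omega>: "\<omega> < n"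
    and m: "is_measurement d\<^sub>f d\<^sub>f s\<^sub>f g E R"
  shows "asm_value d\<^sub>f r\<^sub>f s\<^sub>f g E R (branch \<omega> \<rho>) (branch \<omega> \<sigma>) \<le>
    (\<Sum>\<gamma><g. \<Sum>x<s. \<Sum>a<r. ennreal (\<Sum>x\<^sub>f<s\<^sub>f. R x\<^sub>f \<gamma> * P x x\<^sub>f \<omega>) *
      divergence d\<^sub>f ((E \<gamma> * K \<omega>) * \<rho> a x * (E \<gamma> * K \<omega>)\<^sup>\<dagger>) ((E \<gamma> * K \<omega>) * \<sigma> a x * (E \<gamma> * K \<omega>)\<^sup>\<dagger>))"
proof -
  let ?I = "{..<r} \<times> {..<s}"
  define D where "D = (\<lambda>\<gamma> k. divergence d\<^sub>f ((E \<gamma> * K \<omega>) * \<rho> (fst k) (snd k) * (E \<gamma> * K \<omega>)\<^sup>\<dagger>)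
    ((E \<gamma> * K \<omega>) * \<sigma> (fst k) (snd k) * (E \<gamma> * K \<omega>)\<^sup>\<dagger>))"
  have cong: "E \<gamma> * branch \<omega> \<tau> a\<^sub>f x\<^sub>f * (E \<gamma>)\<^sup>\<dagger> = mat_sum d\<^sub>f d\<^sub>f ?I
      (\<lambda>k. complex_of_real (P (snd k) x\<^sub>f \<omega> * Q a\<^sub>f (fst k) (snd k) \<omega> x\<^sub>f) \<cdot>\<^sub>m
        ((E \<gamma> * K \<omega>) * \<tau> (fst k) (snd k) * (E \<gamma> * K \<omega>)\<^sup>\<dagger>))"
    if \<tau>: "is_assemblage d r s \<tau>" and "\<gamma> < g" and fx: "a\<^sub>f < r\<^sub>f" "x\<^sub>f < s\<^sub>f" for \<tau> \<gamma> a\<^sub>f x\<^sub>f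
  proof -
    note E = is_measurementD(1)[OF m \<open>\<gamma> < g\<close>] and c = K_rho_carrier[OF \<tau> \<omega>]
    show ?thesis
      unfolding branch_eq[OF fx] congruence_mult[OF E K[OF \<omega>] is_assemblageD(7)[OF \<tau>]] congruence_smult[OF E c, symmetric]
      by (rule congruence_mat_sum[OF E]) (use c in auto)
  qed
  have step: "divergence d\<^sub>f (E \<gamma> * branch \<omega> \<rho> a\<^sub>f x\<^sub>f * (E \<gamma>)\<^sup>\<dagger>) (E \<gamma> * branch \<omega> \<sigma> a\<^sub>f x\<^sub>f * (E \<gamma>)\<^sup>\<dagger>) \<le>
      (\<Sum>k\<in>?I. ennreal (P (snd k) x\<^sub>f \<omega> * Q a\<^sub>f (fst k) (snd k) \<omega> x\<^sub>f) * D \<gamma> k)"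
    if \<gamma>: "\<gamma> < g" and fx: "a\<^sub>f < r\<^sub>f" "x\<^sub>f < s\<^sub>f" for \<gamma> a\<^sub>f x\<^sub>f
    unfolding D_def cong[OF \<rho> \<gamma> fx] cong[OF \<sigma> \<gamma> fx]
  proof (rule divergence_weighted_sum_le)
    fix k assume "k \<in> ?I"
    then have k: "fst k < r" "snd k < s" by auto
    note EK = mult_carrier_mat[OF is_measurementD(1)[OF m \<gamma>] K[OF \<omega>]]
    show "psd d\<^sub>f ((E \<gamma> * K \<omega>) * \<rho> (fst k) (snd k) * (E \<gamma> * K \<omega>)\<^sup>\<dagger>)" "psd d\<^sub>f ((E \<gamma> * K \<omega>) * \<sigma> (fst k) (snd k) * (E \<gamma> * K \<omega>)\<^sup>\<dagger>)"
      by (rule psd_congruence[OF is_assemblageD(4)[OF \<rho> k] EK], rule psd_congruence[OF is_assemblageD(4)[OF \<sigma> k] EK])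
    show "0 \<le> P (snd k) x\<^sub>f \<omega> * Q a\<^sub>f (fst k) (snd k) \<omega> x\<^sub>f"
      using P(1)[OF \<omega> fx(2) k(2)] Q(1)[OF \<omega> fx(2) k fx(1)] by simp
  qed
  have "asm_value d\<^sub>f r\<^sub>f s\<^sub>f g E R (branch \<omega> \<rho>) (branch \<omega> \<sigma>) \<le>
      (\<Sum>\<gamma><g. \<Sum>x\<^sub>f<s\<^sub>f. \<Sum>a\<^sub>f<r\<^sub>f. ennreal (R x\<^sub>f \<gamma>) * (\<Sum>k\<in>?I. ennreal (P (snd k) x\<^sub>f \<omega> * Q a\<^sub>f (fst k) (snd k) \<omega> x\<^sub>f) * D \<gamma> k))"
    unfolding asm_value_def by (intro sum_mono mult_left_mono step) auto
  also have "\<dots> = (\<Sum>\<gamma><g. \<Sum>k\<in>?I. ennreal (\<Sum>x\<^sub>f<s\<^sub>f. R x\<^sub>f \<gamma> * P (snd k) x\<^sub>f \<omega>) * D \<gamma> k)"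
  proof (rule sum.cong[OF refl])
    fix \<gamma> assume "\<gamma> \<in> {..<g}"
    then have \<gamma>: "\<gamma> < g" by simp
    have "(\<Sum>x\<^sub>f<s\<^sub>f. \<Sum>a\<^sub>f<r\<^sub>f. ennreal (R x\<^sub>f \<gamma>) * (\<Sum>k\<in>?I. ennreal (P (snd k) x\<^sub>f \<omega> * Q a\<^sub>f (fst k) (snd k) \<omega> x\<^sub>f) * D \<gamma> k)) =
        (\<Sum>x\<^sub>f<s\<^sub>f. \<Sum>a\<^sub>f<r\<^sub>f. \<Sum>k\<in>?I. ennreal (R x\<^sub>f \<gamma> * P (snd k) x\<^sub>f \<omega> * Q a\<^sub>f (fst k) (snd k) \<omega> x\<^sub>f) * D \<gamma> k)"
      unfolding sum_distrib_left
    proof (intro sum.cong refl)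
      fix x\<^sub>f a\<^sub>f k assume "x\<^sub>f \<in> {..<s\<^sub>f}"
      then have "0 \<le> R x\<^sub>f \<gamma>" using is_measurementD(3)[OF m \<gamma>] by simp
      then show "ennreal (R x\<^sub>f \<gamma>) * (ennreal (P (snd k) x\<^sub>f \<omega> * Q a\<^sub>f (fst k) (snd k) \<omega> x\<^sub>f) * D \<gamma> k) =
          ennreal (R x\<^sub>f \<gamma> * P (snd k) x\<^sub>f \<omega> * Q a\<^sub>f (fst k) (snd k) \<omega> x\<^sub>f) * D \<gamma> k"
        by (simp add: mult.assoc ennreal_mult')
    qed
    also have "\<dots> = (\<Sum>k\<in>?I. (\<Sum>x\<^sub>f<s\<^sub>f. \<Sum>a\<^sub>f<r\<^sub>f. ennreal (R x\<^sub>f \<gamma> * P (snd k) x\<^sub>f \<omega> * Q a\<^sub>f (fst k) (snd k) \<omega> x\<^sub>f)) * D \<gamma> k)"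
      unfolding sum_distrib_right by (subst (2) sum.swap, subst sum.swap) (rule refl)
    also have "\<dots> = (\<Sum>k\<in>?I. ennreal (\<Sum>x\<^sub>f<s\<^sub>f. R x\<^sub>f \<gamma> * P (snd k) x\<^sub>f \<omega>) * D \<gamma> k)"
    proof (rule sum.cong[OF refl], rule arg_cong2[of _ _ _ _ "(*)"])
      fix k assume "k \<in> ?I"
      then have k: "fst k < r" "snd k < s" by auto
      have "(\<Sum>x\<^sub>f<s\<^sub>f. \<Sum>a\<^sub>f<r\<^sub>f. ennreal (R x\<^sub>f \<gamma> * P (snd k) x\<^sub>f \<omega> * Q a\<^sub>f (fst k) (snd k) \<omega> x\<^sub>f)) =
          ennreal (\<Sum>x\<^sub>f<s\<^sub>f. \<Sum>a\<^sub>f<r\<^sub>f. R x\<^sub>f \<gamma> * P (snd k) x\<^sub>f \<omega> * Q a\<^sub>f (fst k) (snd k) \<omega> x\<^sub>f)"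
        by (intro sum_sum_ennreal mult_nonneg_nonneg is_measurementD(3)[OF m \<gamma>] P(1)[OF \<omega>] Q(1)[OF \<omega>] k)
      also have "(\<Sum>x\<^sub>f<s\<^sub>f. \<Sum>a\<^sub>f<r\<^sub>f. R x\<^sub>f \<gamma> * P (snd k) x\<^sub>f \<omega> * Q a\<^sub>f (fst k) (snd k) \<omega> x\<^sub>f) =
          (\<Sum>x\<^sub>f<s\<^sub>f. R x\<^sub>f \<gamma> * P (snd k) x\<^sub>f \<omega>)"
        by (intro sum.cong refl) (use Q(2)[OF \<omega> _ k] in \<open>simp flip: sum_distrib_left\<close>)
      finally show "(\<Sum>x\<^sub>f<s\<^sub>f. \<Sum>a\<^sub>f<r\<^sub>f. ennreal (R x\<^sub>f \<gamma> * P (snd k) x\<^sub>f \<omega> * Q a\<^sub>f (fst k) (snd k) \<omega> x\<^sub>f)) =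
          ennreal (\<Sum>x\<^sub>f<s\<^sub>f. R x\<^sub>f \<gamma> * P (snd k) x\<^sub>f \<omega>)" .
    qed (rule refl)
    finally show "(\<Sum>x\<^sub>f<s\<^sub>f. \<Sum>a\<^sub>f<r\<^sub>f. ennreal (R x\<^sub>f \<gamma>) * (\<Sum>k\<in>?I. ennreal (P (snd k) x\<^sub>f \<omega> * Q a\<^sub>f (fst k) (snd k) \<omega> x\<^sub>f) * D \<gamma> k)) =
        (\<Sum>k\<in>?I. ennreal (\<Sum>x\<^sub>f<s\<^sub>f. R x\<^sub>f \<gamma> * P (snd k) x\<^sub>f \<omega>) * D \<gamma> k)" .
  qed
  also have "\<dots> = (\<Sum>\<gamma><g. \<Sum>a<r. \<Sum>x<s. ennreal (\<Sum>x\<^sub>f<s\<^sub>f. R x\<^sub>f \<gamma> * P x x\<^sub>f \<omega>) * D \<gamma> (a, x))"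
    unfolding sum.cartesian_product by (simp add: case_prod_beta)
  also have "\<dots> = (\<Sum>\<gamma><g. \<Sum>x<s. \<Sum>a<r. ennreal (\<Sum>x\<^sub>f<s\<^sub>f. R x\<^sub>f \<gamma> * P x x\<^sub>f \<omega>) * D \<gamma> (a, x))"
    by (rule sum.cong[OF refl], rule sum.swap)
  finally show ?thesis unfolding D_def fst_conv snd_conv .
qed

text \<open>Measuring \<open>E \<omega>\<close> after outcome \<open>\<omega>\<close> of the LOCC is the single measurement with operators
  \<open>E \<omega> \<gamma> * K \<omega>\<close> on the original assemblage.\<close>

lemma sum_branch_asm_value_le:
  assumes \<rho>: "\<rho> \<in> normalised_assemblages d r s" and \<sigma>: "\<sigma> \<in> normalised_assemblages d r s"
    and m: "\<And>\<omega>. \<omega> < n \<Longrightarrow> is_measurement d\<^sub>f d\<^sub>f s\<^sub>f (g \<omega>) (E \<omega>) (R \<omega>)"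
  shows "enn2ereal (\<Sum>\<omega><n. asm_value d\<^sub>f r\<^sub>f s\<^sub>f (g \<omega>) (E \<omega>) (R \<omega>) (branch \<omega> \<rho>) (branch \<omega> \<sigma>)) \<le> S_A d r s \<rho> \<sigma>"
proof -
  note ra = normalisedD(1)[OF \<rho>] and sa = normalisedD(1)[OF \<sigma>]
  let ?I = "SIGMA \<omega>:{..<n}. {..<g \<omega>}"
  define F where "F = (\<lambda>k. E (fst k) (snd k) * K (fst k))"
  \<comment> \<open>The distribution of the original input given both outcomes: a final input is
    drawn from \<open>R\<close>, then the original input from \<open>P\<close>.\<close>
  define T where "T = (\<lambda>k x. \<Sum>x\<^sub>f<s\<^sub>f. R (fst k) x\<^sub>f (snd k) * P x x\<^sub>f (fst k))"
  have F: "F k \<in> carrier_mat d\<^sub>f d" if "k \<in> ?I" for k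
    unfolding F_def by (rule mult_carrier_mat[OF is_measurementD(1)[OF m] K]) (use that in auto)
  have "(\<Sum>\<omega><n. asm_value d\<^sub>f r\<^sub>f s\<^sub>f (g \<omega>) (E \<omega>) (R \<omega>) (branch \<omega> \<rho>) (branch \<omega> \<sigma>)) \<le>
      (\<Sum>\<omega><n. \<Sum>\<gamma><g \<omega>. \<Sum>x<s. \<Sum>a<r. ennreal (\<Sum>x\<^sub>f<s\<^sub>f. R \<omega> x\<^sub>f \<gamma> * P x x\<^sub>f \<omega>) *
      divergence d\<^sub>f ((E \<omega> \<gamma> * K \<omega>) * \<rho> a x * (E \<omega> \<gamma> * K \<omega>)\<^sup>\<dagger>) ((E \<omega> \<gamma> * K \<omega>) * \<sigma> a x * (E \<omega> \<gamma> * K \<omega>)\<^sup>\<dagger>))"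
    by (rule sum_mono) (rule branch_asm_value_le[OF ra sa _ m]; simp)
  also have "\<dots> = (\<Sum>k\<in>?I. \<Sum>x<s. \<Sum>a<r. ennreal (T k x) * divergence d\<^sub>f (F k * \<rho> a x * (F k)\<^sup>\<dagger>) (F k * \<sigma> a x * (F k)\<^sup>\<dagger>))"
    unfolding F_def T_def by (subst sum.Sigma) (auto simp: case_prod_beta)
  finally have le: "(\<Sum>\<omega><n. asm_value d\<^sub>f r\<^sub>f s\<^sub>f (g \<omega>) (E \<omega>) (R \<omega>) (branch \<omega> \<rho>) (branch \<omega> \<sigma>)) \<le>
      (\<Sum>k\<in>?I. \<Sum>x<s. \<Sum>a<r. ennreal (T k x) * divergence d\<^sub>f (F k * \<rho> a x * (F k)\<^sup>\<dagger>) (F k * \<sigma> a x * (F k)\<^sup>\<dagger>))" .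
  have "enn2ereal (\<Sum>k\<in>?I. \<Sum>x<s. \<Sum>a<r. ennreal (T k x) * divergence d\<^sub>f (F k * \<rho> a x * (F k)\<^sup>\<dagger>) (F k * \<sigma> a x * (F k)\<^sup>\<dagger>))
      \<le> S_A d r s \<rho> \<sigma>"
  proof (rule asm_value_le_S_A[OF \<rho> \<sigma> _ F])
    show "prob_dist s (T k)" if "k \<in> ?I" for k
    proof -
      have k: "fst k < n" "snd k < g (fst k)" using that by auto
      have "(\<Sum>x<s. T k x) = (\<Sum>x\<^sub>f<s\<^sub>f. R (fst k) x\<^sub>f (snd k) * (\<Sum>x<s. P x x\<^sub>f (fst k)))"
        unfolding T_def by (subst sum.swap) (simp add: sum_distrib_left)
      also have "\<dots> = 1" by (simp add: P(2)[OF k(1)] is_measurementD(4)[OF m[OF k(1)] k(2)])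
      finally show ?thesis
        unfolding prob_dist_def T_def
        using P(1)[OF k(1)] is_measurementD(3)[OF m[OF k(1)] k(2)] by (auto intro!: sum_nonneg mult_nonneg_nonneg)
    qed
    have inner: "mat_sum d d {..<g \<omega>} (\<lambda>\<gamma>. (E \<omega> \<gamma> * K \<omega>)\<^sup>\<dagger> * (E \<omega> \<gamma> * K \<omega>)) = (K \<omega>)\<^sup>\<dagger> * K \<omega>" if \<omega>: "\<omega> < n" for \<omega>
    proof -
      note k = K[OF \<omega>]
      have k': "(K \<omega>)\<^sup>\<dagger> \<in> carrier_mat d d\<^sub>f" using k by simp
      have "(E \<omega> \<gamma> * K \<omega>)\<^sup>\<dagger> * (E \<omega> \<gamma> * K \<omega>) = (K \<omega>)\<^sup>\<dagger> * ((E \<omega> \<gamma>)\<^sup>\<dagger> * E \<omega> \<gamma>) * ((K \<omega>)\<^sup>\<dagger>)\<^sup>\<dagger>" if "\<gamma> < g \<omega>" for \<gamma>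
      proof -
        note e = is_measurementD(1)[OF m[OF \<omega>] that]
        have e': "(E \<omega> \<gamma>)\<^sup>\<dagger> \<in> carrier_mat d\<^sub>f d\<^sub>f" using e by simp
        show ?thesis
          unfolding adjoint_mult[OF e k] adjoint_adjoint
          using assoc_mult_mat[OF k' e' mult_carrier_mat[OF e k]] assoc_mult_mat[OF e' e k]
            assoc_mult_mat[OF k' mult_carrier_mat[OF e' e] k] by simp
      qed
      then have "mat_sum d d {..<g \<omega>} (\<lambda>\<gamma>. (E \<omega> \<gamma> * K \<omega>)\<^sup>\<dagger> * (E \<omega> \<gamma> * K \<omega>)) =
          mat_sum d d {..<g \<omega>} (\<lambda>\<gamma>. (K \<omega>)\<^sup>\<dagger> * ((E \<omega> \<gamma>)\<^sup>\<dagger> * E \<omega> \<gamma>) * ((K \<omega>)\<^sup>\<dagger>)\<^sup>\<dagger>)"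
        by (intro mat_sum_cong refl) simp
      also have "\<dots> = (K \<omega>)\<^sup>\<dagger> * mat_sum d\<^sub>f d\<^sub>f {..<g \<omega>} (\<lambda>\<gamma>. (E \<omega> \<gamma>)\<^sup>\<dagger> * E \<omega> \<gamma>) * ((K \<omega>)\<^sup>\<dagger>)\<^sup>\<dagger>"
      proof (rule congruence_mat_sum[OF k', symmetric])
        fix \<gamma> assume "\<gamma> \<in> {..<g \<omega>}"
        then have e: "E \<omega> \<gamma> \<in> carrier_mat d\<^sub>f d\<^sub>f" using is_measurementD(1)[OF m[OF \<omega>]] by simp
        show "(E \<omega> \<gamma>)\<^sup>\<dagger> * E \<omega> \<gamma> \<in> carrier_mat d\<^sub>f d\<^sub>f" by (rule mult_carrier_mat[OF adjoint_carrier[OF e] e])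
      qed
      also have "\<dots> = (K \<omega>)\<^sup>\<dagger> * K \<omega>" unfolding is_measurementD(2)[OF m[OF \<omega>]] right_mult_one_mat[OF k'] by simp
      finally show ?thesis .
    qed
    show "mat_sum d d ?I (\<lambda>k. (F k)\<^sup>\<dagger> * F k) = 1\<^sub>m d"
    proof -
      have "mat_sum d d ?I (\<lambda>k. (F k)\<^sup>\<dagger> * F k) = mat_sum d d {..<n} (\<lambda>\<omega>. mat_sum d d {..<g \<omega>} (\<lambda>\<gamma>. (E \<omega> \<gamma> * K \<omega>)\<^sup>\<dagger> * (E \<omega> \<gamma> * K \<omega>)))"
        unfolding F_def by (rule eq_matI) (simp_all add: sum.Sigma case_prod_beta del: index_mult_mat(1))
      also have "\<dots> = mat_sum d d {..<n} (\<lambda>\<omega>. (K \<omega>)\<^sup>\<dagger> * K \<omega>)"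
        by (rule mat_sum_cong[OF refl]) (simp add: inner)
      finally show ?thesis unfolding K_sum .
    qed
  qed simp
  then show ?thesis using le unfolding less_eq_ennreal.rep_eq by (rule order_trans[rotated])
qed

text \<open>The Kraus operators of the LOCC are themselves a measurement. If \<open>\<sigma>\<close>
  excluded an outcome that \<open>\<rho>\<close> allows, this measurement alone would make
  \<open>S_A\<close> infinite.\<close>

lemma weight_pos:
  assumes \<rho>: "\<rho> \<in> normalised_assemblages d r s" and \<sigma>: "\<sigma> \<in> normalised_assemblages d r s"
    and fin: "S_A d r s \<rho> \<sigma> \<noteq> \<infinity>" and \<omega>: "\<omega> < n" and p: "0 < weight \<rho> \<omega>"
  shows "0 < weight \<sigma> \<omega>"
proof (rule ccontr)
  note ra = normalisedD(1)[OF \<rho>] and sa = normalisedD(1)[OF \<sigma>]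
  assume "\<not> 0 < weight \<sigma> \<omega>"
  then have q: "weight \<sigma> \<omega> = 0" using weight_eq(2)[OF sa \<omega>] by simp
  have s0: "0 < s" using dims by simp
  let ?D = "\<lambda>\<omega> x a. divergence d\<^sub>f (K \<omega> * \<rho> a x * (K \<omega>)\<^sup>\<dagger>) (K \<omega> * \<sigma> a x * (K \<omega>)\<^sup>\<dagger>)"
  \<comment> \<open>The input is always 0; any fixed input detects the outcome, as the probability
    of \<open>\<omega>\<close> is the same for each.\<close>
  let ?P = "\<lambda>(\<omega>::nat) (x::nat). if x = 0 then 1 else 0 :: real"
  have psd: "psd d\<^sub>f (K \<omega> * \<rho> a 0 * (K \<omega>)\<^sup>\<dagger>)" "psd d\<^sub>f (K \<omega> * \<sigma> a 0 * (K \<omega>)\<^sup>\<dagger>)" if "a < r" for a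
    by (rule psd_congruence[OF is_assemblageD(4)[OF ra that s0] K[OF \<omega>]], rule psd_congruence[OF is_assemblageD(4)[OF sa that s0] K[OF \<omega>]])
  have "(\<Sum>a<r. Re (mat_trace (K \<omega> * \<rho> a 0 * (K \<omega>)\<^sup>\<dagger>))) \<noteq> 0" using p unfolding weight_eq(1)[OF ra \<omega>] by simp
  then obtain a where "a \<in> {..<r}" "Re (mat_trace (K \<omega> * \<rho> a 0 * (K \<omega>)\<^sup>\<dagger>)) \<noteq> 0" by (rule sum.not_neutral_contains_not_neutral)
  then have a: "a < r" "0 < Re (mat_trace (K \<omega> * \<rho> a 0 * (K \<omega>)\<^sup>\<dagger>))" using psd_trace(2)[OF psd(1), of a] by auto
  have "\<forall>a\<in>{..<r}. Re (mat_trace (K \<omega> * \<sigma> a 0 * (K \<omega>)\<^sup>\<dagger>)) = 0"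
    using q unfolding weight_eq(1)[OF sa \<omega>]
    by (subst (asm) sum_nonneg_eq_0_iff) (auto intro: psd_trace(2)[OF psd(2)])
  then have "Re (mat_trace (K \<omega> * \<sigma> a 0 * (K \<omega>)\<^sup>\<dagger>)) = 0" using a(1) by simp
  then have "?D \<omega> 0 a = \<infinity>" by (intro divergence_zero_right psd a)
  then have "\<infinity> \<le> (\<Sum>a<r. ennreal (?P \<omega> 0) * ?D \<omega> 0 a)"
    using member_le_sum[of a "{..<r}" "\<lambda>a. ennreal (?P \<omega> 0) * ?D \<omega> 0 a"] a(1) by simp
  also have "\<dots> \<le> (\<Sum>x<s. \<Sum>a<r. ennreal (?P \<omega> x) * ?D \<omega> x a)"
    by (rule member_le_sum[of 0 "{..<s}" "\<lambda>x. \<Sum>a<r. ennreal (?P \<omega> x) * ?D \<omega> x a"]) (use s0 in auto)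
  also have "\<dots> \<le> (\<Sum>\<omega><n. \<Sum>x<s. \<Sum>a<r. ennreal (?P \<omega> x) * ?D \<omega> x a)"
    by (rule member_le_sum[of \<omega> "{..<n}" "\<lambda>\<omega>. \<Sum>x<s. \<Sum>a<r. ennreal (?P \<omega> x) * ?D \<omega> x a"]) (use \<omega> in auto)
  finally have inf: "(\<Sum>\<omega><n. \<Sum>x<s. \<Sum>a<r. ennreal (?P \<omega> x) * ?D \<omega> x a) = \<infinity>"
    unfolding infinity_ennreal_def top_unique .
  have "enn2ereal (\<Sum>\<omega><n. \<Sum>x<s. \<Sum>a<r. ennreal (?P \<omega> x) * ?D \<omega> x a) \<le> S_A d r s \<rho> \<sigma>"
    by (rule asm_value_le_S_A[OF \<rho> \<sigma> _ K K_sum]) (use s0 in \<open>auto simp: prob_dist_def\<close>)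
  then show False using fin unfolding inf by simp
qed

text \<open>For an optimal \<open>\<sigma>\<close> the normalised branches of
  \<open>\<sigma>\<close> compete in the minima for the branches of \<open>\<rho>\<close>. A
  measurement within \<open>e\<close> of the required value is chosen for each outcome; the combined
  measurement is bounded by \<open>S_A d r s \<rho> \<sigma>\<close>. The errors are weighted by
  probabilities and add up to \<open>e\<close>.\<close>

lemma S_R_monotone:
  assumes \<rho>: "\<rho> \<in> normalised_assemblages d r s"
  shows "(\<Sum>\<omega><n. if weight \<rho> \<omega> = 0 then 0 else weight \<rho> \<omega> *
      real_of_ereal (S_R d\<^sub>f r\<^sub>f s\<^sub>f (asm_scale (1 / weight \<rho> \<omega>) (branch \<omega> \<rho>)))) \<le> real_of_ereal (S_R d r s \<rho>)"
proof -
  note ra = normalisedD(1)[OF \<rho>]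
  obtain \<sigma> where \<sigma>: "\<sigma> \<in> LHS d r s" "S_R d r s \<rho> = S_A d r s \<rho> \<sigma>" by (rule S_R_attained[OF \<rho>])
  note ns = LHS_normalised[OF \<sigma>(1)]
  note sa = normalisedD(1)[OF ns]
  obtain y where y: "S_R d r s \<rho> = ereal y" by (rule S_R_finite[OF \<rho>])
  let ?p = "weight \<rho>" and ?q = "weight \<sigma>"
  define \<rho>' where "\<rho>' = (\<lambda>\<omega>. asm_scale (1 / ?p \<omega>) (branch \<omega> \<rho>))"
  define \<sigma>' where "\<sigma>' = (\<lambda>\<omega>. asm_scale (1 / ?q \<omega>) (branch \<omega> \<sigma>))"
  define z where "z = (\<lambda>\<omega>. real_of_ereal (S_R d\<^sub>f r\<^sub>f s\<^sub>f (\<rho>' \<omega>)))"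
  have le: "(\<Sum>\<omega><n. if ?p \<omega> = 0 then 0 else ?p \<omega> * z \<omega>) \<le> y + e" if e: "0 < e" for e
  proof -
    have "\<forall>\<omega>. \<exists>g E R. \<omega> < n \<longrightarrow> is_measurement d\<^sub>f d\<^sub>f s\<^sub>f g E R \<and>
        ereal (if ?p \<omega> = 0 then 0 else ?p \<omega> * (z \<omega> - e)) \<le> enn2ereal (asm_value d\<^sub>f r\<^sub>f s\<^sub>f g E R (branch \<omega> \<rho>) (branch \<omega> \<sigma>))"
    proof
      fix \<omega>
      show "\<exists>g E R. \<omega> < n \<longrightarrow> is_measurement d\<^sub>f d\<^sub>f s\<^sub>f g E R \<and>
        ereal (if ?p \<omega> = 0 then 0 else ?p \<omega> * (z \<omega> - e)) \<le> enn2ereal (asm_value d\<^sub>f r\<^sub>f s\<^sub>f g E R (branch \<omega> \<rho>) (branch \<omega> \<sigma>))"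
      proof (cases "\<omega> < n \<and> ?p \<omega> \<noteq> 0")
        \<comment> \<open>An outcome of probability 0 only needs some measurement with nonnegative
          value, and the trivial one serves.\<close>
        case False
        show ?thesis
        proof (intro exI impI conjI)
          show "is_measurement d\<^sub>f d\<^sub>f s\<^sub>f 1 (\<lambda>_. 1\<^sub>m d\<^sub>f) (\<lambda>x _. if x = 0 then 1 else 0)"
            by (rule trivial_measurement[OF dims(6)])
        qed (use False in \<open>simp flip: zero_ereal_def\<close>)
      next
        case True
        then have \<omega>: "\<omega> < n" and p: "0 < ?p \<omega>" using weight_eq(2)[OF ra, of \<omega>] by auto
        have q: "0 < ?q \<omega>" by (rule weight_pos[OF \<rho> ns _ \<omega> p]) (use \<sigma>(2) y in auto)
        have n\<rho>': "\<rho>' \<omega> \<in> normalised_assemblages d\<^sub>f r\<^sub>f s\<^sub>f" unfolding \<rho>'_def by (rule branch_normalised[OF ra \<omega> p])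
        have L\<sigma>': "\<sigma>' \<omega> \<in> LHS d\<^sub>f r\<^sub>f s\<^sub>f" unfolding \<sigma>'_def by (rule branch_LHS[OF \<sigma>(1) \<omega> q])
        note n\<sigma>' = LHS_normalised[OF L\<sigma>']
        obtain w where w: "S_R d\<^sub>f r\<^sub>f s\<^sub>f (\<rho>' \<omega>) = ereal w" by (rule S_R_finite[OF n\<rho>'])
        have zw: "z \<omega> = w" unfolding z_def w by simp
        have "ereal (z \<omega> - e) < ereal w" using e zw by simp
        also have "\<dots> \<le> S_A d\<^sub>f r\<^sub>f s\<^sub>f (\<rho>' \<omega>) (\<sigma>' \<omega>)" unfolding w[symmetric] S_R_def by (rule INF_lower[OF L\<sigma>'])
        finally obtain g E R where m: "is_measurement d\<^sub>f d\<^sub>f s\<^sub>f g E R"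
          and less: "ereal (z \<omega> - e) < enn2ereal (asm_value d\<^sub>f r\<^sub>f s\<^sub>f g E R (\<rho>' \<omega>) (\<sigma>' \<omega>))"
          by (rule S_A_less_witness[OF n\<rho>' n\<sigma>'])
        have inv: "asm_scale t (asm_scale (1 / t) M) = M" if "0 < t" for t M
          using that by (auto simp: asm_scale_def intro!: ext eq_matI)
        have "ereal (?p \<omega> * (z \<omega> - e)) = ereal (?p \<omega>) * ereal (z \<omega> - e)" by simp
        also have "\<dots> \<le> ereal (?p \<omega>) * enn2ereal (asm_value d\<^sub>f r\<^sub>f s\<^sub>f g E R (\<rho>' \<omega>) (\<sigma>' \<omega>))"
          by (rule ereal_mult_left_mono) (use less p in auto)
        also have "\<dots> = enn2ereal (ennreal (?p \<omega>) * asm_value d\<^sub>f r\<^sub>f s\<^sub>f g E R (\<rho>' \<omega>) (\<sigma>' \<omega>))"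
          using p by (simp add: times_ennreal.rep_eq)
        \<comment> \<open>The branches of \<open>\<rho>\<close> and \<open>\<sigma>\<close> have
          different probabilities. Undoing both normalisations can only raise the value.\<close>
        also have "\<dots> \<le> enn2ereal (asm_value d\<^sub>f r\<^sub>f s\<^sub>f g E R (branch \<omega> \<rho>) (branch \<omega> \<sigma>))"
          using asm_value_scale[OF n\<rho>' n\<sigma>' m p q] unfolding \<rho>'_def \<sigma>'_def inv[OF p] inv[OF q] less_eq_ennreal.rep_eq .
        finally have "ereal (if ?p \<omega> = 0 then 0 else ?p \<omega> * (z \<omega> - e)) \<le>
            enn2ereal (asm_value d\<^sub>f r\<^sub>f s\<^sub>f g E R (branch \<omega> \<rho>) (branch \<omega> \<sigma>))" using p by simp
        then show ?thesis using m by blast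
      qed
    qed
    then obtain g E R where *: "\<forall>\<omega>. \<omega> < n \<longrightarrow> is_measurement d\<^sub>f d\<^sub>f s\<^sub>f (g \<omega>) (E \<omega>) (R \<omega>) \<and>
        ereal (if ?p \<omega> = 0 then 0 else ?p \<omega> * (z \<omega> - e)) \<le>
          enn2ereal (asm_value d\<^sub>f r\<^sub>f s\<^sub>f (g \<omega>) (E \<omega>) (R \<omega>) (branch \<omega> \<rho>) (branch \<omega> \<sigma>))"
      unfolding choice_iff by blast
    then have m: "is_measurement d\<^sub>f d\<^sub>f s\<^sub>f (g \<omega>) (E \<omega>) (R \<omega>)" if "\<omega> < n" for \<omega> using that by blast
    have "ereal (\<Sum>\<omega><n. if ?p \<omega> = 0 then 0 else ?p \<omega> * (z \<omega> - e)) =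
        (\<Sum>\<omega><n. ereal (if ?p \<omega> = 0 then 0 else ?p \<omega> * (z \<omega> - e)))" by simp
    also have "\<dots> \<le> (\<Sum>\<omega><n. enn2ereal (asm_value d\<^sub>f r\<^sub>f s\<^sub>f (g \<omega>) (E \<omega>) (R \<omega>) (branch \<omega> \<rho>) (branch \<omega> \<sigma>)))"
      by (rule sum_mono) (use * in blast)
    also have "\<dots> = enn2ereal (\<Sum>\<omega><n. asm_value d\<^sub>f r\<^sub>f s\<^sub>f (g \<omega>) (E \<omega>) (R \<omega>) (branch \<omega> \<rho>) (branch \<omega> \<sigma>))"
      by (rule sum_enn2ereal) simp
    also have "\<dots> \<le> S_A d r s \<rho> \<sigma>" by (rule sum_branch_asm_value_le[OF \<rho> ns m])
    also have "\<dots> = ereal y" using \<sigma>(2) y by simp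
    finally have "(\<Sum>\<omega><n. if ?p \<omega> = 0 then 0 else ?p \<omega> * (z \<omega> - e)) \<le> y" by simp
    moreover have "(\<Sum>\<omega><n. if ?p \<omega> = 0 then 0 else ?p \<omega> * (z \<omega> - e)) =
        (\<Sum>\<omega><n. (if ?p \<omega> = 0 then 0 else ?p \<omega> * z \<omega>) - e * ?p \<omega>)"
      by (intro sum.cong refl) (simp add: algebra_simps)
    moreover have "\<dots> = (\<Sum>\<omega><n. if ?p \<omega> = 0 then 0 else ?p \<omega> * z \<omega>) - e"
      using sum_weight[OF \<rho>] by (simp add: sum_subtractf flip: sum_distrib_left)
    ultimately show ?thesis by simp
  qed
  have "(\<Sum>\<omega><n. if ?p \<omega> = 0 then 0 else ?p \<omega> * z \<omega>) \<le> y" by (rule field_le_epsilon) (rule le)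
  then show ?thesis unfolding y z_def \<rho>'_def by simp
qed

end

text \<open>Since \<open>real_of_ereal\<close> sends infinite values to 0, the first conjunct
  records that the infimum is a finite, attained minimum, so the real-valued function in the second
  conjunct is the relative entropy of steering itself.\<close>

theorem theorem2:
  shows "(\<forall>d r s. \<forall>\<rho> \<in> normalised_assemblages d r s.
            (\<exists>\<sigma> \<in> LHS d r s. S_R d r s \<rho> = S_A d r s \<rho> \<sigma>) \<and> \<bar>S_R d r s \<rho>\<bar> \<noteq> \<infinity>) \<and>
         convex_steering_monotone (\<lambda>d r s \<rho>. real_of_ereal (S_R d r s \<rho>))"
proof
  show "\<forall>d r s. \<forall>\<rho> \<in> normalised_assemblages d r s.
            (\<exists>\<sigma> \<in> LHS d r s. S_R d r s \<rho> = S_A d r s \<rho> \<sigma>) \<and> \<bar>S_R d r s \<rho>\<bar> \<noteq> \<infinity>"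
  proof (intro allI ballI)
    fix d r s \<rho> assume \<rho>: "\<rho> \<in> normalised_assemblages d r s"
    obtain \<sigma> where "\<sigma> \<in> LHS d r s" "S_R d r s \<rho> = S_A d r s \<rho> \<sigma>" by (rule S_R_attained[OF \<rho>])
    moreover obtain y where "S_R d r s \<rho> = ereal y" by (rule S_R_finite[OF \<rho>])
    ultimately show "(\<exists>\<sigma> \<in> LHS d r s. S_R d r s \<rho> = S_A d r s \<rho> \<sigma>) \<and> \<bar>S_R d r s \<rho>\<bar> \<noteq> \<infinity>" by auto
  qed
  have nonneg: "0 \<le> real_of_ereal (S_R d r s \<rho>)" if \<rho>: "\<rho> \<in> normalised_assemblages d r s" for d r s \<rho>
  proof -
    obtain y where "S_R d r s \<rho> = ereal y" "0 \<le> y" by (rule S_R_finite[OF \<rho>])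
    then show ?thesis by simp
  qed
  have zero: "real_of_ereal (S_R d r s \<rho>) = 0" if \<rho>: "\<rho> \<in> LHS d r s" for d r s \<rho>
  proof -
    note n = LHS_normalised[OF \<rho>]
    obtain y where y: "S_R d r s \<rho> = ereal y" "0 \<le> y" by (rule S_R_finite[OF n])
    have "S_R d r s \<rho> \<le> S_A d r s \<rho> \<rho>" unfolding S_R_def by (rule INF_lower[OF \<rho>])
    then show ?thesis using y unfolding S_A_self[OF n] by (simp add: zero_ereal_def)
  qed
  have "steering_monotone (\<lambda>d r s \<rho>. real_of_ereal (S_R d r s \<rho>))"
    unfolding steering_monotone_def Let_def
  proof (intro conjI allI ballI impI nonneg zero)
    fix d r s d\<^sub>f r\<^sub>f s\<^sub>f n K P Q \<rho>
    assume "is_locc d r s d\<^sub>f r\<^sub>f s\<^sub>f n K P Q" and \<rho>: "\<rho> \<in> normalised_assemblages d r s"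
    then interpret one_way_locc d r s d\<^sub>f r\<^sub>f s\<^sub>f n K P Q by (simp add: one_way_locc_def)
    show "(\<Sum>\<omega><n. if weight \<rho> \<omega> = 0 then 0 else weight \<rho> \<omega> *
      real_of_ereal (S_R d\<^sub>f r\<^sub>f s\<^sub>f (asm_scale (1 / weight \<rho> \<omega>) (branch \<omega> \<rho>)))) \<le> real_of_ereal (S_R d r s \<rho>)"
      by (rule S_R_monotone[OF \<rho>])
  qed
  then show "convex_steering_monotone (\<lambda>d r s \<rho>. real_of_ereal (S_R d r s \<rho>))"
    unfolding convex_steering_monotone_def using S_R_convex by blast
qed

end
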